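(* Let $m,k,l$ be integers with $m\ge 2$, $1\le k\le l$ and $\gcd(m,k,l)=1$. Then the boundary $L$ of the Milnor fiber of $f(x,y,z)=z^m-x^ky^l$ is a Seifert manifold, and its Seifert foliation can be chosen so that the projection $(x,y,z)\mapsto z$ onto the $z$-axis is constant on each Seifert leaf.
   Context: For $r>0$ let $B^2_r\subset\mathbf{C}$ be the closed disc of radius $r$ centered at $0$. Choose $0<\alpha\le\epsilon$ with $\alpha^{k+l}<\epsilon^m$, let $B(\alpha)=B^2_\alpha\times B^2_\alpha\times B^2_\epsilon\subset\mathbf{C}^3$ and let $S$ be the boundary of $B(\alpha)$. Choose $\eta$ with $0<\eta\ll\alpha$ such that $f$ restricted to $B(\alpha)\cap f^{-1}(B^2_\eta\setminus\{0\})$ is a locally trivial fibration over $B^2_\eta\setminus\{0\}$ and such that $f^{-1}(t)\cap S\subset\{|x|=\alpha\text{ or }|y|=\alpha\}$ whenever $|t|\le\eta$ (such $\eta$ exists). Fix $t$ with $0<|t|\le\eta$. The Milnor fiber is $F_t=B(\alpha)\cap f^{-1}(t)$, and the boundary of the Milnor fiber is $L=F_t\cap S$, a closed 3-manifold (corners along $|x|=|y|=\alpha$ being smoothed), oriented as the boundary of the complex surface $F_t$. A Seifert manifold is a compact oriented 3-manifold foliated by circles (the Seifert leaves) in the sense of Seifert. *)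

theory Defs
  imports "HOL-Analysis.Analysis"
begin

section \<open>Smooth maps\<close>

text \<open>
  Intended for open \<open>S\<close> (the derivatives are two-sided). As the domain is finite-dimensional,
  continuity of the derivative is tested direction by direction.
\<close>

primrec Ck_on :: "nat \<Rightarrow> 'a::euclidean_space set \<Rightarrow> ('a \<Rightarrow> 'b::real_normed_vector) \<Rightarrow> bool" where
  "Ck_on 0 S f \<longleftrightarrow> continuous_on S f"
| "Ck_on (Suc n) S f \<longleftrightarrow>
     (\<forall>x\<in>S. f differentiable (at x)) \<and> (\<forall>v. Ck_on n S (\<lambda>x. frechet_derivative f (at x) v))"

definition smooth_on :: "'a::euclidean_space set \<Rightarrow> ('a \<Rightarrow> 'b::real_normed_vector) \<Rightarrow> bool" where
  "smooth_on S f \<longleftrightarrow> (\<forall>n. Ck_on n S f)"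

definition jacobian :: "(real^'n \<Rightarrow> real^'n) \<Rightarrow> real^'n \<Rightarrow> real" where
  "jacobian f p = det (matrix (frechet_derivative f (at p)))"


section \<open>Oriented manifolds\<close>

text \<open>
  A chart is a pair \<open>(U, \<phi>)\<close>; only the values of \<open>\<phi>\<close> on \<open>U\<close> matter, and \<open>inv_into U \<phi>\<close> is the
  local parametrisation inverse to it. All manifolds here are without boundary.
\<close>

type_synonym ('a, 'n) chart = "'a set \<times> ('a \<Rightarrow> real^'n)"

definition is_chart :: "'a topology \<Rightarrow> 'a set \<Rightarrow> ('a \<Rightarrow> real^'n) \<Rightarrow> bool" where
  "is_chart X U \<phi> \<longleftrightarrow>
     openin X U \<and> (\<exists>V. open V \<and> homeomorphic_map (subtopology X U) (top_of_set V) \<phi>)"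

definition oriented_smooth_atlas :: "'a topology \<Rightarrow> ('a, 'n::finite) chart set \<Rightarrow> bool" where
  "oriented_smooth_atlas X A \<longleftrightarrow>
     (\<forall>(U, \<phi>)\<in>A. is_chart X U \<phi>) \<and>
     \<Union>(fst ` A) = topspace X \<and>
     (\<forall>(U, \<phi>)\<in>A. \<forall>(V, \<psi>)\<in>A.
        smooth_on (\<phi> ` (U \<inter> V)) (\<psi> \<circ> inv_into U \<phi>) \<and>
        (\<forall>p\<in>\<phi> ` (U \<inter> V). jacobian (\<psi> \<circ> inv_into U \<phi>) p > 0))"

definition closed_oriented_manifold :: "'a topology \<Rightarrow> ('a, 'n::finite) chart set \<Rightarrow> bool" where
  "closed_oriented_manifold X A \<longleftrightarrow>
     compact_space X \<and> Hausdorff_space X \<and> second_countable X \<and> oriented_smooth_atlas X A"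

text \<open>For a continuous \<open>\<Phi>\<close> from the open set \<open>D\<close> into the manifold with atlas \<open>A\<close>.\<close>

definition local_diffeo_on ::
  "('a, 'n::finite) chart set \<Rightarrow> (real^'n) set \<Rightarrow> (real^'n \<Rightarrow> 'a) \<Rightarrow> bool" where
  "local_diffeo_on A D \<Phi> \<longleftrightarrow>
     (\<forall>(U, \<phi>)\<in>A. smooth_on {p \<in> D. \<Phi> p \<in> U} (\<phi> \<circ> \<Phi>) \<and>
        (\<forall>p\<in>D. \<Phi> p \<in> U \<longrightarrow> jacobian (\<phi> \<circ> \<Phi>) p \<noteq> 0))"


section \<open>Seifert manifolds\<close>

text \<open>
  The fibred solid torus of type \<open>(p, q)\<close> is the quotient of \<open>D \<times> \<real>\<close> (\<open>D\<close> the open unit disc) by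
  \<open>(\<zeta>, s) \<sim> (exp (2\<pi>ip/q) \<zeta>, s + 1)\<close>, foliated by the images of the lines \<open>{\<zeta>} \<times> \<real>\<close>. The map
  \<open>(\<zeta>, s) \<mapsto> (exp (-2\<pi>ips/q) \<zeta>, exp (2\<pi>is))\<close> identifies it with \<open>D \<times> S\<^sup>1\<close> and turns the leaves
  into the orbits of the circle action \<open>c \<cdot> (\<zeta>, u) = (c\<^sup>-\<^sup>p \<zeta>, c\<^sup>q u)\<close>; the sign of \<open>p\<close> is
  immaterial since every integer \<open>p\<close> prime to \<open>q\<close> is allowed below.
\<close>

definition solid_torus :: "(complex \<times> complex) set" where
  "solid_torus = ball 0 1 \<times> sphere 0 1"

definition torus_leaf :: "int \<Rightarrow> nat \<Rightarrow> complex \<times> complex \<Rightarrow> (complex \<times> complex) set" where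
  "torus_leaf p q = (\<lambda>(\<zeta>, u). (\<lambda>c. (c powi p * \<zeta>, c ^ q * u)) ` sphere 0 1)"

text \<open>The universal covering \<open>D \<times> \<real> \<rightarrow> D \<times> S\<^sup>1\<close>, giving the smooth structure of the solid torus.\<close>

definition torus_cover :: "real^3 \<Rightarrow> complex \<times> complex" where
  "torus_cover v = (Complex (v$1) (v$2), cis (v$3))"

definition fibred_torus_nbhd ::
  "'a topology \<Rightarrow> ('a, 3) chart set \<Rightarrow> 'a set set \<Rightarrow> 'a set \<Rightarrow> bool" where
  "fibred_torus_nbhd X A \<F> C \<longleftrightarrow>
     (\<exists>p q N g. q \<ge> 1 \<and> coprime p (int q) \<and> openin X N \<and>
        homeomorphic_map (top_of_set solid_torus) (subtopology X N) g \<and>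
        local_diffeo_on A (torus_cover -` solid_torus) (g \<circ> torus_cover) \<and>
        (\<forall>w\<in>solid_torus. g ` torus_leaf p q w \<in> \<F>) \<and>
        g ` torus_leaf p q (0, 1) = C)"

definition seifert_manifold ::
  "'a topology \<Rightarrow> ('a, 3) chart set \<Rightarrow> 'a set set \<Rightarrow> bool" where
  "seifert_manifold X A \<F> \<longleftrightarrow>
     closed_oriented_manifold X A \<and>
     partition_on (topspace X) \<F> \<and> (\<forall>C\<in>\<F>. fibred_torus_nbhd X A \<F> C)"


section \<open>Milnor fibre and its boundary\<close>

type_synonym C3 = "complex \<times> complex \<times> complex"

definition germ :: "nat \<Rightarrow> nat \<Rightarrow> nat \<Rightarrow> C3 \<Rightarrow> complex" where
  "germ m k l = (\<lambda>(x, y, z). z ^ m - x ^ k * y ^ l)"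

definition polydisc :: "real \<Rightarrow> real \<Rightarrow> C3 set" where
  "polydisc \<alpha> \<epsilon> = cball 0 \<alpha> \<times> cball 0 \<alpha> \<times> cball 0 \<epsilon>"

definition milnor_fibre :: "(C3 \<Rightarrow> complex) \<Rightarrow> real \<Rightarrow> real \<Rightarrow> complex \<Rightarrow> C3 set" where
  "milnor_fibre f \<alpha> \<epsilon> t = polydisc \<alpha> \<epsilon> \<inter> f -` {t}"

definition milnor_boundary :: "(C3 \<Rightarrow> complex) \<Rightarrow> real \<Rightarrow> real \<Rightarrow> complex \<Rightarrow> C3 set" where
  "milnor_boundary f \<alpha> \<epsilon> t = milnor_fibre f \<alpha> \<epsilon> t \<inter> frontier (polydisc \<alpha> \<epsilon>)"

definition locally_trivial_fibration ::
  "'a::topological_space set \<Rightarrow> 'b::topological_space set \<Rightarrow> ('a \<Rightarrow> 'b) \<Rightarrow> bool" where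
  "locally_trivial_fibration E B f \<longleftrightarrow>
     continuous_on E f \<and> f ` E \<subseteq> B \<and>
     (\<forall>b\<in>B. \<exists>U h. b \<in> U \<and> openin (top_of_set B) U \<and>
        homeomorphic_map (top_of_set (E \<inter> f -` U)) (top_of_set (U \<times> (E \<inter> f -` {b}))) h \<and>
        (\<forall>e\<in>E \<inter> f -` U. fst (h e) = f e))"

definition admissible_radius :: "(C3 \<Rightarrow> complex) \<Rightarrow> real \<Rightarrow> real \<Rightarrow> real \<Rightarrow> bool" where
  "admissible_radius f \<alpha> \<epsilon> \<eta> \<longleftrightarrow>
     locally_trivial_fibration (polydisc \<alpha> \<epsilon> \<inter> f -` (cball 0 \<eta> - {0})) (cball 0 \<eta> - {0}) f \<and>
     (\<forall>s\<in>cball 0 \<eta>. f -` {s} \<inter> frontier (polydisc \<alpha> \<epsilon>)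
        \<subseteq> {(x, y, z). cmod x = \<alpha> \<or> cmod y = \<alpha>})"


section \<open>Orientation and smoothing of the boundary\<close>

definition corner :: "real \<Rightarrow> C3 set" where
  "corner \<alpha> = {(x, y, z). cmod x = \<alpha> \<and> cmod y = \<alpha>}"

definition times_i :: "C3 \<Rightarrow> C3" where
  "times_i = (\<lambda>(x, y, z). (\<i> * x, \<i> * y, \<i> * z))"

text \<open>
  A real frame of a complex plane in \<open>\<complex>\<^sup>3\<close> is positive for the complex orientation iff it differs
  from a frame \<open>a, ia, b, ib\<close> by a matrix of positive determinant. (If \<open>v\<close> is linearly
  independent over the reals, then so are \<open>a, ia, b, ib\<close>, and they span the same space.)
\<close>

definition complex_positive_frame :: "C3^4 \<Rightarrow> bool" where
  "complex_positive_frame v \<longleftrightarrow>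
     (\<exists>a b (M::real^4^4). det M > 0 \<and>
        (\<forall>j. v $ j = M$j$1 *\<^sub>R a + M$j$2 *\<^sub>R times_i a + M$j$3 *\<^sub>R b + M$j$4 *\<^sub>R times_i b))"

text \<open>\<open>\<nu>\<close> is tangent to the level set of \<open>f\<close> through \<open>p\<close> and points out of the body \<open>B\<close>.\<close>

definition outward :: "(C3 \<Rightarrow> complex) \<Rightarrow> C3 set \<Rightarrow> C3 \<Rightarrow> C3 \<Rightarrow> bool" where
  "outward f B p \<nu> \<longleftrightarrow>
     frechet_derivative f (at p) \<nu> = 0 \<and>
     (\<forall>\<^sub>F s in at_right (0::real). p - s *\<^sub>R \<nu> \<in> interior B)"

text \<open>
  Near the corner the two faces of the fibre are \<open>\<bar>x\<bar> = \<alpha>\<close> and \<open>\<bar>y\<bar> = \<alpha>\<close>. Straightening the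
  quadrant \<open>a = \<alpha> - \<bar>x\<bar> \<ge> 0\<close>, \<open>b = \<alpha> - \<bar>y\<bar> \<ge> 0\<close> to a half plane by doubling angles makes
  \<open>b - a = \<bar>x\<bar> - \<bar>y\<bar>\<close> a smooth coordinate on its boundary; the corner itself has the angular
  coordinates \<open>x/\<bar>x\<bar>\<close> and \<open>y/\<bar>y\<bar>\<close>.
\<close>

definition straightening :: "C3 \<Rightarrow> complex \<times> complex \<times> real" where
  "straightening = (\<lambda>(x, y, z). (sgn x, sgn y, cmod x - cmod y))"

text \<open>
  \<open>A\<close> is an atlas of the boundary \<open>L\<close> of the Milnor fibre, with corners smoothed and oriented as a
  boundary. Away from the corner the parametrisations are smooth immersions into \<open>\<complex>\<^sup>3\<close>, so \<open>A\<close>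
  induces there the structure of a smooth submanifold, and they are positive for the convention
  ``outward vector first''. At the corner \<open>straightening\<close> is a local diffeomorphism onto
  \<open>S\<^sup>1 \<times> S\<^sup>1 \<times> \<real>\<close>. These conditions determine the smooth structure and the orientation.
\<close>

definition smoothed_boundary_atlas ::
  "(C3 \<Rightarrow> complex) \<Rightarrow> real \<Rightarrow> real \<Rightarrow> complex \<Rightarrow> (C3, 3) chart set \<Rightarrow> bool" where
  "smoothed_boundary_atlas f \<alpha> \<epsilon> t A \<longleftrightarrow>
     oriented_smooth_atlas (top_of_set (milnor_boundary f \<alpha> \<epsilon> t)) A \<and>
     (\<forall>(U, \<phi>)\<in>A.
        smooth_on (\<phi> ` (U - corner \<alpha>)) (inv_into U \<phi>) \<and>
        (\<forall>p\<in>U - corner \<alpha>. let D = frechet_derivative (inv_into U \<phi>) (at (\<phi> p)) in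
           inj D \<and>
           (\<exists>\<nu>. outward f (polydisc \<alpha> \<epsilon>) p \<nu> \<and>
              complex_positive_frame (vector [\<nu>, D (axis 1 1), D (axis 2 1), D (axis 3 1)]))) \<and>
        smooth_on (\<phi> ` {(x, y, z) \<in> U. x \<noteq> 0 \<and> y \<noteq> 0}) (straightening \<circ> inv_into U \<phi>) \<and>
        (\<forall>p\<in>U \<inter> corner \<alpha>. inj (frechet_derivative (straightening \<circ> inv_into U \<phi>) (at (\<phi> p)))))"

end

theory Submission
  imports Defs
begin

text \<open>
  For small \<open>t\<close> the equation \<open>z\<^sup>m = t + x\<^sup>k y\<^sup>l\<close> keeps the Milnor fibre away from the face \<open>\<bar>z\<bar> = \<epsilon>\<close>, so
  its boundary \<open>L\<close> is the part with \<open>max \<bar>x\<bar> \<bar>y\<bar> = \<alpha>\<close>. Put \<open>k' = k / gcd k l\<close> and \<open>l' = l / gcd k l\<close>. The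
  circle action \<open>c \<cdot> (x, y, z) = (c\<^sup>l\<^sup>' x, c\<^sup>-\<^sup>k\<^sup>' y, z)\<close> leaves \<open>x\<^sup>k y\<^sup>l\<close>, the moduli and \<open>z\<close> unchanged. Hence it
  preserves \<open>L\<close>, and it has no fixed points there because \<open>x\<close> and \<open>y\<close> do not both vanish. Its orbits are
  the leaves, and \<open>z\<close> is constant on each of them.

  The work lies in the smooth structure. \<open>L\<close> is covered by maps from open sets of \<open>\<real>\<^sup>3\<close> that realise one
  of the following systems of coordinates: \<open>(arg x, arg y, \<bar>x\<bar> - \<bar>y\<bar>)\<close> where \<open>x y z \<noteq> 0\<close>, \<open>(arg x, z)\<close> where
  \<open>\<bar>y\<bar> < \<alpha>\<close> and \<open>y \<noteq> 0\<close>, \<open>(arg x, y)\<close> where \<open>\<bar>y\<bar> < \<alpha>\<close> and \<open>z \<noteq> 0\<close>, and the last two with \<open>x\<close> and \<open>y\<close>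
  exchanged (\<open>admissible\<close>). The atlas consists of the inverses of those maps that are injective. The
  component that is not a coordinate is a continuous root of a smooth function without zeros,
  therefore smooth (\<open>Ck_on_root\<close>); a continuous argument of a smooth function is smooth too
  (\<open>Ck_on_angle\<close>). Thus the transition maps, continuous at first, are smooth (\<open>transition_Ck_on\<close>).

  For the orientation, consider the face \<open>\<bar>x\<bar> = \<alpha>\<close>. The tangent plane of the fibre is complex. It is
  spanned by an outward vector \<open>\<nu>\<close>, by \<open>i\<nu>\<close>, which rotates \<open>x\<close>, and by the complex line \<open>dx = 0\<close>. All
  parametrisations rotate \<open>x\<close> by one coordinate and orient that line by the other two, in the same
  cyclic order (\<open>positive_on_face\<close>). This gives the boundary orientation
  (\<open>positive_on_face_frame\<close>) and positive Jacobians (\<open>positive_on_face_det\<close>) at once.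

  Every leaf has an explicit fibred neighbourhood (\<open>torus_disc\<close>, \<open>torus_slice\<close>, \<open>torus_corner\<close>), and on
  the universal covering of the solid torus each of these is one of the above parametrisations up to
  an affine isomorphism. So it is a local diffeomorphism and open without further computation
  (\<open>torus_data_fibred_nbhd\<close>).
\<close>

section \<open>Calculus of smooth maps\<close>

lemma frechet_derivative_eq:
  "(f has_derivative f') (at x) \<Longrightarrow> frechet_derivative f (at x) = f'"
  using frechet_derivative_at by metis

lemma Ck_on_subset: "Ck_on n S f \<Longrightarrow> T \<subseteq> S \<Longrightarrow> Ck_on n T f"
  by (induction n arbitrary: f) (auto intro: continuous_on_subset)

lemma Ck_on_cong:
  assumes "open S" "\<And>x. x \<in> S \<Longrightarrow> f x = g x" "Ck_on n S f"
  shows "Ck_on n S g"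
  using assms(2,3)
proof (induction n arbitrary: f g)
  case 0
  then show ?case using continuous_on_cong[of S S f g] by simp
next
  case (Suc n)
  have D: "(g has_derivative frechet_derivative f (at x)) (at x)" if "x \<in> S" for x
    using Suc.prems that assms(1) frechet_derivative_works
    by (metis Ck_on.simps(2) has_derivative_transform_within_open)
  have "Ck_on n S (\<lambda>x. frechet_derivative g (at x) v)" for v
    by (rule Suc.IH[of "\<lambda>x. frechet_derivative f (at x) v"])
      (use Suc.prems frechet_derivative_eq[OF D] in auto)
  then show ?case using D by (auto simp: differentiable_def)
qed

text \<open>
  In this form the derivative may be given by any formula, so that an induction over the order of
  differentiability only has to treat that formula.
\<close>

lemma Ck_on_SucI:
  assumes "open S" "\<And>x. x \<in> S \<Longrightarrow> (f has_derivative f' x) (at x)"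
    and "\<And>v. Ck_on n S (\<lambda>x. f' x v)"
  shows "Ck_on (Suc n) S f"
proof -
  have "Ck_on n S (\<lambda>x. frechet_derivative f (at x) v)" for v
    by (rule Ck_on_cong[OF assms(1) _ assms(3)[of v]]) (use assms(2) frechet_derivative_eq in metis)
  then show ?thesis using assms(2) by (auto simp: differentiable_def)
qed

lemma Ck_on_SucD:
  assumes "Ck_on (Suc n) S f" "x \<in> S"
  shows "(f has_derivative frechet_derivative f (at x)) (at x)"
  using assms frechet_derivative_works by auto

lemma Ck_on_Suc_imp: "Ck_on (Suc n) S f \<Longrightarrow> Ck_on n S f"
proof (induction n arbitrary: f)
  case 0
  then show ?case
    by (auto intro!: continuous_at_imp_continuous_on differentiable_imp_continuous_within)
qed auto

lemma Ck_on_local: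
  assumes "\<And>x. x \<in> S \<Longrightarrow> \<exists>T. x \<in> T \<and> open T \<and> Ck_on n T f"
  shows "Ck_on n S f"
  using assms
proof (induction n arbitrary: f)
  case 0
  then have "\<forall>x\<in>S. isCont f x" by (metis Ck_on.simps(1) continuous_on_eq_continuous_at)
  then show ?case by (simp add: continuous_at_imp_continuous_on)
next
  case (Suc n)
  have "Ck_on n S (\<lambda>x. frechet_derivative f (at x) v)" for v
    by (rule Suc.IH) (use Suc.prems in force)
  then show ?case using Suc.prems by force
qed

lemma Ck_on_const: "Ck_on n S (\<lambda>x. c)"
proof (induction n arbitrary: c)
  case (Suc n)
  then show ?case by (simp add: frechet_derivative_const)
qed simp

lemma Ck_on_ident: "Ck_on n S (\<lambda>x. x)"
  by (cases n) (auto intro: Ck_on_const)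

lemma Ck_on_linear_comp:
  assumes "bounded_linear L" "open S" "Ck_on n S f"
  shows "Ck_on n S (\<lambda>x. L (f x))"
  using assms(3)
proof (induction n arbitrary: f)
  case 0
  then show ?case
    by (simp add: bounded_linear.continuous_on[OF assms(1)])
next
  case (Suc n)
  show ?case
    by (rule Ck_on_SucI[OF assms(2)], rule bounded_linear.has_derivative[OF assms(1)],
        erule Ck_on_SucD[OF Suc.prems]) (use Suc in auto)
qed

lemma Ck_on_add:
  assumes "open S" "Ck_on n S f" "Ck_on n S g"
  shows "Ck_on n S (\<lambda>x. f x + g x)"
  using assms(2,3)
proof (induction n arbitrary: f g)
  case 0
  then show ?case by (auto intro: continuous_intros)
next
  case (Suc n)
  show ?case
    by (rule Ck_on_SucI[OF assms(1)], rule has_derivative_add,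
        erule Ck_on_SucD[OF Suc.prems(1)], erule Ck_on_SucD[OF Suc.prems(2)]) (use Suc in auto)
qed

lemma Ck_on_sum:
  assumes "open S" "finite I" "\<And>i. i \<in> I \<Longrightarrow> Ck_on n S (f i)"
  shows "Ck_on n S (\<lambda>x. \<Sum>i\<in>I. f i x)"
  using assms(2,3)
  by (induction I rule: finite_induct) (auto intro!: Ck_on_add[OF assms(1)] Ck_on_const)

lemma Ck_on_bilinear:
  assumes "bounded_bilinear B" "open S" "Ck_on n S f" "Ck_on n S g"
  shows "Ck_on n S (\<lambda>x. B (f x) (g x))"
  using assms(3,4)
proof (induction n arbitrary: f g)
  case 0
  then show ?case using bounded_bilinear.continuous_on[OF assms(1)] by auto
next
  case (Suc n)
  show ?case
    by (rule Ck_on_SucI[OF assms(2)], rule bounded_bilinear.FDERIV[OF assms(1)],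
        erule Ck_on_SucD[OF Suc.prems(1)], erule Ck_on_SucD[OF Suc.prems(2)],
        intro Ck_on_add[OF assms(2)] Suc.IH)
      (use Suc.prems Suc.prems[THEN Ck_on_Suc_imp] in auto)
qed

text \<open>
  The chain rule writes the derivative of \<open>g \<circ> f\<close> as a sum over a basis of the intermediate space;
  each summand is a product of functions that the induction hypothesis covers.
\<close>

lemma Ck_on_compose:
  fixes f :: "'a::euclidean_space \<Rightarrow> 'b::euclidean_space"
    and g :: "'b \<Rightarrow> 'c::real_normed_vector"
  assumes "open S" "Ck_on n S f" "Ck_on n T g" "f ` S \<subseteq> T"
  shows "Ck_on n S (\<lambda>x. g (f x))"
  using assms(2,3)
proof (induction n arbitrary: g)
  case 0
  then show ?case using assms(4) by (auto intro: continuous_on_compose2)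
next
  case (Suc n)
  have gD: "(g has_derivative frechet_derivative g (at (f x))) (at (f x))" if "x \<in> S" for x
    using Ck_on_SucD[OF Suc.prems(2)] assms(4) that by auto
  have fD: "(f has_derivative frechet_derivative f (at x)) (at x)" if "x \<in> S" for x
    using Ck_on_SucD[OF Suc.prems(1)] that by auto
  let ?h = "\<lambda>x v. \<Sum>b\<in>Basis. (frechet_derivative f (at x) v \<bullet> b) *\<^sub>R frechet_derivative g (at (f x)) b"
  show ?case
  proof (rule Ck_on_SucI[OF assms(1), where f' = ?h])
    fix x assume x: "x \<in> S"
    have eq: "frechet_derivative g (at (f x)) w = (\<Sum>b\<in>Basis. (w \<bullet> b) *\<^sub>R frechet_derivative g (at (f x)) b)" for w
    proof -
      have lin: "linear (frechet_derivative g (at (f x)))"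
        using gD[OF x] by (rule has_derivative_linear)
      have "frechet_derivative g (at (f x)) w = frechet_derivative g (at (f x)) (\<Sum>b\<in>Basis. (w \<bullet> b) *\<^sub>R b)"
        by (simp add: euclidean_representation)
      also have "\<dots> = (\<Sum>b\<in>Basis. (w \<bullet> b) *\<^sub>R frechet_derivative g (at (f x)) b)"
        by (simp add: linear_sum[OF lin] linear_cmul[OF lin])
      finally show ?thesis .
    qed
    show "((\<lambda>x. g (f x)) has_derivative ?h x) (at x)"
      by (rule has_derivative_eq_rhs[OF has_derivative_compose[OF fD[OF x] gD[OF x]] ext[OF eq]])
  next
    fix v
    show "Ck_on n S (\<lambda>x. ?h x v)"
    proof (rule Ck_on_sum[OF assms(1) finite_Basis])
      fix b :: 'b assume "b \<in> Basis"
      have "Ck_on n S (\<lambda>x. frechet_derivative f (at x) v \<bullet> b)"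
        by (rule Ck_on_linear_comp[OF bounded_linear_inner_left assms(1)]) (use Suc.prems in auto)
      moreover have "Ck_on n S (\<lambda>x. frechet_derivative g (at (f x)) b)"
        using Suc.IH[OF Ck_on_Suc_imp[OF Suc.prems(1)], of "\<lambda>y. frechet_derivative g (at y) b"] Suc.prems(2)
        by auto
      ultimately show "Ck_on n S (\<lambda>x. (frechet_derivative f (at x) v \<bullet> b) *\<^sub>R frechet_derivative g (at (f x)) b)"
        by (rule Ck_on_bilinear[OF bounded_bilinear_scaleR assms(1)])
    qed
  qed
qed

lemma Ck_on_Pair:
  assumes "open S" "Ck_on n S f" "Ck_on n S g"
  shows "Ck_on n S (\<lambda>x. (f x, g x))"
proof -
  have "Ck_on n S (\<lambda>x. (f x, 0) + (0, g x))"
    by (intro Ck_on_add[OF assms(1)] Ck_on_linear_comp[OF _ assms(1), where L = "\<lambda>a. (a, 0)"]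
        Ck_on_linear_comp[OF _ assms(1), where L = "\<lambda>a. (0, a)"] assms bounded_linear_Pair
        bounded_linear_ident bounded_linear_zero)
  then show ?thesis by simp
qed

lemma Ck_on_vec:
  fixes f :: "'a::euclidean_space \<Rightarrow> real^'n"
  assumes "open S" "\<And>i. Ck_on n S (\<lambda>x. f x $ i)"
  shows "Ck_on n S f"
proof -
  have "Ck_on n S (\<lambda>x. \<Sum>i\<in>UNIV. (f x $ i) *\<^sub>R axis i (1::real))"
    by (intro Ck_on_sum[OF assms(1)] Ck_on_linear_comp[OF _ assms(1), where L = "\<lambda>c. c *\<^sub>R _"] 
         assms(2) bounded_linear_scaleR_left) auto
  moreover have "(\<Sum>i\<in>UNIV. (f x $ i) *\<^sub>R axis i (1::real)) = f x" for x
    using basis_expansion[of "f x"] by (simp add: scalar_mult_eq_scaleR)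
  ultimately show ?thesis by simp
qed

lemma Ck_on_inverse:
  fixes q :: "'a::euclidean_space \<Rightarrow> 'b::real_normed_field"
  assumes "open S" "Ck_on n S q" "\<And>x. x \<in> S \<Longrightarrow> q x \<noteq> 0"
  shows "Ck_on n S (\<lambda>x. inverse (q x))"
  using assms(2)
proof (induction n)
  case 0
  then show ?case using assms(3) by (auto intro: continuous_intros)
next
  case (Suc n)
  note mult = Ck_on_bilinear[OF bounded_bilinear_mult assms(1)]
  have IH: "Ck_on n S (\<lambda>x. inverse (q x))" using Suc Ck_on_Suc_imp by blast
  show ?case
  proof (rule Ck_on_SucI[OF assms(1)])
    show "((\<lambda>x. inverse (q x)) has_derivative
        (\<lambda>v. - (inverse (q x) * frechet_derivative q (at x) v * inverse (q x)))) (at x)" if "x \<in> S" for x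
      using that assms(3) Ck_on_SucD[OF Suc.prems that] by (auto intro!: derivative_eq_intros)
    show "Ck_on n S (\<lambda>x. - (inverse (q x) * frechet_derivative q (at x) v * inverse (q x)))" for v
      using Suc.prems IH
      by (intro Ck_on_linear_comp[OF _ assms(1), where L = uminus] mult bounded_linear_minus bounded_linear_ident)
        auto
  qed
qed

text \<open>
  A differentiable function may be multiplied by a merely continuous factor without losing
  differentiability at its zeros. Applied to the reciprocal of the difference quotient of \<open>G\<close>, this
  differentiates a solution \<open>u\<close> of \<open>G \<circ> u = F\<close> although only the continuity of \<open>u\<close> is known.
\<close>

lemma has_derivative_mult_continuous:
  fixes F K :: "'a::real_normed_vector \<Rightarrow> 'b::real_normed_field"
  assumes F: "(F has_derivative F') (at x)" and "F x = 0" and K: "isCont K x"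
  shows "((\<lambda>y. F y * K y) has_derivative (\<lambda>v. F' v * K x)) (at x)"
proof -
  have lin: "bounded_linear F'" using F by (rule has_derivative_bounded_linear)
  obtain c where c: "c > 0" "\<And>v. norm (F' v) \<le> norm v * c"
    using bounded_linear.pos_bounded[OF lin] by blast
  let ?r = "\<lambda>h. F (x + h) - F x - F' h"
  have r: "((\<lambda>h. norm (?r h) / norm h) \<longlongrightarrow> 0) (at 0)"
    using F by (simp add: has_derivative_at)
  have Kc: "((\<lambda>h. K (x + h)) \<longlongrightarrow> K x) (at 0)"
    using K isCont_iff by blast
  have bound: "norm (F (x + h) * K (x + h) - F x * K x - F' h * K x) / norm h
      \<le> norm (?r h) / norm h * norm (K (x + h)) + c * norm (K (x + h) - K x)" if "h \<noteq> 0" for h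
  proof -
    have "F (x + h) * K (x + h) - F x * K x - F' h * K x
        = ?r h * K (x + h) + F' h * (K (x + h) - K x)"
      using assms(2) by (simp add: algebra_simps)
    then have "norm (F (x + h) * K (x + h) - F x * K x - F' h * K x)
        \<le> norm (?r h) * norm (K (x + h)) + norm h * c * norm (K (x + h) - K x)"
      using norm_triangle_ineq[of "?r h * K (x + h)" "F' h * (K (x + h) - K x)"]
        mult_right_mono[OF c(2)[of h], of "norm (K (x + h) - K x)"]
      by (simp add: norm_mult)
    then show ?thesis using that by (simp add: field_simps)
  qed
  have "((\<lambda>h. norm (?r h) / norm h * norm (K (x + h)) + c * norm (K (x + h) - K x)) \<longlongrightarrow>
      0 * norm (K x) + c * norm (K x - K x)) (at 0)"
    by (intro tendsto_intros r Kc)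
  then have 0: "((\<lambda>h. norm (?r h) / norm h * norm (K (x + h)) + c * norm (K (x + h) - K x)) \<longlongrightarrow> 0) (at 0)"
    by simp
  have "\<forall>\<^sub>F h in at 0. norm (norm (F (x + h) * K (x + h) - F x * K x - F' h * K x) / norm h)
      \<le> norm (?r h) / norm h * norm (K (x + h)) + c * norm (K (x + h) - K x)"
    unfolding eventually_at_filter using bound by (intro always_eventually) auto
  then have lim: "((\<lambda>h. norm (F (x + h) * K (x + h) - F x * K x - F' h * K x) / norm h) \<longlongrightarrow> 0) (at 0)"
    by (rule Lim_null_comparison[OF _ 0])
  show ?thesis
    unfolding has_derivative_at using lim bounded_linear_mult_const[OF lin, of "K x"] by simp
qed

lemma implicit_has_derivative:
  fixes u F :: "'a::real_normed_vector \<Rightarrow> 'b::real_normed_field"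
  assumes "isCont u x" and GF: "open S" "x \<in> S" "\<And>y. y \<in> S \<Longrightarrow> G (u y) = F y"
    and F: "(F has_derivative F') (at x)"
    and G: "(G has_field_derivative g) (at (u x))" and "g \<noteq> 0"
  shows "(u has_derivative (\<lambda>v. F' v / g)) (at x)"
proof -
  obtain H where H: "\<And>z. G z - G (u x) = H z * (z - u x)" "isCont H (u x)" "H (u x) = g"
    using G CARAT_DERIV by blast
  have Hu: "isCont (\<lambda>y. H (u y)) x" using assms(1) H(2) by (metis isCont_o2)
  have "((\<lambda>y. (F y - F x) * inverse (H (u y))) has_derivative (\<lambda>v. F' v * inverse (H (u x)))) (at x)"
    using F Hu H(3) \<open>g \<noteq> 0\<close>
    by (intro has_derivative_mult_continuous[of "\<lambda>y. F y - F x"])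
      (auto intro!: derivative_eq_intros continuous_intros)
  from has_derivative_add[OF has_derivative_const[of "u x"] this]
  have 1: "((\<lambda>y. u x + (F y - F x) * inverse (H (u y))) has_derivative (\<lambda>v. F' v / g)) (at x)"
    using H(3) by (simp add: divide_inverse)
  have "\<forall>\<^sub>F y in nhds x. H (u y) \<noteq> 0"
  proof -
    have "((\<lambda>y. H (u y)) \<longlongrightarrow> H (u x)) (nhds x)" using Hu tendsto_nhds_iff isCont_def by blast
    then show ?thesis using tendsto_imp_eventually_ne H(3) \<open>g \<noteq> 0\<close> by blast
  qed
  moreover have "\<forall>\<^sub>F y in nhds x. y \<in> S" using GF eventually_nhds by blast
  ultimately have "\<forall>\<^sub>F y in nhds x. u x + (F y - F x) * inverse (H (u y)) = u y"
  proof eventually_elim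
    case (elim y)
    then have "F y - F x = H (u y) * (u y - u x)" using H(1)[of "u y"] GF by simp
    then show ?case using elim by (simp add: field_simps)
  qed
  then have "\<forall>\<^sub>F y in at x. u x + (F y - F x) * inverse (H (u y)) = u y"
    unfolding eventually_at_filter by (rule eventually_mono) simp
  then show ?thesis
    by (rule has_derivative_transform_eventually[OF 1]) auto
qed

lemma Ck_on_power:
  fixes f :: "'a::euclidean_space \<Rightarrow> 'b::real_normed_field"
  assumes "open S" "Ck_on n S f"
  shows "Ck_on n S (\<lambda>x. f x ^ j)"
  by (induction j) (auto intro: Ck_on_const Ck_on_bilinear[OF bounded_bilinear_mult assms(1)] assms)

text \<open>
  The derivative \<open>DF / (j u\<^sup>j\<^sup>-\<^sup>1)\<close> involves \<open>u\<close> itself but no derivative of \<open>u\<close>, so induction applies.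
  No branch of the root has to be named: the continuity of \<open>u\<close> has selected one.
\<close>

lemma Ck_on_root:
  fixes u F :: "'a::euclidean_space \<Rightarrow> 'b::real_normed_field"
  assumes "open S" "continuous_on S u" "\<And>x. x \<in> S \<Longrightarrow> u x ^ j = F x" "\<And>x. x \<in> S \<Longrightarrow> u x \<noteq> 0"
    and "j \<ge> 1" and "Ck_on n S F"
  shows "Ck_on n S u"
  using assms(6)
proof (induction n)
  case 0
  then show ?case using assms by simp
next
  case (Suc n)
  have IH: "Ck_on n S u" using Suc Ck_on_Suc_imp by blast
  show ?case
  proof (rule Ck_on_SucI[OF assms(1)])
    fix x assume x: "x \<in> S"
    show "(u has_derivative (\<lambda>v. frechet_derivative F (at x) v / (of_nat j * u x ^ (j - 1)))) (at x)"
    proof (rule implicit_has_derivative[where G = "\<lambda>w. w ^ j", OF _ assms(1) x])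
      show "isCont u x" using assms x continuous_on_eq_continuous_at by blast
      show "((\<lambda>w. w ^ j) has_field_derivative of_nat j * u x ^ (j - 1)) (at (u x))"
        by (auto intro!: derivative_eq_intros)
    qed (use assms x Ck_on_SucD[OF Suc.prems x] in auto)
  next
    fix v
    have "Ck_on n S (\<lambda>x. frechet_derivative F (at x) v * inverse (of_nat j * u x ^ (j - 1)))"
      by (intro Ck_on_bilinear[OF bounded_bilinear_mult assms(1)] Ck_on_inverse Ck_on_power Ck_on_const
          assms(1) IH) (use Suc.prems assms in auto)
    then show "Ck_on n S (\<lambda>x. frechet_derivative F (at x) v / (of_nat j * u x ^ (j - 1)))"
      by (simp add: divide_inverse)
  qed
qed

lemma has_derivative_cis [derivative_intros]:
  assumes "(u has_derivative u') (at x within A)"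
  shows "((\<lambda>x. cis (u x)) has_derivative (\<lambda>v. \<i> * cis (u x) * of_real (u' v))) (at x within A)"
proof -
  have "((\<lambda>x. exp (\<i> * of_real (u x))) has_derivative (\<lambda>v. \<i> * of_real (u' v) * exp (\<i> * of_real (u x)))) (at x within A)"
  proof -
    have 1: "((\<lambda>x. \<i> * of_real (u x)) has_derivative (\<lambda>v. \<i> * complex_of_real (u' v))) (at x within A)"
      by (intro has_derivative_mult_right bounded_linear.has_derivative[OF bounded_linear_of_real] assms)
    show ?thesis
      using has_derivative_compose[OF 1 DERIV_exp[unfolded has_field_derivative_def]]
      by (simp add: mult_ac)
  qed
  then show ?thesis by (simp add: cis_conv_exp mult_ac)
qed

lemma Ck_on_cis:
  assumes "open S" "Ck_on n S u"
  shows "Ck_on n S (\<lambda>x. cis (u x))"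
  using assms(2)
proof (induction n)
  case 0
  then show ?case by (auto intro: continuous_intros)
next
  case (Suc n)
  note lin = Ck_on_linear_comp[OF _ assms(1)] and mult = Ck_on_bilinear[OF bounded_bilinear_mult assms(1)]
  show ?case
    by (rule Ck_on_SucI[OF assms(1)], rule has_derivative_cis, erule Ck_on_SucD[OF Suc.prems],
        intro mult Ck_on_const lin[OF bounded_linear_of_real])
      (use Suc Ck_on_Suc_imp in auto)
qed

text \<open>
  A continuous angle of a \<open>C\<^sup>n\<close> map to the unit circle is \<open>C\<^sup>n\<close>: this settles all the angular
  components of the transition maps below.
\<close>

lemma angle_has_derivative:
  fixes u :: "'a::real_normed_vector \<Rightarrow> real"
  assumes "open S" "x \<in> S" "continuous_on S u" "\<And>y. y \<in> S \<Longrightarrow> cis (u y) = F y"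
    and F: "(F has_derivative F') (at x)"
  shows "(u has_derivative (\<lambda>v. Im (F' v / F x))) (at x)"
proof -
  have "((\<lambda>y. complex_of_real (u y)) has_derivative (\<lambda>v. F' v / (\<i> * F x))) (at x)"
  proof (rule implicit_has_derivative[where G = "\<lambda>w. exp (\<i> * w)", OF _ assms(1,2)])
    show "isCont (\<lambda>y. complex_of_real (u y)) x"
      using assms by (auto intro!: continuous_intros simp: continuous_on_eq_continuous_at)
    show "((\<lambda>w. exp (\<i> * w)) has_field_derivative \<i> * F x) (at (complex_of_real (u x)))"
      using assms(4)[OF assms(2)] by (auto intro!: derivative_eq_intros simp: cis_conv_exp)
    show "\<i> * F x \<noteq> 0" using assms(4)[OF assms(2)] by (metis cis_neq_zero complex_i_not_zero mult_eq_0_iff)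
  qed (use assms F in \<open>auto simp: cis_conv_exp\<close>)
  from bounded_linear.has_derivative[OF bounded_linear_Re this]
  have "(u has_derivative (\<lambda>v. Re (F' v / (\<i> * F x)))) (at x)" by simp
  moreover have "Re (w / (\<i> * F x)) = Im (w / F x)" for w
  proof -
    have "w / (\<i> * F x) = - \<i> * (w / F x)" by (simp add: divide_inverse)
    then show ?thesis by (simp del: times_divide_eq_right)
  qed
  ultimately show ?thesis by simp
qed

lemma Ck_on_angle:
  fixes u :: "'a::euclidean_space \<Rightarrow> real"
  assumes "open S" "continuous_on S u" "\<And>x. x \<in> S \<Longrightarrow> cis (u x) = F x" and "Ck_on n S F"
  shows "Ck_on n S u"
proof (cases n)
  case 0
  then show ?thesis using assms by simp
next
  case (Suc n')
  note mult = Ck_on_bilinear[OF bounded_bilinear_mult assms(1)]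
  have nz: "F x \<noteq> 0" if "x \<in> S" for x using assms(3)[OF that] by (metis cis_neq_zero)
  show ?thesis
    unfolding Suc
  proof (rule Ck_on_SucI[OF assms(1)])
    show "(u has_derivative (\<lambda>v. Im (frechet_derivative F (at x) v / F x))) (at x)" if "x \<in> S" for x
      using angle_has_derivative[OF assms(1) that assms(2,3)] Ck_on_SucD assms(4) that Suc by blast
    have "Ck_on n' S (\<lambda>x. Im (frechet_derivative F (at x) v * inverse (F x)))" for v
      by (intro Ck_on_linear_comp[OF bounded_linear_Im assms(1)] mult Ck_on_inverse assms(1) nz)
        (use assms(4) Suc Ck_on_Suc_imp in auto)
    then show "Ck_on n' S (\<lambda>x. Im (frechet_derivative F (at x) v / F x))" for v
      by (simp add: divide_inverse)
  qed
qed

text \<open>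
  The modulus is a continuous square root of \<open>q * cnj q\<close>.
\<close>

lemma Ck_on_cmod:
  assumes "open S" "Ck_on n S q" "\<And>x. x \<in> S \<Longrightarrow> q x \<noteq> 0"
  shows "Ck_on n S (\<lambda>x. cmod (q x))"
proof -
  have cont: "continuous_on S q" using assms(2)
    by (induction n) (use Ck_on_Suc_imp in auto)
  have "Ck_on n S (\<lambda>x. complex_of_real (cmod (q x)))"
  proof (rule Ck_on_root[OF assms(1), where j = 2])
    show "complex_of_real (cmod (q x)) ^ 2 = q x * cnj (q x)" for x
      using complex_norm_square[of "q x"] by simp
    show "Ck_on n S (\<lambda>x. q x * cnj (q x))"
      by (intro Ck_on_bilinear[OF bounded_bilinear_mult assms(1)]
          Ck_on_linear_comp[OF bounded_linear_cnj assms(1)] assms)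
  qed (use assms cont in \<open>auto intro: continuous_intros\<close>)
  from Ck_on_linear_comp[OF bounded_linear_Re assms(1) this] show ?thesis by simp
qed

lemma Ck_on_sgn:
  fixes q :: "'a::euclidean_space \<Rightarrow> complex"
  assumes "open S" "Ck_on n S q" "\<And>x. x \<in> S \<Longrightarrow> q x \<noteq> 0"
  shows "Ck_on n S (\<lambda>x. sgn (q x))"
proof -
  have "Ck_on n S (\<lambda>x. inverse (cmod (q x)) *\<^sub>R q x)"
    by (intro Ck_on_bilinear[OF bounded_bilinear_scaleR assms(1)] Ck_on_inverse Ck_on_cmod) (use assms in auto)
  then show ?thesis by (simp add: sgn_div_norm)
qed

lemma Ck_on_vec_nth: "open S \<Longrightarrow> Ck_on n S (\<lambda>x::real^'n. x $ i)"
  using Ck_on_linear_comp[OF bounded_linear_vec_nth, of S n "\<lambda>x. x"] Ck_on_ident by blast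

lemmas Ck_on_mult = Ck_on_bilinear[OF bounded_bilinear_mult]
lemmas Ck_on_fst = Ck_on_linear_comp[OF bounded_linear_fst]
lemmas Ck_on_snd = Ck_on_linear_comp[OF bounded_linear_snd]
lemmas Ck_on_Re = Ck_on_linear_comp[OF bounded_linear_Re]
lemmas Ck_on_Im = Ck_on_linear_comp[OF bounded_linear_Im]
lemmas Ck_on_of_real = Ck_on_linear_comp[OF bounded_linear_of_real]

lemma Ck_on_diff: "open S \<Longrightarrow> Ck_on n S f \<Longrightarrow> Ck_on n S g \<Longrightarrow> Ck_on n S (\<lambda>x. f x - g x)"
  using Ck_on_add[OF _ _ Ck_on_linear_comp[OF bounded_linear_minus[OF bounded_linear_ident]], of S n f g] by simp

lemma Ck_on_Complex:
  assumes "open S" "Ck_on n S f" "Ck_on n S g"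
  shows "Ck_on n S (\<lambda>x. Complex (f x) (g x))"
  unfolding Complex_eq by (intro Ck_on_add Ck_on_mult Ck_on_const Ck_on_of_real assms)

lemmas Ck_on_intros = Ck_on_const Ck_on_add Ck_on_diff Ck_on_mult Ck_on_power Ck_on_Pair Ck_on_fst Ck_on_snd
  Ck_on_vec_nth Ck_on_Complex Ck_on_of_real Ck_on_cis

lemma Ck_on_vec3:
  fixes f :: "'a::euclidean_space \<Rightarrow> real^3"
  assumes "open S" "Ck_on n S (\<lambda>x. f x $ 1)" "Ck_on n S (\<lambda>x. f x $ 2)" "Ck_on n S (\<lambda>x. f x $ 3)"
  shows "Ck_on n S f"
  using Ck_on_vec[OF assms(1), of n f] assms(2-4) by (metis exhaust_3)

lemma jacobian_cong:
  assumes "open S" "v \<in> S" "\<And>u. u \<in> S \<Longrightarrow> f u = g u" "f differentiable (at v)"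
  shows "jacobian f v = jacobian g v"
proof -
  have "(g has_derivative frechet_derivative f (at v)) (at v)"
    by (rule has_derivative_transform_within_open[OF _ assms(1-3)]) 
      (use assms(4) frechet_derivative_works in blast)
  then show ?thesis by (simp add: jacobian_def frechet_derivative_eq)
qed

text \<open>
  For maps of which only some components are given by formulas.
\<close>

lemma derivative_component:
  assumes "(P has_derivative P') (at v)" "bounded_linear \<phi>" "open T" "v \<in> T" "\<And>u. u \<in> T \<Longrightarrow> \<phi> (P u) = g u"
    and "(g has_derivative g') (at v)"
  shows "\<phi> (P' h) = g' h"
proof -
  have "((\<lambda>u. \<phi> (P u)) has_derivative (\<lambda>h. \<phi> (P' h))) (at v)"
    by (rule bounded_linear.has_derivative[OF assms(2,1)])
  moreover have "((\<lambda>u. \<phi> (P u)) has_derivative g') (at v)"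
    by (rule has_derivative_transform_within_open[OF assms(6,3,4)]) (simp add: assms(5))
  ultimately show ?thesis using has_derivative_unique by metis
qed

section \<open>The boundary of the Milnor fibre and its parametrisations\<close>

definition swap_xy :: "C3 \<Rightarrow> C3" where
  "swap_xy = (\<lambda>(x, y, z). (y, x, z))"

lemma swap_xy_simps [simp]: "swap_xy (x, y, z) = (y, x, z)" "swap_xy (swap_xy p) = p"
  by (auto simp: swap_xy_def split: prod.splits)

lemma swap_xy_components [simp]: "fst (swap_xy p) = fst (snd p)" "fst (snd (swap_xy p)) = fst p" "snd (snd (swap_xy p)) = snd (snd p)"
  by (auto simp: swap_xy_def split: prod.splits)

lemma bounded_linear_swap_xy: "bounded_linear swap_xy"
proof -
  have eq: "swap_xy = (\<lambda>p. (fst (snd p), fst p, snd (snd p)))"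
    by (auto simp: swap_xy_def fun_eq_iff)
  show ?thesis
    unfolding eq by (intro bounded_linear_Pair bounded_linear_fst bounded_linear_snd
        bounded_linear_compose[OF bounded_linear_fst] bounded_linear_compose[OF bounded_linear_snd])
qed

text \<open>
  The parametrisations of the boundary come in three kinds. Each of them prescribes two complex
  components, or the arguments of two components and the difference of their moduli; the remaining
  component is a root of an expression in the others, and is constrained below by continuity and by
  the equation of the boundary.

  Where \<open>max \<bar>x\<bar> \<bar>y\<bar> = \<alpha>\<close>, the moduli are recovered from \<open>h = \<bar>x\<bar> - \<bar>y\<bar>\<close> as \<open>min \<alpha> (\<alpha> + h)\<close> and
  \<open>min \<alpha> (\<alpha> - h)\<close>. Only this first kind reaches the corner, which is \<open>h = 0\<close>.
\<close>

definition corner_type :: "real \<Rightarrow> (real^3) set \<Rightarrow> (real^3 \<Rightarrow> C3) \<Rightarrow> bool" where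
  "corner_type \<alpha> D P \<longleftrightarrow> (\<forall>v\<in>D. \<exists>z. z \<noteq> 0 \<and> \<bar>v$3\<bar> < \<alpha> \<and>
     P v = (of_real (min \<alpha> (\<alpha> + v$3)) * cis (v$1), of_real (min \<alpha> (\<alpha> - v$3)) * cis (v$2), z))"

text \<open>
  On the open face \<open>\<bar>y\<bar> < \<alpha>\<close>, the coordinate \<open>z\<close> may be used off \<open>y = 0\<close>, in particular at \<open>z = 0\<close>.
\<close>

definition slice_type :: "real \<Rightarrow> (real^3) set \<Rightarrow> (real^3 \<Rightarrow> C3) \<Rightarrow> bool" where
  "slice_type \<alpha> D P \<longleftrightarrow> (\<forall>v\<in>D. \<exists>y. y \<noteq> 0 \<and> cmod y < \<alpha> \<and>
     P v = (of_real \<alpha> * cis (v$1), y, Complex (v$2) (v$3)))"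

text \<open>
  On the same face, the coordinate \<open>y\<close> may be used off \<open>z = 0\<close>, in particular at \<open>y = 0\<close>.
\<close>

definition disc_type :: "real \<Rightarrow> (real^3) set \<Rightarrow> (real^3 \<Rightarrow> C3) \<Rightarrow> bool" where
  "disc_type \<alpha> D P \<longleftrightarrow> (\<forall>v\<in>D. \<exists>z. z \<noteq> 0 \<and> cmod (Complex (v$2) (v$3)) < \<alpha> \<and>
     P v = (of_real \<alpha> * cis (v$1), Complex (v$2) (v$3), z))"

definition edge_type :: "real \<Rightarrow> (real^3) set \<Rightarrow> (real^3 \<Rightarrow> C3) \<Rightarrow> bool" where
  "edge_type \<alpha> D P \<longleftrightarrow> slice_type \<alpha> D P \<or> disc_type \<alpha> D P"

text \<open>
  The last alternative covers the face \<open>\<bar>x\<bar> < \<alpha>\<close>. The first kind needs no such counterpart: it is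
  symmetric up to the linear substitution \<open>(a, b, h) \<mapsto> (b, a, -h)\<close>.
\<close>

definition admissible :: "C3 set \<Rightarrow> real \<Rightarrow> (real^3) set \<Rightarrow> (real^3 \<Rightarrow> C3) \<Rightarrow> bool" where
  "admissible S \<alpha> D P \<longleftrightarrow> open D \<and> continuous_on D P \<and> P ` D \<subseteq> S \<and>
     (corner_type \<alpha> D P \<or> edge_type \<alpha> D P \<or> edge_type \<alpha> D (swap_xy \<circ> P))"

lemma type_subset:
  assumes "D' \<subseteq> D"
  shows "corner_type \<alpha> D P \<Longrightarrow> corner_type \<alpha> D' P"
    "slice_type \<alpha> D P \<Longrightarrow> slice_type \<alpha> D' P"
    "disc_type \<alpha> D P \<Longrightarrow> disc_type \<alpha> D' P"
    "edge_type \<alpha> D P \<Longrightarrow> edge_type \<alpha> D' P"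
  using assms unfolding corner_type_def slice_type_def disc_type_def edge_type_def by blast+

lemma admissible_subset:
  "admissible S \<alpha> D P \<Longrightarrow> D' \<subseteq> D \<Longrightarrow> open D' \<Longrightarrow> admissible S \<alpha> D' P"
  unfolding admissible_def by (meson continuous_on_subset image_mono subset_trans type_subset)

lemma corner_typeD:
  assumes "corner_type \<alpha> D P" "v \<in> D"
  shows "fst (P v) = of_real (min \<alpha> (\<alpha> + v$3)) * cis (v$1)"
    "fst (snd (P v)) = of_real (min \<alpha> (\<alpha> - v$3)) * cis (v$2)"
    "snd (snd (P v)) \<noteq> 0" "\<bar>v$3\<bar> < \<alpha>"
  using assms unfolding corner_type_def by force+

lemma slice_typeD:
  assumes "slice_type \<alpha> D P" "v \<in> D"
  shows "fst (P v) = of_real \<alpha> * cis (v$1)" "snd (snd (P v)) = Complex (v$2) (v$3)"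
    "fst (snd (P v)) \<noteq> 0" "cmod (fst (snd (P v))) < \<alpha>"
  using assms unfolding slice_type_def by force+

lemma disc_typeD:
  assumes "disc_type \<alpha> D P" "v \<in> D"
  shows "fst (P v) = of_real \<alpha> * cis (v$1)" "fst (snd (P v)) = Complex (v$2) (v$3)"
    "snd (snd (P v)) \<noteq> 0" "cmod (fst (snd (P v))) < \<alpha>"
  using assms unfolding disc_type_def by force+

lemma edge_typeD:
  assumes "edge_type \<alpha> D P" "v \<in> D"
  shows "fst (P v) = of_real \<alpha> * cis (v$1)" "cmod (fst (snd (P v))) < \<alpha>"
  using assms slice_typeD(1,4)[of \<alpha> D P v] disc_typeD(1,4)[of \<alpha> D P v] unfolding edge_type_def by metis+

lemma mem_corner: "p \<in> corner \<alpha> \<longleftrightarrow> cmod (fst p) = \<alpha> \<and> cmod (fst (snd p)) = \<alpha>"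
  by (cases p) (auto simp: corner_def)

lemma corner_type_mem_corner:
  assumes "corner_type \<alpha> D P" "v \<in> D"
  shows "P v \<in> corner \<alpha> \<longleftrightarrow> v$3 = 0" "cmod (fst (P v)) < \<alpha> \<longleftrightarrow> v$3 < 0"
    "cmod (fst (snd (P v))) < \<alpha> \<longleftrightarrow> v$3 > 0"
  using corner_typeD[OF assms] by (auto simp: mem_corner norm_mult min_def split: if_splits)

lemma straightening_corner_type:
  assumes "corner_type \<alpha> D P" "v \<in> D"
  shows "straightening (P v) = (cis (v$1), cis (v$2), v$3)"
proof -
  obtain z where Pv: "P v = (of_real (min \<alpha> (\<alpha> + v$3)) * cis (v$1), of_real (min \<alpha> (\<alpha> - v$3)) * cis (v$2), z)"
    and v3: "\<bar>v$3\<bar> < \<alpha>"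
    using assms unfolding corner_type_def by blast
  have "min \<alpha> (\<alpha> + v$3) > 0" "min \<alpha> (\<alpha> - v$3) > 0" "min \<alpha> (\<alpha> + v$3) - min \<alpha> (\<alpha> - v$3) = v$3"
    using v3 by (auto simp: min_def)
  then show ?thesis unfolding Pv straightening_def
    by (simp add: norm_mult sgn_mult sgn_of_real)
qed

lemma edge_not_corner:
  assumes "edge_type \<alpha> D P \<or> edge_type \<alpha> D (swap_xy \<circ> P)" "v \<in> D"
  shows "P v \<notin> corner \<alpha>"
  using assms edge_typeD(2)[of \<alpha> D P v] edge_typeD(2)[of \<alpha> D "swap_xy \<circ> P" v] by (auto simp: mem_corner)

lemma swap_xy_continuous: "continuous_on S P \<Longrightarrow> continuous_on S (swap_xy \<circ> P)"
  unfolding o_def by (rule bounded_linear.continuous_on[OF bounded_linear_swap_xy])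

lemma continuous_on_vector3:
  assumes "continuous_on S f" "continuous_on S g" "continuous_on S h"
  shows "continuous_on S (\<lambda>q. vector [f q, g q, h q] :: real^3)"
proof -
  have "(\<lambda>q. vector [f q, g q, h q] :: real^3) = (\<lambda>q. f q *\<^sub>R axis 1 1 + g q *\<^sub>R axis 2 1 + h q *\<^sub>R axis 3 1)"
    by (auto simp: vec_eq_iff forall_3 axis_def)
  then show ?thesis by (simp only:) (intro continuous_intros assms)
qed

text \<open>
  A local inverse of polar coordinates that is continuous near \<open>x0\<close>, where the principal argument of
  \<open>x / x0\<close> is.
\<close>

lemma angle_continuation:
  assumes "x0 = of_real r0 * cis a0" "r0 > 0" "x \<noteq> 0"
  shows "of_real (cmod x) * cis (a0 + Arg (x / x0)) = x"
proof -
  have x0: "x0 \<noteq> 0" "cmod x0 = r0" using assms by (auto simp: norm_mult)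
  have "x / x0 = of_real (cmod (x / x0)) * cis (Arg (x / x0))"
    using rcis_cmod_Arg[of "x / x0"] by (simp add: rcis_def)
  then have "x = x0 * of_real (cmod x / r0) * cis (Arg (x / x0))"
    using x0 by (simp add: norm_divide field_simps)
  also have "\<dots> = of_real (cmod x) * cis (a0 + Arg (x / x0))"
    using assms(1,2) by (simp add: cis_mult[symmetric])
  finally show ?thesis by simp
qed

lemma cis_inj_small:
  assumes "cis a = cis b" "\<bar>a - b\<bar> < 2 * pi"
  shows "a = b"
proof -
  have "cos (a - b) = 1"
    using assms(1) by (metis cis_divide cis_neq_zero divide_self cis.sel(1) one_complex.sel(1))
  then obtain n :: int where n: "a - b = of_int n * 2 * pi" using cos_one_2pi_int by blast
  then have "\<bar>of_int n\<bar> * (2 * pi) < 1 * (2 * pi)" using assms(2) by (simp add: abs_mult)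
  then have "\<bar>of_int n :: real\<bar> < 1" by simp
  then have "n = 0" by linarith
  then show ?thesis using n by simp
qed

text \<open>
  Distinct \<open>n\<close>-th roots of one number stay apart, so a root that agrees with a given continuous
  branch at one point agrees with it nearby.
\<close>

lemma root_branch_unique_nearby:
  fixes E :: "'a::topological_space \<Rightarrow> 'b::topological_space" and r :: "'a \<Rightarrow> complex"
  assumes W: "openin (top_of_set L) W" and E: "continuous_on W E" and r: "continuous_on W r"
    and \<rho>: "continuous_on D \<rho>" "\<And>v. v \<in> D \<Longrightarrow> \<rho> v \<noteq> 0" and D: "open D" and "n \<ge> 1"
    and root: "\<And>q. q \<in> W \<Longrightarrow> E q \<in> D \<Longrightarrow> r q ^ n = \<rho> (E q) ^ n"
    and q0: "q0 \<in> W" "E q0 \<in> D" "r q0 = \<rho> (E q0)"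
  obtains W' where "openin (top_of_set L) W'" "q0 \<in> W'" "W' \<subseteq> W"
    "\<And>q. q \<in> W' \<Longrightarrow> E q \<in> D \<and> r q = \<rho> (E q)"
proof -
  have "finite {\<omega>::complex. \<omega> ^ n = 1}" using finite_roots_unity \<open>n \<ge> 1\<close> by blast
  then obtain e where "e > 0" and "\<forall>\<omega>\<in>{\<omega>. \<omega> ^ n = 1}. \<omega> \<noteq> (1::complex) \<longrightarrow> e \<le> dist 1 \<omega>"
    using finite_set_avoid by blast
  then have e: "e > 0" "\<And>\<omega>. \<omega> ^ n = 1 \<Longrightarrow> \<omega> \<noteq> (1::complex) \<Longrightarrow> e \<le> dist 1 \<omega>"
    by auto
  define W1 where "W1 = W \<inter> E -` D"
  have W1: "openin (top_of_set L) W1" "W1 \<subseteq> W"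
    using continuous_openin_preimage_gen[OF E D] openin_trans[OF _ W] by (auto simp: W1_def)
  have "continuous_on W1 (\<lambda>q. r q / \<rho> (E q))"
    using continuous_on_subset[OF r W1(2)] continuous_on_subset[OF E W1(2)] \<rho>
    by (intro continuous_on_divide continuous_on_compose2[OF \<rho>(1)]) (auto simp: W1_def)
  then have 1: "openin (top_of_set L) (W1 \<inter> (\<lambda>q. r q / \<rho> (E q)) -` ball 1 e)"
    using continuous_openin_preimage_gen[OF _ open_ball] openin_trans[OF _ W1(1)] by blast
  have 2: "r q = \<rho> (E q)" if "q \<in> W1 \<inter> (\<lambda>q. r q / \<rho> (E q)) -` ball 1 e" for q
  proof -
    have q: "q \<in> W" "E q \<in> D" "dist 1 (r q / \<rho> (E q)) < e" using that by (auto simp: W1_def)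
    have "(r q / \<rho> (E q)) ^ n = 1"
      using root[OF q(1,2)] \<rho>(2)[OF q(2)] by (simp add: power_divide)
    then have "r q / \<rho> (E q) = 1" using e(2) q(3) by fastforce
    then show ?thesis using \<rho>(2)[OF q(2)] by (simp add: field_simps)
  qed
  have 3: "q0 \<in> W1 \<inter> (\<lambda>q. r q / \<rho> (E q)) -` ball 1 e"
    using q0 e(1) \<rho>(2) by (simp add: W1_def)
  show thesis
  proof (rule that[OF 1 3])
    fix q assume q: "q \<in> W1 \<inter> (\<lambda>q. r q / \<rho> (E q)) -` ball 1 e"
    then have "E q \<in> D" unfolding W1_def by blast
    then show "E q \<in> D \<and> r q = \<rho> (E q)" using 2[OF q] by (rule conjI)
  qed (use W1(2) in blast)
qed

lemma nbhd_of_local_section: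
  assumes "openin (top_of_set L) W'" "P v0 \<in> W'" "\<And>q. q \<in> W' \<Longrightarrow> E q \<in> D \<and> P (E q) = q"
  shows "\<exists>W. openin (top_of_set L) W \<and> P v0 \<in> W \<and> W \<subseteq> P ` D"
  using assms by (metis image_eqI subsetI)

text \<open>
  For \<open>t\<close> as small as this, the face \<open>\<bar>z\<bar> = \<epsilon>\<close> of the polydisc is not reached, and the leaves in \<open>z = 0\<close>
  stay away from the corner. The conditions are symmetric in \<open>k\<close> and \<open>l\<close>, so that statements about one
  face carry over to the other.
\<close>

locale milnor =
  fixes m k l :: nat and \<alpha> \<epsilon> :: real and t :: complex
  assumes m: "m \<ge> 2" and k: "k \<ge> 1" and l: "l \<ge> 1"
    and \<alpha>: "\<alpha> > 0" and \<epsilon>: "\<epsilon> > 0" and t: "t \<noteq> 0"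
    and t_less: "cmod t < \<alpha> ^ (k + l)" and \<epsilon>_big: "\<alpha> ^ (k + l) + cmod t < \<epsilon> ^ m"
begin

abbreviation "L \<equiv> milnor_boundary (germ m k l) \<alpha> \<epsilon> t"

lemma swapped: "milnor m l k \<alpha> \<epsilon> t"
  using m k l \<alpha> \<epsilon> t t_less \<epsilon>_big by unfold_locales (auto simp: add.commute)

text \<open>The face \<open>\<bar>z\<bar> = \<epsilon>\<close> of the polydisc is not reached, since \<open>z\<^sup>m = t + x\<^sup>k y\<^sup>l\<close> is too small.\<close>

lemma z_less:
  assumes "z ^ m = t + x ^ k * y ^ l" "cmod x \<le> \<alpha>" "cmod y \<le> \<alpha>"
  shows "cmod z < \<epsilon>"
proof -
  have "cmod z ^ m = cmod (t + x ^ k * y ^ l)" using assms(1) by (metis norm_power)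
  also have "\<dots> \<le> cmod t + cmod x ^ k * cmod y ^ l"
    using norm_triangle_ineq[of t "x ^ k * y ^ l"] by (simp add: norm_mult norm_power)
  also have "\<dots> \<le> cmod t + \<alpha> ^ (k + l)"
    using assms(2,3) \<alpha> by (auto simp: power_add intro!: mult_mono power_mono)
  also have "\<dots> < \<epsilon> ^ m" using \<epsilon>_big by simp
  finally show ?thesis using \<epsilon> by (meson less_le_not_le not_le power_less_imp_less_base)
qed

lemma mem_L: "(x, y, z) \<in> L \<longleftrightarrow> z ^ m = t + x ^ k * y ^ l \<and> max (cmod x) (cmod y) = \<alpha>"
proof -
  have "closed (polydisc \<alpha> \<epsilon>)" by (auto simp: polydisc_def intro!: closed_Times)
  then have fr: "frontier (polydisc \<alpha> \<epsilon>) = polydisc \<alpha> \<epsilon> - ball 0 \<alpha> \<times> ball 0 \<alpha> \<times> ball 0 \<epsilon>"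
    unfolding frontier_def by (simp add: polydisc_def interior_Times)
  show ?thesis
    unfolding milnor_boundary_def milnor_fibre_def fr
    using z_less[of z x y] by (auto simp: polydisc_def germ_def algebra_simps max_def)
qed

lemma swap_xy_L: "swap_xy p \<in> L \<longleftrightarrow> p \<in> milnor_boundary (germ m l k) \<alpha> \<epsilon> t"
proof -
  interpret s: milnor m l k \<alpha> \<epsilon> t by (rule swapped)
  obtain x y z where p: "p = (x, y, z)" by (cases p)
  show ?thesis unfolding p swap_xy_simps mem_L s.mem_L by (auto simp: mult.commute max.commute)
qed

lemma not_both_zero:
  assumes "(x, y, z) \<in> L"
  shows "z = 0 \<Longrightarrow> x \<noteq> 0 \<and> y \<noteq> 0" and "y = 0 \<Longrightarrow> z \<noteq> 0" and "x = 0 \<Longrightarrow> z \<noteq> 0"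
  using assms m k l t by (auto simp: mem_L power_0_left)

text \<open>
  The arguments and moduli of \<open>x\<close> and \<open>y\<close> give a continuous map \<open>E\<close> with \<open>E (P v0) = v0\<close>. The points \<open>q\<close>
  and \<open>P (E q)\<close> agree in \<open>x\<close> and \<open>y\<close>; their third components are \<open>m\<close>-th roots of the same number,
  hence equal near \<open>P v0\<close>.
\<close>

lemma corner_type_nbhd:
  assumes D: "open D" "continuous_on D P" "P ` D \<subseteq> L" and P: "corner_type \<alpha> D P" and v0: "v0 \<in> D"
  shows "\<exists>W. openin (top_of_set L) W \<and> P v0 \<in> W \<and> W \<subseteq> P ` D"
proof -
  define Z where "Z v = snd (snd (P v))" for v
  have Pv: "P v = (of_real (min \<alpha> (\<alpha> + v$3)) * cis (v$1), of_real (min \<alpha> (\<alpha> - v$3)) * cis (v$2), Z v)"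
    and Z: "Z v \<noteq> 0" and v3: "\<bar>v$3\<bar> < \<alpha>" if "v \<in> D" for v
    using P that unfolding corner_type_def Z_def by force+
  define x0 where "x0 = fst (P v0)"
  define y0 where "y0 = fst (snd (P v0))"
  have xy0: "x0 = of_real (min \<alpha> (\<alpha> + v0$3)) * cis (v0$1)" "y0 = of_real (min \<alpha> (\<alpha> - v0$3)) * cis (v0$2)"
    using Pv[OF v0] by (auto simp: x0_def y0_def)
  have pos: "min \<alpha> (\<alpha> + v0$3) > 0" "min \<alpha> (\<alpha> - v0$3) > 0" using v3[OF v0] by auto
  define E :: "C3 \<Rightarrow> real^3" where
    "E q = vector [v0$1 + Arg (fst q / x0), v0$2 + Arg (fst (snd q) / y0), cmod (fst q) - cmod (fst (snd q))]" for q
  define W where "W = L \<inter> {q. Re (fst q / x0) > 0 \<and> Re (fst (snd q) / y0) > 0}"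
  have ne: "x0 \<noteq> 0" "y0 \<noteq> 0" using pos xy0 by auto
  have W: "openin (top_of_set L) W"
    unfolding W_def by (intro openin_open_Int open_Collect_conj open_Collect_less continuous_intros ballI ne)
  have cE: "continuous_on W E"
    unfolding E_def by (intro continuous_on_vector3 continuous_intros ballI ne)
      (auto simp: W_def complex_nonpos_Reals_iff)
  have PE: "fst (P (E q)) = fst q \<and> fst (snd (P (E q))) = fst (snd q)" if q: "q \<in> W" "E q \<in> D" for q
  proof -
    obtain x y z where qe: "q = (x, y, z)" by (cases q)
    have xy: "x \<noteq> 0" "y \<noteq> 0" using q by (auto simp: qe W_def)
    have mx: "max (cmod x) (cmod y) = \<alpha>" using q by (auto simp: qe W_def mem_L)
    then have "min \<alpha> (\<alpha> + (cmod x - cmod y)) = cmod x" "min \<alpha> (\<alpha> - (cmod x - cmod y)) = cmod y"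
      by (auto simp: max_def split: if_splits)
    then show ?thesis
      using Pv[OF q(2)] angle_continuation[OF xy0(1) pos(1) xy(1)] angle_continuation[OF xy0(2) pos(2) xy(2)]
      by (simp add: E_def qe)
  qed
  have zL: "snd (snd p) ^ m = t + fst p ^ k * fst (snd p) ^ l" if "p \<in> L" for p
    using that by (cases p) (auto simp: mem_L)
  have mv: "max (cmod x0) (cmod y0) = \<alpha>"
    using D(3) v0 by (cases "P v0") (auto simp: x0_def y0_def mem_L)
  have Ev0: "E (P v0) = v0"
    using ne pos v3[OF v0] unfolding E_def x0_def[symmetric] y0_def[symmetric]
    by (auto simp: vec_eq_iff forall_3 xy0 norm_mult min_def)
  obtain W' where W': "openin (top_of_set L) W'" "P v0 \<in> W'" "W' \<subseteq> W"
    "\<And>q. q \<in> W' \<Longrightarrow> E q \<in> D \<and> snd (snd q) = Z (E q)"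
  proof (rule root_branch_unique_nearby[OF W cE, of "\<lambda>q. snd (snd q)" D Z m "P v0"])
    show "continuous_on D Z" unfolding Z_def by (intro continuous_intros D)
    show "snd (snd q) ^ m = Z (E q) ^ m" if "q \<in> W" "E q \<in> D" for q
      using zL[of q] zL[of "P (E q)"] PE[OF that] that D(3) by (auto simp: W_def Z_def)
    show "P v0 \<in> W" using v0 D(3) ne by (auto simp: W_def x0_def y0_def)
  qed (use D v0 Z Ev0 m in \<open>auto intro!: continuous_intros simp: Z_def\<close>)
  have "P (E q) = q" if "q \<in> W'" for q
    using W'(3,4) that PE[of q] by (auto simp: Z_def prod_eq_iff)
  with W' show ?thesis by (intro nbhd_of_local_section[of L W' P v0 E D]) auto
qed

text \<open>
  The same argument with other coordinates. The component determined as a root is \<open>y\<close> for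
  \<open>slice_type\<close> and \<open>z\<close> for \<open>disc_type\<close>.
\<close>

lemma edge_type_nbhd:
  assumes D: "open D" "continuous_on D P" "P ` D \<subseteq> L" and P: "edge_type \<alpha> D P" and v0: "v0 \<in> D"
  shows "\<exists>W. openin (top_of_set L) W \<and> P v0 \<in> W \<and> W \<subseteq> P ` D"
proof -
  have xD: "fst (P v) = of_real \<alpha> * cis (v$1)" and yD: "cmod (fst (snd (P v))) < \<alpha>" if "v \<in> D" for v
    using P that unfolding edge_type_def slice_type_def disc_type_def by fastforce+
  define x0 where "x0 = fst (P v0)"
  have x0: "x0 = of_real \<alpha> * cis (v0$1)" "x0 \<noteq> 0" using xD[OF v0] \<alpha> by (auto simp: x0_def)
  have zL: "snd (snd p) ^ m = t + fst p ^ k * fst (snd p) ^ l" if "p \<in> L" for p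
    using that by (cases p) (auto simp: mem_L)
  define W where "W = L \<inter> {q. Re (fst q / x0) > 0 \<and> cmod (fst (snd q)) < \<alpha>}"
  have W: "openin (top_of_set L) W"
    unfolding W_def by (intro openin_open_Int open_Collect_conj open_Collect_less continuous_intros ballI x0)
  have Pv0: "P v0 \<in> W" using v0 D(3) x0 yD[OF v0] by (auto simp: W_def x0_def)
  have cA: "continuous_on W (\<lambda>q. v0$1 + Arg (fst q / x0))"
    by (intro continuous_intros x0) (auto simp: W_def complex_nonpos_Reals_iff)
  have xW: "of_real \<alpha> * cis (v0$1 + Arg (fst q / x0)) = fst q" if "q \<in> W" for q
  proof -
    have "cmod (fst q) = \<alpha>" using that by (cases q) (auto simp: W_def mem_L max_def split: if_splits)
    moreover have "fst q \<noteq> 0" using that by (auto simp: W_def)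
    ultimately show ?thesis using angle_continuation[OF x0(1) \<alpha>, of "fst q"] by simp
  qed
  have A0: "Arg (fst (P v0) / x0) = 0" using x0 by (simp add: x0_def)
  from P consider "slice_type \<alpha> D P" | "disc_type \<alpha> D P" unfolding edge_type_def by blast
  then show ?thesis
  proof cases
    case 1
    define Y where "Y v = fst (snd (P v))" for v
    have Pv: "P v = (of_real \<alpha> * cis (v$1), Y v, Complex (v$2) (v$3))" and Y: "Y v \<noteq> 0" if "v \<in> D" for v
      using 1 that unfolding slice_type_def Y_def by force+
    define E :: "C3 \<Rightarrow> real^3" where
      "E q = vector [v0$1 + Arg (fst q / x0), Re (snd (snd q)), Im (snd (snd q))]" for q
    have cE: "continuous_on W E" unfolding E_def by (intro continuous_on_vector3 continuous_intros cA)
    have PE: "P (E q) = (fst q, Y (E q), snd (snd q))" if q: "q \<in> W" "E q \<in> D" for q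
      using Pv[OF q(2)] xW[OF q(1)] by (simp add: E_def)
    have Ev0: "E (P v0) = v0"
      using Pv[OF v0] A0 by (auto simp: E_def vec_eq_iff forall_3)
    obtain W' where W': "openin (top_of_set L) W'" "P v0 \<in> W'" "W' \<subseteq> W"
      "\<And>q. q \<in> W' \<Longrightarrow> E q \<in> D \<and> fst (snd q) = Y (E q)"
    proof (rule root_branch_unique_nearby[OF W cE, of "\<lambda>q. fst (snd q)" D Y l "P v0"])
      show "continuous_on D Y" unfolding Y_def by (intro continuous_intros D)
      show "fst (snd q) ^ l = Y (E q) ^ l" if "q \<in> W" "E q \<in> D" for q
      proof -
        have "fst q ^ k * fst (snd q) ^ l = fst q ^ k * Y (E q) ^ l"
          using zL[of q] zL[of "P (E q)"] PE[OF that] that D(3) by (auto simp: W_def)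
        then show ?thesis using that by (auto simp: W_def)
      qed
    qed (use D v0 Y Ev0 l Pv0 in \<open>auto intro!: continuous_intros simp: Y_def\<close>)
    have "P (E q) = q" if "q \<in> W'" for q
      using W'(3,4) that PE[of q] by (auto simp: prod_eq_iff)
    with W' show ?thesis by (intro nbhd_of_local_section[of L W' P v0 E D]) auto
  next
    case 2
    define Z where "Z v = snd (snd (P v))" for v
    have Pv: "P v = (of_real \<alpha> * cis (v$1), Complex (v$2) (v$3), Z v)" and Z: "Z v \<noteq> 0" if "v \<in> D" for v
      using 2 that unfolding disc_type_def Z_def by force+
    define E :: "C3 \<Rightarrow> real^3" where
      "E q = vector [v0$1 + Arg (fst q / x0), Re (fst (snd q)), Im (fst (snd q))]" for q
    have cE: "continuous_on W E" unfolding E_def by (intro continuous_on_vector3 continuous_intros cA)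
    have PE: "P (E q) = (fst q, fst (snd q), Z (E q))" if q: "q \<in> W" "E q \<in> D" for q
      using Pv[OF q(2)] xW[OF q(1)] by (simp add: E_def)
    have Ev0: "E (P v0) = v0"
      using Pv[OF v0] A0 by (auto simp: E_def vec_eq_iff forall_3)
    obtain W' where W': "openin (top_of_set L) W'" "P v0 \<in> W'" "W' \<subseteq> W"
      "\<And>q. q \<in> W' \<Longrightarrow> E q \<in> D \<and> snd (snd q) = Z (E q)"
    proof (rule root_branch_unique_nearby[OF W cE, of "\<lambda>q. snd (snd q)" D Z m "P v0"])
      show "continuous_on D Z" unfolding Z_def by (intro continuous_intros D)
      show "snd (snd q) ^ m = Z (E q) ^ m" if "q \<in> W" "E q \<in> D" for q
        using zL[of q] zL[of "P (E q)"] PE[OF that] that D(3) by (auto simp: W_def)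
    qed (use D v0 Z Ev0 m Pv0 in \<open>auto intro!: continuous_intros simp: Z_def\<close>)
    have "P (E q) = q" if "q \<in> W'" for q
      using W'(3,4) that PE[of q] by (auto simp: prod_eq_iff)
    with W' show ?thesis by (intro nbhd_of_local_section[of L W' P v0 E D]) auto
  qed
qed

lemma admissible_nbhd:
  assumes "admissible L \<alpha> D P" and v0: "v0 \<in> D"
  shows "\<exists>W. openin (top_of_set L) W \<and> P v0 \<in> W \<and> W \<subseteq> P ` D"
proof -
  from assms(1) have D: "open D" "continuous_on D P" "P ` D \<subseteq> L" by (auto simp: admissible_def)
  from assms(1) consider "corner_type \<alpha> D P" | "edge_type \<alpha> D P" | "edge_type \<alpha> D (swap_xy \<circ> P)"
    by (auto simp: admissible_def)
  then show ?thesis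
  proof cases
    case 3
    interpret s: milnor m l k \<alpha> \<epsilon> t by (rule swapped)
    have "(swap_xy \<circ> P) ` D \<subseteq> s.L" using D(3) by (auto simp: s.swap_xy_L)
    then obtain W where W: "openin (top_of_set s.L) W" "swap_xy (P v0) \<in> W" "W \<subseteq> (swap_xy \<circ> P) ` D"
      using s.edge_type_nbhd[OF D(1) swap_xy_continuous[OF D(2)] _ 3 v0] by auto
    have "continuous_on L swap_xy" by (rule linear_continuous_on[OF bounded_linear_swap_xy])
    then have "openin (top_of_set L) (L \<inter> swap_xy -` W)"
      by (rule continuous_openin_preimage[OF _ _ W(1)]) (auto simp: s.swap_xy_L)
    moreover have "L \<inter> swap_xy -` W \<subseteq> P ` D"
    proof
      fix q assume "q \<in> L \<inter> swap_xy -` W"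
      then obtain v where "v \<in> D" "swap_xy q = swap_xy (P v)" using W(3) by auto
      then show "q \<in> P ` D" by (metis image_eqI swap_xy_simps(2))
    qed
    ultimately show ?thesis using W(2) v0 D(3) by (intro exI[of _ "L \<inter> swap_xy -` W"]) auto
  qed (use corner_type_nbhd edge_type_nbhd D v0 in auto)
qed

lemma admissible_open_map:
  assumes "admissible L \<alpha> D P" and "open D'" "D' \<subseteq> D"
  shows "openin (top_of_set L) (P ` D')"
proof (subst openin_subopen, intro ballI)
  fix q assume "q \<in> P ` D'"
  then obtain v where "v \<in> D'" "q = P v" by auto
  then show "\<exists>T. openin (top_of_set L) T \<and> q \<in> T \<and> T \<subseteq> P ` D'"
    using admissible_nbhd[OF admissible_subset[OF assms(1,3,2)]] by blast
qed

lemma admissible_locally_inj: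
  assumes "admissible L \<alpha> D P" "u \<in> D" "v \<in> D" "dist u v < 1" "P u = P v"
  shows "u = v"
proof -
  have d: "\<bar>u$i - v$i\<bar> < 2 * pi" for i
  proof -
    have "\<bar>u$i - v$i\<bar> < 1" using assms(4) dist_vec_nth_le[of u i v] by (simp add: dist_real_def)
    then show ?thesis using pi_gt3 by linarith
  qed
  have edge: "u = v" if "edge_type \<alpha> D Q" "Q u = Q v" for Q
    using that(1) unfolding edge_type_def
  proof
    assume "slice_type \<alpha> D Q"
    then obtain y y' where "Q u = (of_real \<alpha> * cis (u$1), y, Complex (u$2) (u$3))"
      "Q v = (of_real \<alpha> * cis (v$1), y', Complex (v$2) (v$3))"
      using assms(2,3) unfolding slice_type_def by meson
    then show ?thesis using that(2) d[of 1] \<alpha> cis_inj_small by (simp add: vec_eq_iff forall_3)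
  next
    assume "disc_type \<alpha> D Q"
    then obtain z z' where "Q u = (of_real \<alpha> * cis (u$1), Complex (u$2) (u$3), z)"
      "Q v = (of_real \<alpha> * cis (v$1), Complex (v$2) (v$3), z')"
      using assms(2,3) unfolding disc_type_def by meson
    then show ?thesis using that(2) d[of 1] \<alpha> cis_inj_small by (simp add: vec_eq_iff forall_3)
  qed
  from assms(1) consider "corner_type \<alpha> D P" | "edge_type \<alpha> D P" | "edge_type \<alpha> D (swap_xy \<circ> P)"
    by (auto simp: admissible_def)
  then show ?thesis
  proof cases
    case 1
    then have P: "fst (P v) = of_real (min \<alpha> (\<alpha> + v$3)) * cis (v$1)" 
       "fst (snd (P v)) = of_real (min \<alpha> (\<alpha> - v$3)) * cis (v$2)" "\<bar>v$3\<bar> < \<alpha>" if "v \<in> D" for v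
      using that unfolding corner_type_def by force+
    have c: "cmod (fst (P v)) - cmod (fst (snd (P v))) = v$3"
      "sgn (fst (P v)) = cis (v$1)" "sgn (fst (snd (P v))) = cis (v$2)" if "v \<in> D" for v
      using P[OF that] by (auto simp: norm_mult min_def sgn_mult sgn_of_real)
    show ?thesis
      using c[OF assms(2)] c[OF assms(3)] assms(5) d cis_inj_small
      by (simp add: vec_eq_iff forall_3)
  qed (use edge assms(5) in auto)
qed

end

section \<open>Smoothness of the parametrisations\<close>

context milnor begin

lemma L_equation: "p \<in> L \<Longrightarrow> snd (snd p) ^ m = t + fst p ^ k * fst (snd p) ^ l"
  by (cases p) (auto simp: mem_L)

text \<open>
  The third component is an \<open>m\<close>-th root of \<open>t + x\<^sup>k y\<^sup>l\<close>.
\<close>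

lemma Ck_on_from_xy:
  assumes T: "open T" "continuous_on T P" "P ` T \<subseteq> L"
    and "Ck_on n T (\<lambda>v. fst (P v))" "Ck_on n T (\<lambda>v. fst (snd (P v)))"
    and "\<And>v. v \<in> T \<Longrightarrow> snd (snd (P v)) \<noteq> 0"
  shows "Ck_on n T P"
proof -
  have "Ck_on n T (\<lambda>v. snd (snd (P v)))"
  proof (rule Ck_on_root[OF T(1), where j = m])
    show "snd (snd (P v)) ^ m = t + fst (P v) ^ k * fst (snd (P v)) ^ l" if "v \<in> T" for v
      using that T(3) L_equation by blast
    show "Ck_on n T (\<lambda>v. t + fst (P v) ^ k * fst (snd (P v)) ^ l)"
      by (intro Ck_on_intros assms)
  qed (use assms m in \<open>auto intro!: continuous_intros\<close>)
  then have "Ck_on n T (\<lambda>v. (fst (P v), fst (snd (P v)), snd (snd (P v))))"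
    by (intro Ck_on_Pair assms)
  then show ?thesis by simp
qed

text \<open>
  The second component is an \<open>l\<close>-th root of \<open>(z\<^sup>m - t) / x\<^sup>k\<close>.
\<close>

lemma Ck_on_from_xz:
  assumes T: "open T" "continuous_on T P" "P ` T \<subseteq> L"
    and x: "Ck_on n T (\<lambda>v. fst (P v))" and "Ck_on n T (\<lambda>v. snd (snd (P v)))"
    and nz: "\<And>v. v \<in> T \<Longrightarrow> fst (P v) \<noteq> 0 \<and> fst (snd (P v)) \<noteq> 0"
  shows "Ck_on n T P"
proof -
  have "Ck_on n T (\<lambda>v. fst (snd (P v)))"
  proof (rule Ck_on_root[OF T(1), where j = l])
    show "fst (snd (P v)) ^ l = (snd (snd (P v)) ^ m - t) * inverse (fst (P v) ^ k)" if "v \<in> T" for v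
      using L_equation[of "P v"] that T(3) nz[OF that] by (auto simp: field_simps)
    show "Ck_on n T (\<lambda>v. (snd (snd (P v)) ^ m - t) * inverse (fst (P v) ^ k))"
      by (intro Ck_on_intros Ck_on_inverse assms) (use nz in auto)
  qed (use assms l in \<open>auto intro!: continuous_intros\<close>)
  then have "Ck_on n T (\<lambda>v. (fst (P v), fst (snd (P v)), snd (snd (P v))))"
    by (intro Ck_on_Pair assms)
  then show ?thesis by simp
qed

lemma edge_Ck_on:
  assumes D: "open D" "continuous_on D P" "P ` D \<subseteq> L" and P: "edge_type \<alpha> D P"
  shows "Ck_on n D P"
proof -
  have x: "Ck_on n D (\<lambda>v. fst (P v))"
    by (rule Ck_on_cong[OF D(1) edge_typeD(1)[OF P, symmetric]], assumption) (intro Ck_on_intros D)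
  from P consider "slice_type \<alpha> D P" | "disc_type \<alpha> D P" unfolding edge_type_def by blast
  then show ?thesis
  proof cases
    case 1
    have "Ck_on n D (\<lambda>v. snd (snd (P v)))"
      by (rule Ck_on_cong[OF D(1) slice_typeD(2)[OF 1, symmetric]], assumption) (intro Ck_on_intros D)
    then show ?thesis
      by (rule Ck_on_from_xz[OF D x]) (use slice_typeD[OF 1] \<alpha> in auto)
  next
    case 2
    have "Ck_on n D (\<lambda>v. fst (snd (P v)))"
      by (rule Ck_on_cong[OF D(1) disc_typeD(2)[OF 2, symmetric]], assumption) (intro Ck_on_intros D)
    then show ?thesis
      by (rule Ck_on_from_xy[OF D x]) (use disc_typeD[OF 2] \<alpha> in auto)
  qed
qed

text \<open>
  On either side of \<open>v $ 3 = 0\<close> both minima in \<open>corner_type\<close> are affine functions of \<open>v $ 3\<close>.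
\<close>

lemma corner_Ck_on:
  assumes D: "open D" "continuous_on D P" "P ` D \<subseteq> L" and P: "corner_type \<alpha> D P"
    and "\<And>v. v \<in> D \<Longrightarrow> v$3 \<noteq> 0"
  shows "Ck_on n D P"
proof -
  have pos: "Ck_on n (D \<inter> {v. v$3 > 0}) P"
  proof -
    let ?T = "D \<inter> {v::real^3. v$3 > 0}"
    have T: "open ?T" by (intro open_Int D open_Collect_less continuous_intros)
    have e: "of_real \<alpha> * cis (v$1) = fst (P v)" "of_real (\<alpha> - v$3) * cis (v$2) = fst (snd (P v))"
      if "v \<in> ?T" for v using corner_typeD[OF P, of v] that by auto
    have x: "Ck_on n ?T (\<lambda>v. fst (P v))"
      by (rule Ck_on_cong[OF T e(1)], assumption) (intro Ck_on_intros T)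
    have y: "Ck_on n ?T (\<lambda>v. fst (snd (P v)))"
      by (rule Ck_on_cong[OF T e(2)], assumption) (intro Ck_on_intros T)
    show ?thesis
      by (rule Ck_on_from_xy[OF T continuous_on_subset[OF D(2)] _ x y]) (use D corner_typeD[OF P] in auto)
  qed
  have neg: "Ck_on n (D \<inter> {v. v$3 < 0}) P"
  proof -
    let ?T = "D \<inter> {v::real^3. v$3 < 0}"
    have T: "open ?T" by (intro open_Int D open_Collect_less continuous_intros)
    have e: "of_real (\<alpha> + v$3) * cis (v$1) = fst (P v)" "of_real \<alpha> * cis (v$2) = fst (snd (P v))"
      if "v \<in> ?T" for v using corner_typeD[OF P, of v] that by auto
    have x: "Ck_on n ?T (\<lambda>v. fst (P v))"
      by (rule Ck_on_cong[OF T e(1)], assumption) (intro Ck_on_intros T)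
    have y: "Ck_on n ?T (\<lambda>v. fst (snd (P v)))"
      by (rule Ck_on_cong[OF T e(2)], assumption) (intro Ck_on_intros T)
    show ?thesis
      by (rule Ck_on_from_xy[OF T continuous_on_subset[OF D(2)] _ x y]) (use D corner_typeD[OF P] in auto)
  qed
  have o: "open (D \<inter> {v. v$3 > 0})" "open (D \<inter> {v. v$3 < 0})"
    by (intro open_Int D open_Collect_less continuous_intros)+
  show ?thesis
  proof (rule Ck_on_local)
    fix v assume "v \<in> D"
    then consider "v \<in> D \<inter> {v. v$3 > 0}" | "v \<in> D \<inter> {v. v$3 < 0}" using assms(5)[of v] by fastforce
    then show "\<exists>T. v \<in> T \<and> open T \<and> Ck_on n T P"
    proof cases
      case 1
      then show ?thesis using pos o(1) by (intro exI conjI)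
    next
      case 2
      then show ?thesis using neg o(2) by (intro exI conjI)
    qed
  qed
qed

lemma admissible_swap_xy:
  assumes "admissible L \<alpha> D P" "edge_type \<alpha> D (swap_xy \<circ> P)"
  shows "open D" "continuous_on D (swap_xy \<circ> P)" "(swap_xy \<circ> P) ` D \<subseteq> milnor_boundary (germ m l k) \<alpha> \<epsilon> t"
proof -
  interpret s: milnor m l k \<alpha> \<epsilon> t by (rule swapped)
  show "open D" "continuous_on D (swap_xy \<circ> P)" "(swap_xy \<circ> P) ` D \<subseteq> s.L"
    using assms swap_xy_continuous by (auto simp: admissible_def s.swap_xy_L)
qed

lemma admissible_cases [consumes 1, case_names corner edge swapped_edge]:
  assumes "admissible L \<alpha> D P"
  obtains "corner_type \<alpha> D P" | "edge_type \<alpha> D P" | "edge_type \<alpha> D (swap_xy \<circ> P)"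
  using assms by (auto simp: admissible_def)

lemma open_preimage:
  assumes "admissible L \<alpha> D P" "open S"
  shows "open {v \<in> D. P v \<in> S}"
proof -
  have "open (D \<inter> P -` S)" 
    using assms continuous_open_preimage unfolding admissible_def by blast
  then show ?thesis by (simp add: Collect_conj_eq vimage_def)
qed

lemma closed_corner: "closed (corner \<alpha>)"
proof -
  have "corner \<alpha> = {p. cmod (fst p) = \<alpha> \<and> cmod (fst (snd p)) = \<alpha>}" using mem_corner by auto
  then show ?thesis by (auto intro!: closed_Collect_conj closed_Collect_eq continuous_intros)
qed

lemma open_off_corner: "admissible L \<alpha> D P \<Longrightarrow> open {v \<in> D. P v \<notin> corner \<alpha>}"
  using open_preimage[of D P "- corner \<alpha>"] closed_corner by auto

lemma open_off_axes: "admissible L \<alpha> D P \<Longrightarrow> open {v \<in> D. fst (P v) \<noteq> 0 \<and> fst (snd (P v)) \<noteq> 0}"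
  using open_preimage[of D P "{p. fst p \<noteq> 0 \<and> fst (snd p) \<noteq> 0}"]
    open_Collect_conj[OF open_Collect_neq[of fst "\<lambda>_. 0"] open_Collect_neq[of "\<lambda>p. fst (snd p)" "\<lambda>_. 0"]]
  by (simp add: continuous_on_fst continuous_on_snd)

lemma swapped_edge_Ck_on:
  assumes "admissible L \<alpha> D P" "edge_type \<alpha> D (swap_xy \<circ> P)"
  shows "Ck_on n D P"
proof -
  interpret s: milnor m l k \<alpha> \<epsilon> t by (rule swapped)
  have "Ck_on n D (swap_xy \<circ> P)"
    using s.edge_Ck_on[OF admissible_swap_xy[OF assms] assms(2)] .
  from Ck_on_linear_comp[OF bounded_linear_swap_xy admissible_swap_xy(1)[OF assms] this]
  show ?thesis by simp
qed

lemma admissible_Ck_on: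
  assumes "admissible L \<alpha> D P"
  shows "Ck_on n {v \<in> D. P v \<notin> corner \<alpha>} P"
  using assms
proof (cases rule: admissible_cases)
  case corner
  show ?thesis
    by (rule corner_Ck_on[OF open_off_corner[OF assms]])
      (use corner_type_mem_corner[OF corner] assms corner in
        \<open>auto simp: admissible_def intro: continuous_on_subset type_subset(1)[rotated]\<close>)
next
  case edge
  then have "Ck_on n D P" using assms edge_Ck_on unfolding admissible_def by blast
  then show ?thesis by (rule Ck_on_subset) auto
next
  case swapped_edge
  show ?thesis by (rule Ck_on_subset[OF swapped_edge_Ck_on[OF assms swapped_edge]]) auto
qed

text \<open>
  For \<open>corner_type\<close> the minima disappear from the straightened map. The other kinds avoid the corner,
  where nothing but the smoothness of \<open>straightening\<close> off the axes is needed.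
\<close>

lemma straightening_Ck_on:
  assumes "admissible L \<alpha> D P"
  shows "Ck_on n {v \<in> D. fst (P v) \<noteq> 0 \<and> fst (snd (P v)) \<noteq> 0} (straightening \<circ> P)"
proof -
  let ?S = "{v \<in> D. fst (P v) \<noteq> 0 \<and> fst (snd (P v)) \<noteq> 0}"
  note S = open_off_axes[OF assms]
  have smooth: ?thesis if "Ck_on n ?S P"
  proof -
    have "Ck_on n ?S (\<lambda>v. (sgn (fst (P v)), sgn (fst (snd (P v))), cmod (fst (P v)) - cmod (fst (snd (P v)))))"
      by (intro Ck_on_Pair Ck_on_diff Ck_on_sgn Ck_on_cmod Ck_on_fst Ck_on_snd S that) auto
    then show ?thesis by (simp add: straightening_def case_prod_beta o_def)
  qed
  show ?thesis using assms
  proof (cases rule: admissible_cases)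
    case corner
    have "Ck_on n ?S (\<lambda>v. (cis (v$1), cis (v$2), v$3))" by (intro Ck_on_intros S)
    then show ?thesis
      by (rule Ck_on_cong[OF S, rotated]) (simp add: straightening_corner_type[OF corner])
  next
    case edge
    then show ?thesis using edge_not_corner Ck_on_subset[OF admissible_Ck_on[OF assms], of ?S n]
      by (intro smooth) auto
  next
    case swapped_edge
    then show ?thesis using edge_not_corner Ck_on_subset[OF admissible_Ck_on[OF assms], of ?S n]
      by (intro smooth) auto
  qed
qed

end

section \<open>Orientation\<close>

lemma vector_4:
  "(vector [a, b, c, d] :: 'a::zero^4) $ 1 = a" "(vector [a, b, c, d] :: 'a^4) $ 2 = b"
  "(vector [a, b, c, d] :: 'a^4) $ 3 = c" "(vector [a, b, c, d] :: 'a^4) $ 4 = d"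
  unfolding vector_def by simp_all

text \<open>
  These are the matrices of the frames adapted to a face; which of them occurs depends on the order
  in which a parametrisation lists the coordinates of that face.
\<close>

lemma det_block:
  fixes p q r s :: real
  shows "det (vector [vector [1, 0, 0, 0], vector [0, 1, 0, 0], vector [0, 0, p, q], vector [0, 0, r, s]] :: real^4^4)
      = p * s - q * r" (is "det ?A = _")
    and "det (vector [vector [1, 0, 0, 0], vector [0, 0, r, s], vector [0, 1, 0, 0], vector [0, 0, p, q]] :: real^4^4)
      = p * s - q * r" (is "det ?B = _")
proof -
  have f: "finite {2::4, 3, 4}" "1 \<notin> {2::4, 3, 4}" "finite {3::4, 4}" "2 \<notin> {3::4, 4}"
    "finite {4::4}" "3 \<notin> {4::4}" by auto
  show "det ?A = p * s - q * r"
    unfolding det_def UNIV_4 sum_over_permutations_insert[OF f(1,2)]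
      sum_over_permutations_insert[OF f(3,4)] sum_over_permutations_insert[OF f(5,6)] permutes_sing
    by (simp add: sign_swap_id permutation_swap_id sign_compose sign_id swap_id_eq vector_4)
  show "det ?B = p * s - q * r"
    unfolding det_def UNIV_4 sum_over_permutations_insert[OF f(1,2)]
      sum_over_permutations_insert[OF f(3,4)] sum_over_permutations_insert[OF f(5,6)] permutes_sing
    by (simp add: sign_swap_id permutation_swap_id sign_compose sign_id swap_id_eq vector_4)
qed

definition dgerm :: "nat \<Rightarrow> nat \<Rightarrow> nat \<Rightarrow> C3 \<Rightarrow> C3 \<Rightarrow> complex" where
  "dgerm m k l = (\<lambda>(x, y, z) (a, b, c).
     of_nat m * z ^ (m - 1) * c - (of_nat k * x ^ (k - 1) * a * y ^ l + x ^ k * (of_nat l * y ^ (l - 1) * b)))"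

lemma has_derivative_germ: "(germ m k l has_derivative dgerm m k l p) (at p)"
proof -
  have g: "germ m k l = (\<lambda>p. snd (snd p) ^ m - fst p ^ k * fst (snd p) ^ l)"
    by (auto simp: germ_def fun_eq_iff)
  have d: "dgerm m k l p = (\<lambda>h. of_nat m * snd (snd h) * snd (snd p) ^ (m - 1)
      - (fst p ^ k * (of_nat l * fst (snd h) * fst (snd p) ^ (l - 1))
       + of_nat k * fst h * fst p ^ (k - 1) * fst (snd p) ^ l))"
    by (auto simp: dgerm_def fun_eq_iff case_prod_beta algebra_simps)
  show ?thesis
    unfolding g d by (auto intro!: derivative_eq_intros)
qed

lemma dgerm_times_i: "dgerm m k l p (times_i u) = \<i> * dgerm m k l p u"
  by (cases p; cases u) (auto simp: dgerm_def times_i_def algebra_simps)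

lemma dgerm_minus: "dgerm m k l p (- u) = - dgerm m k l p u"
  by (cases p; cases u) (auto simp: dgerm_def algebra_simps)

lemma dgerm_swap_xy: "dgerm m l k (swap_xy p) (swap_xy u) = dgerm m k l p u"
  by (cases p; cases u) (auto simp: dgerm_def algebra_simps)

lemma interior_polydisc: "interior (polydisc \<alpha> \<epsilon>) = ball 0 \<alpha> \<times> ball 0 \<alpha> \<times> ball 0 \<epsilon>"
  by (simp add: polydisc_def interior_Times)

text \<open>
  The tangent vectors of the level surface at \<open>p\<close> with vanishing \<open>x\<close>-component form a complex line. Its
  complex coordinate is \<open>dy\<close> where \<open>z \<noteq> 0\<close>, and \<open>dz\<close> where \<open>z = 0\<close>, because \<open>dy\<close> vanishes on it there.
\<close>

definition transverse_coordinate :: "C3 \<Rightarrow> C3 \<Rightarrow> complex" where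
  "transverse_coordinate p u = (if snd (snd p) \<noteq> 0 then fst (snd u) else snd (snd u))"

text \<open>
  Here \<open>P'\<close> stands for the derivative of a parametrisation at a point \<open>p\<close> of the face \<open>\<bar>x\<bar> = \<alpha>\<close>. The
  direction \<open>f1\<close> rotates \<open>x\<close>, and the other two directions give a positively oriented real basis of the
  complex line \<open>dx = 0\<close>. The order of the three directions matters up to cyclic permutation; the
  second order occurs for \<open>corner_type\<close> on the face \<open>\<bar>y\<bar> = \<alpha>\<close> after exchanging \<open>x\<close> and \<open>y\<close>.

  This one condition yields the orientation as a boundary and the positivity of the Jacobians
  of the transition maps.
\<close>

definition positive_on_face :: "C3 \<Rightarrow> (real^3 \<Rightarrow> C3) \<Rightarrow> bool" where
  "positive_on_face p P' \<longleftrightarrow>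
     (\<exists>(f1, f2, f3)\<in>{(axis 1 1, axis 2 1, axis 3 1), (axis 2 1, axis 3 1, axis 1 1)}.
        fst (P' f1) = \<i> * fst p \<and> fst (P' f2) = 0 \<and> fst (P' f3) = 0 \<and>
        Im (cnj (transverse_coordinate p (P' f2)) * transverse_coordinate p (P' f3)) > 0)"

lemma positive_on_faceE:
  assumes "positive_on_face p P'"
  obtains f1 f2 f3 where "(f1, f2, f3) \<in> {(axis 1 1, axis 2 1, axis 3 1), (axis 2 1, axis 3 1, axis 1 1)}"
    "fst (P' f1) = \<i> * fst p" "fst (P' f2) = 0" "fst (P' f3) = 0"
    "Im (cnj (transverse_coordinate p (P' f2)) * transverse_coordinate p (P' f3)) > 0"
  using assms unfolding positive_on_face_def by blast

lemma linear_on_vec3: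
  assumes "linear (P' :: real^3 \<Rightarrow> 'b::real_vector)"
  shows "P' h = h$1 *\<^sub>R P' (axis 1 1) + h$2 *\<^sub>R P' (axis 2 1) + h$3 *\<^sub>R P' (axis 3 1)"
proof -
  have "h = h$1 *\<^sub>R axis 1 1 + h$2 *\<^sub>R axis 2 1 + h$3 *\<^sub>R axis 3 1"
    by (auto simp: vec_eq_iff forall_3 axis_def)
  then have "P' h = P' (h$1 *\<^sub>R axis 1 1 + h$2 *\<^sub>R axis 2 1 + h$3 *\<^sub>R axis 3 1)" by simp
  then show ?thesis by (simp only: linear_add[OF assms] linear_cmul[OF assms])
qed

lemma linear_transverse_coordinate: "linear (transverse_coordinate p)"
  by (auto simp: transverse_coordinate_def linear_iff)

lemma Im_cnj_mult_i: "Im (cnj w * (w * \<i>)) = (cmod w)\<^sup>2"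
  unfolding cmod_power2 by (simp add: power2_eq_square)

lemma real_independent_if_oriented:
  assumes "Im (cnj b * c) > 0" "r *\<^sub>R b + s *\<^sub>R c = 0"
  shows "r = 0 \<and> s = 0"
proof -
  have "r * Im (cnj b * c) = - Im (cnj c * (r *\<^sub>R b + s *\<^sub>R c))"
       "s * Im (cnj b * c) = Im (cnj b * (r *\<^sub>R b + s *\<^sub>R c))"
    by (auto simp: algebra_simps)
  then show ?thesis using assms by simp
qed

lemma positive_on_face_inj:
  assumes "linear P'" "positive_on_face p P'" "fst p \<noteq> 0"
  shows "inj P'"
proof -
  have "h = 0" if "P' h = 0" for h
  proof -
    let ?w = "transverse_coordinate p"
    have w: "linear (\<lambda>h. ?w (P' h))" "linear (\<lambda>h. fst (P' h))"
      using linear_compose[OF assms(1) linear_transverse_coordinate] linear_compose[OF assms(1) linear_fst]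
      by (auto simp: o_def)
    have eq: "0 = h$1 *\<^sub>R fst (P' (axis 1 1)) + h$2 *\<^sub>R fst (P' (axis 2 1)) + h$3 *\<^sub>R fst (P' (axis 3 1))"
       "0 = h$1 *\<^sub>R ?w (P' (axis 1 1)) + h$2 *\<^sub>R ?w (P' (axis 2 1)) + h$3 *\<^sub>R ?w (P' (axis 3 1))"
      using linear_on_vec3[OF w(2), of h] linear_on_vec3[OF w(1), of h] that
        linear_0[OF linear_transverse_coordinate] by simp_all
    show ?thesis
      using assms(2,3) eq real_independent_if_oriented
      by (fastforce simp: positive_on_face_def vec_eq_iff forall_3 add.commute)
  qed
  then show ?thesis using linear_injective_0[OF assms(1)] by blast
qed

text \<open>
  A single linear map \<open>\<Lambda>\<close> to \<open>\<real>\<^sup>3\<close>, depending on the point alone, makes both derivatives into matrices of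
  positive determinant; the determinant of \<open>\<tau>'\<close> is their quotient.
\<close>

lemma positive_on_face_det:
  assumes "fst p \<noteq> 0" and lin: "linear P'" "linear Q'" "linear \<tau>'" and "P' = Q' \<circ> \<tau>'"
    and pos: "positive_on_face p P'" "positive_on_face p Q'"
  shows "det (matrix \<tau>') > 0"
proof -
  define \<Lambda> :: "C3 \<Rightarrow> real^3" where
    "\<Lambda> u = vector [Im (cnj (fst p) * fst u), Re (transverse_coordinate p u), Im (transverse_coordinate p u)]" for u
  have \<Lambda>: "linear \<Lambda>"
    unfolding linear_iff \<Lambda>_def
    by (auto simp: vec_eq_iff forall_3 linear_add[OF linear_transverse_coordinate]
        linear_cmul[OF linear_transverse_coordinate] algebra_simps)
  have det: "det (matrix (\<Lambda> \<circ> R')) > 0" if R': "positive_on_face p R'" for R'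
  proof -
    have n: "Im (cnj (fst p) * (\<i> * fst p)) > 0"
    proof -
      have "Im (cnj (fst p) * (\<i> * fst p)) = (cmod (fst p))\<^sup>2"
        using Im_cnj_mult_i[of "fst p"] by (simp add: mult.commute)
      then show ?thesis using assms(1) by simp
    qed
    obtain f1 f2 f3 where f: "(f1, f2, f3) \<in> {(axis 1 1, axis 2 1, axis 3 1), (axis 2 1, axis 3 1, axis 1 1)}"
      and f1: "fst (R' f1) = \<i> * fst p" and f23: "fst (R' f2) = 0" "fst (R' f3) = 0"
      and im: "Im (cnj (transverse_coordinate p (R' f2)) * transverse_coordinate p (R' f3)) > 0"
      using R' by (rule positive_on_faceE)
    from f consider "f1 = axis 1 1" "f2 = axis 2 1" "f3 = axis 3 1" | "f1 = axis 2 1" "f2 = axis 3 1" "f3 = axis 1 1"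
      by auto
    then have "det (matrix (\<Lambda> \<circ> R')) = Im (cnj (fst p) * (\<i> * fst p)) *
       Im (cnj (transverse_coordinate p (R' f2)) * transverse_coordinate p (R' f3))"
    proof cases
      case 1
      show ?thesis using f1 f23 unfolding 1
        by (simp add: det_3 matrix_def \<Lambda>_def del: mult_cancel_left) (simp add: algebra_simps)
    next
      case 2
      show ?thesis using f1 f23 unfolding 2
        by (simp add: det_3 matrix_def \<Lambda>_def del: mult_cancel_left) (simp add: algebra_simps)
    qed
    then show ?thesis using n im by (metis mult_pos_pos)
  qed
  have "matrix (\<Lambda> \<circ> P') = matrix (\<Lambda> \<circ> Q') ** matrix \<tau>'"
    unfolding assms(5) o_assoc by (rule matrix_compose[OF lin(3) linear_compose[OF lin(2) \<Lambda>]])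
  then have "det (matrix (\<Lambda> \<circ> P')) = det (matrix (\<Lambda> \<circ> Q')) * det (matrix \<tau>')" by (simp add: det_mul)
  then show ?thesis using det[OF pos(1)] det[OF pos(2)] by (simp add: zero_less_mult_iff)
qed

lemma polar_has_derivative:
  "((\<lambda>v::real^3. of_real (a + b * v$i) * cis (v$j)) has_derivative
     (\<lambda>h. (of_real (b * h$i) + of_real (a + b * v$i) * \<i> * of_real (h$j)) * cis (v$j))) (at v)"
proof -
  have 1: "((\<lambda>v::real^3. complex_of_real (a + b * v$i)) has_derivative (\<lambda>h. of_real (b * h$i))) (at v)"
    by (auto intro!: derivative_eq_intros bounded_linear.has_derivative[OF bounded_linear_of_real]
        bounded_linear_imp_has_derivative bounded_linear_vec_nth)
  have 2: "((\<lambda>v::real^3. cis (v$j)) has_derivative (\<lambda>h. \<i> * cis (v$j) * of_real (h$j))) (at v)"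
    by (intro has_derivative_cis bounded_linear_imp_has_derivative bounded_linear_vec_nth)
  show ?thesis
    by (rule has_derivative_eq_rhs[OF has_derivative_mult[OF 1 2]]) (simp add: fun_eq_iff algebra_simps)
qed

lemma fst_cis_derivative:
  fixes P :: "real^3 \<Rightarrow> C3"
  assumes "(P has_derivative P') (at v)" "open T" "v \<in> T" "\<And>u. u \<in> T \<Longrightarrow> fst (P u) = of_real \<alpha> * cis (u$1)"
  shows "fst (P' (axis 1 1)) = \<i> * fst (P v)" "fst (P' (axis 2 1)) = 0" "fst (P' (axis 3 1)) = 0"
proof -
  have x: "fst (P u) = of_real (\<alpha> + 0 * u$1) * cis (u$1)" if "u \<in> T" for u using assms(4)[OF that] by simp
  have "fst (P' h) = (of_real (0 * h$1) + of_real (\<alpha> + 0 * v$1) * \<i> * of_real (h$1)) * cis (v$1)" for h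
    by (rule derivative_component[OF assms(1) bounded_linear_fst assms(2,3) x polar_has_derivative[of \<alpha> 0 1 1 v]])
  then show "fst (P' (axis 1 1)) = \<i> * fst (P v)" "fst (P' (axis 2 1)) = 0" "fst (P' (axis 3 1)) = 0"
    using assms(4)[OF assms(3)] by (auto simp: axis_def)
qed

lemma Complex_has_derivative:
  "((\<lambda>v::real^3. Complex (v$i) (v$j)) has_derivative (\<lambda>h. Complex (h$i) (h$j))) (at v)"
  unfolding Complex_eq
  by (intro derivative_intros bounded_linear.has_derivative[OF bounded_linear_of_real]
        bounded_linear_imp_has_derivative bounded_linear_vec_nth)

lemma Im_cnj_rotated: "Im (cnj (of_real r * \<i> * cis a) * (- cis a)) = r"
  "Im (cnj (cis a) * (of_real r * \<i> * cis a)) = r"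
proof -
  have c: "cnj (cis a) * cis a = 1" by (simp add: cis_cnj cis_mult)
  have e: "cnj (of_real r * \<i> * cis a) * (- cis a) = of_real r * \<i> * (cnj (cis a) * cis a)"
    "cnj (cis a) * (of_real r * \<i> * cis a) = of_real r * \<i> * (cnj (cis a) * cis a)"
    by (simp_all add: algebra_simps)
  show "Im (cnj (of_real r * \<i> * cis a) * (- cis a)) = r"
    "Im (cnj (cis a) * (of_real r * \<i> * cis a)) = r"
    unfolding e c by simp_all
qed

text \<open>
  For \<open>v $ 3 > 0\<close> the last two coordinates are polar coordinates of \<open>y\<close> with the radius \<open>\<alpha> - v $ 3\<close>,
  for \<open>v $ 3 < 0\<close> the third and the first are polar coordinates of \<open>x\<close> with the radius \<open>\<alpha> + v $ 3\<close>.
\<close>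

lemma corner_type_positive:
  assumes D: "open D" and P: "corner_type \<alpha> D P" and v: "v \<in> D" and dP: "(P has_derivative P') (at v)"
  shows "v$3 > 0 \<Longrightarrow> positive_on_face (P v) P'"
    and "v$3 < 0 \<Longrightarrow> positive_on_face (swap_xy (P v)) (swap_xy \<circ> P')"
proof -
  have z: "snd (snd (P v)) \<noteq> 0" using corner_typeD(3)[OF P v] .
  have v3: "\<bar>v$3\<bar> < \<alpha>" using corner_typeD(4)[OF P v] .
  have by': "bounded_linear (\<lambda>p::C3. fst (snd p))" 
    by (intro bounded_linear_compose[OF bounded_linear_fst bounded_linear_snd])
  {
    assume pos: "v$3 > 0"
    let ?T = "D \<inter> {v. v$3 > 0}"
    have T: "open ?T" "v \<in> ?T" using D v pos by (auto intro!: open_Int open_Collect_less continuous_intros)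
    have x: "fst (P u) = of_real \<alpha> * cis (u$1)" and y: "fst (snd (P u)) = of_real (\<alpha> + (-1) * u$3) * cis (u$2)"
      if "u \<in> ?T" for u using corner_typeD[OF P, of u] that by auto
    have "fst (snd (P' h)) = (of_real ((-1) * h$3) + of_real (\<alpha> + (-1) * v$3) * \<i> * of_real (h$2)) * cis (v$2)" for h
      by (rule derivative_component[OF dP by' T y polar_has_derivative])
    then have "fst (snd (P' (axis 2 1))) = of_real (\<alpha> - v$3) * \<i> * cis (v$2)" "fst (snd (P' (axis 3 1))) = - cis (v$2)"
      by (auto simp: axis_def)
    then have "Im (cnj (fst (snd (P' (axis 2 1)))) * fst (snd (P' (axis 3 1)))) = \<alpha> - v$3"
      using Im_cnj_rotated(1)[of "\<alpha> - v$3" "v$2"] by simp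
    then have "Im (cnj (fst (snd (P' (axis 2 1)))) * fst (snd (P' (axis 3 1)))) > 0" using v3 by linarith
    then show "positive_on_face (P v) P'"
      using fst_cis_derivative[OF dP T x] z v3 unfolding positive_on_face_def transverse_coordinate_def by simp
  next
    assume neg: "v$3 < 0"
    let ?T = "D \<inter> {v. v$3 < 0}"
    have T: "open ?T" "v \<in> ?T" using D v neg by (auto intro!: open_Int open_Collect_less continuous_intros)
    have y: "fst (snd (P u)) = of_real (\<alpha> + 0 * u$3) * cis (u$2)" and x: "fst (P u) = of_real (\<alpha> + 1 * u$3) * cis (u$1)"
      if "u \<in> ?T" for u using corner_typeD[OF P, of u] that by auto
    have "fst (P' h) = (of_real (1 * h$3) + of_real (\<alpha> + 1 * v$3) * \<i> * of_real (h$1)) * cis (v$1)" for h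
      by (rule derivative_component[OF dP bounded_linear_fst T x polar_has_derivative])
    then have x': "fst (P' (axis 1 1)) = of_real (\<alpha> + v$3) * \<i> * cis (v$1)" "fst (P' (axis 3 1)) = cis (v$1)"
      by (auto simp: axis_def)
    have "fst (snd (P' h)) = (of_real (0 * h$3) + of_real (\<alpha> + 0 * v$3) * \<i> * of_real (h$2)) * cis (v$2)" for h
      by (rule derivative_component[OF dP by' T y polar_has_derivative])
    then have y': "fst (snd (P' (axis 2 1))) = \<i> * fst (snd (P v))" "fst (snd (P' (axis 3 1))) = 0" "fst (snd (P' (axis 1 1))) = 0"
      using y[OF T(2)] by (auto simp: axis_def)
    have "Im (cnj (fst (P' (axis 3 1))) * fst (P' (axis 1 1))) = \<alpha> + v$3"
      unfolding x' by (rule Im_cnj_rotated(2))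
    then have "Im (cnj (fst (P' (axis 3 1))) * fst (P' (axis 1 1))) > 0" using v3 by linarith
    then show "positive_on_face (swap_xy (P v)) (swap_xy \<circ> P')"
      using y' z v3 unfolding positive_on_face_def transverse_coordinate_def by simp
  }
qed

lemma complex_positive_frame_swap_xy:
  assumes "complex_positive_frame (vector [a, b, c, d])"
  shows "complex_positive_frame (vector [swap_xy a, swap_xy b, swap_xy c, swap_xy d])"
proof -
  obtain x y and M :: "real^4^4" where M: "det M > 0"
    "\<And>j. (vector [a, b, c, d] :: C3^4) $ j = M$j$1 *\<^sub>R x + M$j$2 *\<^sub>R times_i x + M$j$3 *\<^sub>R y + M$j$4 *\<^sub>R times_i y"
    using assms unfolding complex_positive_frame_def by blast
  have sw: "swap_xy (r *\<^sub>R x + s *\<^sub>R times_i x + p *\<^sub>R y + q *\<^sub>R times_i y)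
     = r *\<^sub>R swap_xy x + s *\<^sub>R times_i (swap_xy x) + p *\<^sub>R swap_xy y + q *\<^sub>R times_i (swap_xy y)" for r s p q
    by (cases x; cases y) (auto simp: times_i_def)
  have "\<forall>j. (vector [swap_xy a, swap_xy b, swap_xy c, swap_xy d] :: C3^4) $ j
      = M$j$1 *\<^sub>R swap_xy x + M$j$2 *\<^sub>R times_i (swap_xy x) + M$j$3 *\<^sub>R swap_xy y + M$j$4 *\<^sub>R times_i (swap_xy y)"
    using M(2)[of 1] M(2)[of 2] M(2)[of 3] M(2)[of 4] by (simp add: forall_4 vector_4 sw)
  then show ?thesis using M(1) unfolding complex_positive_frame_def by blast
qed

context milnor begin

text \<open>
  A complex multiple of \<open>b\<close>, written as a real combination of \<open>b\<close> and \<open>ib\<close>.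
\<close>

lemma tangent_span:
  assumes p: "(x, y, z) \<in> L" and "dgerm m k l (x, y, z) u = 0" "fst u = 0"
    and that: "b = (if z \<noteq> 0 then (0, 1, of_nat l * x ^ k * y ^ (l - 1) / (of_nat m * z ^ (m - 1))) else (0, 0, 1))"
  shows "u = Re (transverse_coordinate (x, y, z) u) *\<^sub>R b + Im (transverse_coordinate (x, y, z) u) *\<^sub>R times_i b"
proof -
  obtain u2 u3 where u: "u = (0, u2, u3)" using assms(3) by (cases u) auto
  have d: "of_nat m * z ^ (m - 1) * u3 = x ^ k * (of_nat l * y ^ (l - 1) * u2)"
    using assms(2) by (simp add: u dgerm_def)
  show ?thesis
  proof (cases "z = 0")
    case True
    then have "x \<noteq> 0" "y \<noteq> 0" using not_both_zero(1)[OF p] by auto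
    then have "u2 = 0" using d m l True by (auto simp: power_0_left)
    then show ?thesis using True by (auto simp: u that transverse_coordinate_def times_i_def complex_eq_iff)
  next
    case False
    define c where "c = of_nat l * x ^ k * y ^ (l - 1) / (of_nat m * z ^ (m - 1))"
    have b: "b = (0, 1, c)" using False that by (simp add: c_def)
    have "u3 = u2 * c" using False d m by (simp add: c_def field_simps)
    moreover have "Re u2 *\<^sub>R a + Im u2 *\<^sub>R (\<i> * a) = u2 * a" for a
      by (simp add: complex_eq_iff)
    ultimately show ?thesis using False
      by (auto simp: u b transverse_coordinate_def times_i_def complex_eq_iff[of u2])
  qed
qed

text \<open>
  The tangent space of the Milnor fibre is complex and \<open>P' f1\<close> has \<open>x\<close>-component \<open>ix\<close>. Hence
  \<open>\<nu> = -i P' f1\<close> is tangent with \<open>x\<close>-component \<open>x\<close>, so it points out of the polydisc, and \<open>P' f1 = i\<nu>\<close>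
  completes it to a positive basis of a complex line. The other two vectors are an oriented basis of the
  complex line spanned by \<open>b\<close>.
\<close>

lemma positive_on_face_frame:
  assumes p: "p \<in> L" and x: "cmod (fst p) = \<alpha>" and y: "cmod (fst (snd p)) < \<alpha>"
    and ker: "\<And>h. dgerm m k l p (P' h) = 0" and pos: "positive_on_face p P'"
  shows "\<exists>\<nu>. outward (germ m k l) (polydisc \<alpha> \<epsilon>) p \<nu> \<and>
    complex_positive_frame (vector [\<nu>, P' (axis 1 1), P' (axis 2 1), P' (axis 3 1)])"
proof -
  obtain f1 f2 f3 where f: "(f1, f2, f3) \<in> {(axis 1 1, axis 2 1, axis 3 1), (axis 2 1, axis 3 1, axis 1 1)}"
    and f1: "fst (P' f1) = \<i> * fst p" and f23: "fst (P' f2) = 0" "fst (P' f3) = 0"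
    and im: "Im (cnj (transverse_coordinate p (P' f2)) * transverse_coordinate p (P' f3)) > 0"
    using pos by (rule positive_on_faceE)
  obtain x0 y0 z0 where pe: "p = (x0, y0, z0)" by (cases p)
  define \<nu> where "\<nu> = - times_i (P' f1)"
  have \<nu>1: "fst \<nu> = x0" using f1 by (cases "P' f1") (auto simp: \<nu>_def times_i_def pe)
  have i\<nu>: "times_i \<nu> = P' f1" by (cases "P' f1") (auto simp: \<nu>_def times_i_def)
  have "dgerm m k l p \<nu> = 0" unfolding \<nu>_def dgerm_minus dgerm_times_i using ker by simp
  then have d\<nu>: "frechet_derivative (germ m k l) (at p) \<nu> = 0"
    using frechet_derivative_eq[OF has_derivative_germ] by metis
  have z: "cmod z0 < \<epsilon>" using p x y z_less[of z0 x0 y0] by (auto simp: pe mem_L)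
  have "\<forall>\<^sub>F s in at_right 0. p - s *\<^sub>R \<nu> \<in> interior (polydisc \<alpha> \<epsilon>)"
  proof -
    have "((\<lambda>s. cmod (y0 - s *\<^sub>R fst (snd \<nu>))) \<longlongrightarrow> cmod (y0 - 0 *\<^sub>R fst (snd \<nu>))) (at_right 0)"
      "((\<lambda>s. cmod (z0 - s *\<^sub>R snd (snd \<nu>))) \<longlongrightarrow> cmod (z0 - 0 *\<^sub>R snd (snd \<nu>))) (at_right 0)"
      by (intro tendsto_intros)+
    then have "\<forall>\<^sub>F s in at_right 0. cmod (y0 - s *\<^sub>R fst (snd \<nu>)) < \<alpha>"
      "\<forall>\<^sub>F s in at_right 0. cmod (z0 - s *\<^sub>R snd (snd \<nu>)) < \<epsilon>"
      using order_tendstoD(2) y z by (fastforce simp: pe)+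
    moreover have "\<forall>\<^sub>F s in at_right (0::real). s \<in> {0<..<1}" by (rule eventually_at_right_real) simp
    ultimately show ?thesis
    proof eventually_elim
      case (elim s)
      have "cmod (x0 - s *\<^sub>R x0) = \<bar>1 - s\<bar> * \<alpha>"
        using x by (metis fst_conv norm_scaleR pe scaleR_left_diff_distrib scaleR_one)
      then have "cmod (x0 - s *\<^sub>R x0) < \<alpha>" using elim \<alpha> by simp
      then show ?case using elim \<nu>1 by (cases \<nu>) (auto simp: interior_polydisc pe)
    qed
  qed
  with d\<nu> have out: "outward (germ m k l) (polydisc \<alpha> \<epsilon>) p \<nu>" unfolding outward_def by blast
  define b where "b = (if z0 \<noteq> 0 then (0, 1, of_nat l * x0 ^ k * y0 ^ (l - 1) / (of_nat m * z0 ^ (m - 1))) else (0, 0, 1) :: C3)"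
  define \<beta> where "\<beta> = transverse_coordinate p (P' f2)"
  define \<gamma> where "\<gamma> = transverse_coordinate p (P' f3)"
  have f2: "P' f2 = Re \<beta> *\<^sub>R b + Im \<beta> *\<^sub>R times_i b" and f3: "P' f3 = Re \<gamma> *\<^sub>R b + Im \<gamma> *\<^sub>R times_i b"
    using tangent_span[OF p[unfolded pe] _ _ b_def] ker f23 unfolding \<beta>_def \<gamma>_def pe by auto
  have bg: "Re \<beta> * Im \<gamma> - Im \<beta> * Re \<gamma> > 0" using im unfolding \<beta>_def[symmetric] \<gamma>_def[symmetric] by simp
  from f consider "f1 = axis 1 1" "f2 = axis 2 1" "f3 = axis 3 1" | "f1 = axis 2 1" "f2 = axis 3 1" "f3 = axis 1 1"
    by auto
  then have "complex_positive_frame (vector [\<nu>, P' (axis 1 1), P' (axis 2 1), P' (axis 3 1)])"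
  proof cases
    case 1
    show ?thesis
      unfolding complex_positive_frame_def
      by (rule exI[of _ \<nu>], rule exI[of _ b], rule exI[of _ "vector [vector [1, 0, 0, 0], vector [0, 1, 0, 0], vector [0, 0, Re \<beta>, Im \<beta>], vector [0, 0, Re \<gamma>, Im \<gamma>]]"])
        (use bg f2 f3 i\<nu> 1 in \<open>simp add: det_block forall_4 vector_4\<close>)
  next
    case 2
    show ?thesis
      unfolding complex_positive_frame_def
      by (rule exI[of _ \<nu>], rule exI[of _ b], rule exI[of _ "vector [vector [1, 0, 0, 0], vector [0, 0, Re \<gamma>, Im \<gamma>], vector [0, 1, 0, 0], vector [0, 0, Re \<beta>, Im \<beta>]]"])
        (use bg f2 f3 i\<nu> 2 in \<open>simp add: det_block forall_4 vector_4\<close>)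
  qed
  with out show ?thesis by blast
qed

lemma derivative_in_kernel:
  assumes D: "open D" "P ` D \<subseteq> L" "v \<in> D" and dP: "(P has_derivative P') (at v)"
  shows "dgerm m k l (P v) (P' h) = 0"
proof -
  have "((\<lambda>u. germ m k l (P u)) has_derivative (\<lambda>h. dgerm m k l (P v) (P' h))) (at v)"
    by (rule has_derivative_compose[OF dP has_derivative_germ])
  moreover have "((\<lambda>u. germ m k l (P u)) has_derivative (\<lambda>h. 0)) (at v)"
    by (rule has_derivative_transform_within_open[OF has_derivative_const[of t] D(1,3)])
      (use D(2) in \<open>auto simp: milnor_boundary_def milnor_fibre_def\<close>)
  ultimately show ?thesis using has_derivative_unique by metis
qed

text \<open>
  For \<open>slice_type\<close> at \<open>z \<noteq> 0\<close>, \<open>dy\<close> is a non-zero complex multiple \<open>q dz\<close> along \<open>dx = 0\<close>, and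
  multiplication by \<open>q\<close> preserves orientation.
\<close>

lemma edge_type_positive:
  assumes D: "open D" "P ` D \<subseteq> L" and P: "edge_type \<alpha> D P" and v: "v \<in> D" and dP: "(P has_derivative P') (at v)"
  shows "positive_on_face (P v) P'"
proof -
  have by': "bounded_linear (\<lambda>p::C3. fst (snd p))" and bz: "bounded_linear (\<lambda>p::C3. snd (snd p))"
    by (intro bounded_linear_compose[OF bounded_linear_fst bounded_linear_snd]
       bounded_linear_compose[OF bounded_linear_snd bounded_linear_snd])+
  note x' = fst_cis_derivative[OF dP D(1) v edge_typeD(1)[OF P]]
  obtain x y z where Pv: "P v = (x, y, z)" by (cases "P v")
  from P consider "slice_type \<alpha> D P" | "disc_type \<alpha> D P" unfolding edge_type_def by blast
  then show ?thesis
  proof cases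
    case 1
    have dz: "snd (snd (P' h)) = Complex (h$2) (h$3)" for h
      by (rule derivative_component[OF dP bz D(1) v slice_typeD(2)[OF 1] Complex_has_derivative])
    have z': "snd (snd (P' (axis 2 1))) = 1" "snd (snd (P' (axis 3 1))) = \<i>"
      by (auto simp: dz axis_def complex_eq_iff)
    show ?thesis
    proof (cases "z = 0")
      case True
      then show ?thesis using x' z' unfolding positive_on_face_def transverse_coordinate_def by (simp add: Pv)
    next
      case False
      define c where "c = x ^ k * (of_nat l * y ^ (l - 1))"
      have xy: "x \<noteq> 0" "y \<noteq> 0" using slice_typeD[OF 1 v] \<alpha> by (auto simp: Pv)
      have c: "c \<noteq> 0" using xy l by (simp add: c_def)
      define q where "q = of_nat m * z ^ (m - 1) / c"
      have q: "q \<noteq> 0" using False c m by (simp add: q_def)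
      have "fst (snd (P' h)) = q * snd (snd (P' h))" if "fst (P' h) = 0" for h
      proof -
        have "of_nat m * z ^ (m - 1) * snd (snd (P' h)) = c * fst (snd (P' h))"
          using derivative_in_kernel[OF D v dP, of h] that
          by (cases "P' h") (auto simp: Pv dgerm_def c_def)
        then show ?thesis using c by (simp add: q_def field_simps)
      qed
      then have "fst (snd (P' (axis 2 1))) = q" "fst (snd (P' (axis 3 1))) = q * \<i>" using x' z' by auto
      moreover have "Im (cnj q * (q * \<i>)) > 0"
      proof -
        have "Im (cnj q * (q * \<i>)) = (cmod q)\<^sup>2" by (rule Im_cnj_mult_i)
        then show ?thesis using q by simp
      qed
      ultimately show ?thesis using x' False
        unfolding positive_on_face_def transverse_coordinate_def by (simp add: Pv)
    qed
  next
    case 2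
    have dy: "fst (snd (P' h)) = Complex (h$2) (h$3)" for h
      by (rule derivative_component[OF dP by' D(1) v disc_typeD(2)[OF 2] Complex_has_derivative])
    have "fst (snd (P' (axis 2 1))) = 1" "fst (snd (P' (axis 3 1))) = \<i>"
      by (auto simp: dy axis_def complex_eq_iff)
    then show ?thesis
      using x' disc_typeD(3)[OF 2 v] unfolding positive_on_face_def transverse_coordinate_def by simp
  qed
qed

end

section \<open>The atlas\<close>

lemma inv_inv_into:
  assumes "inj_on P D" "v \<in> D"
  shows "inv_into (P ` D) (inv_into D P) v = P v"
  by (rule inv_into_f_eq) (use assms in \<open>auto simp: inj_on_inv_into\<close>)

context milnor begin

lemma admissible_has_derivative:
  assumes "admissible L \<alpha> D P" "v \<in> D" "P v \<notin> corner \<alpha>"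
  shows "(P has_derivative frechet_derivative P (at v)) (at v)"
  using Ck_on_SucD[OF admissible_Ck_on[OF assms(1)]] assms(2,3) by blast

lemma admissible_kernel:
  assumes "admissible L \<alpha> D P" "v \<in> D" "P v \<notin> corner \<alpha>"
  shows "dgerm m k l (P v) (frechet_derivative P (at v) h) = 0"
  using assms derivative_in_kernel[OF _ _ _ admissible_has_derivative[OF assms]]
  by (auto simp: admissible_def)

lemma admissible_positive:
  assumes adm: "admissible L \<alpha> D P" and v: "v \<in> D" "P v \<notin> corner \<alpha>"
  shows "cmod (fst (snd (P v))) < \<alpha> \<Longrightarrow> positive_on_face (P v) (frechet_derivative P (at v))"
    and "cmod (fst (P v)) < \<alpha> \<Longrightarrow> positive_on_face (swap_xy (P v)) (swap_xy \<circ> frechet_derivative P (at v))"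
proof -
  interpret s: milnor m l k \<alpha> \<epsilon> t by (rule swapped)
  let ?P' = "frechet_derivative P (at v)"
  have D: "open D" "P ` D \<subseteq> L" using adm by (auto simp: admissible_def)
  note dP = admissible_has_derivative[OF adm v]
  have "(cmod (fst (snd (P v))) < \<alpha> \<longrightarrow> positive_on_face (P v) ?P') \<and>
     (cmod (fst (P v)) < \<alpha> \<longrightarrow> positive_on_face (swap_xy (P v)) (swap_xy \<circ> ?P'))"
    using adm
  proof (cases rule: admissible_cases)
    case corner
    then show ?thesis
      using corner_type_positive[OF D(1) corner v(1) dP] corner_type_mem_corner[OF corner v(1)] by auto
  next
    case edge
    then show ?thesis
      using edge_type_positive[OF D edge v(1) dP] edge_typeD(1)[OF edge v(1)] \<alpha> by (simp add: norm_mult)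
  next
    case swapped_edge
    have "((swap_xy \<circ> P) has_derivative (swap_xy \<circ> ?P')) (at v)"
      using bounded_linear.has_derivative[OF bounded_linear_swap_xy dP] by (simp add: o_def)
    then show ?thesis
      using s.edge_type_positive[OF admissible_swap_xy(1,3)[OF adm swapped_edge] swapped_edge v(1)]
        edge_typeD(1)[OF swapped_edge v(1)] \<alpha> by (simp add: norm_mult)
  qed
  then show "cmod (fst (snd (P v))) < \<alpha> \<Longrightarrow> positive_on_face (P v) ?P'"
    and "cmod (fst (P v)) < \<alpha> \<Longrightarrow> positive_on_face (swap_xy (P v)) (swap_xy \<circ> ?P')" by auto
qed

lemma L_cases:
  assumes "p \<in> L" "p \<notin> corner \<alpha>"
  obtains "cmod (fst p) = \<alpha>" "cmod (fst (snd p)) < \<alpha>" | "cmod (fst (snd p)) = \<alpha>" "cmod (fst p) < \<alpha>"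
  using assms by (cases p) (auto simp: mem_L mem_corner max_def split: if_splits)

lemma edge_target_Ck_on:
  assumes D': "open D'" "continuous_on D' \<tau>" "\<tau> ` D' \<subseteq> D" "\<And>v. v \<in> D' \<Longrightarrow> P (\<tau> v) = Q v"
    and P: "edge_type \<alpha> D P" and Q: "Ck_on n D' Q"
  shows "Ck_on n D' \<tau>"
proof -
  have \<tau>: "\<tau> v \<in> D" if "v \<in> D'" for v using D'(3) that by auto
  have 1: "Ck_on n D' (\<lambda>v. \<tau> v $ 1)"
  proof (rule Ck_on_angle[OF D'(1)])
    show "Ck_on n D' (\<lambda>v. fst (Q v) * inverse (of_real \<alpha>))" by (intro Ck_on_intros D' Q)
    show "cis (\<tau> v $ 1) = fst (Q v) * inverse (of_real \<alpha>)" if "v \<in> D'" for v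
      using edge_typeD(1)[OF P \<tau>[OF that]] D'(4)[OF that] \<alpha> by simp
  qed (use D' in \<open>auto intro!: continuous_intros\<close>)
  have 23: "Ck_on n D' \<tau>" if "Ck_on n D' w" "\<And>v. v \<in> D' \<Longrightarrow> w v = Complex (\<tau> v $ 2) (\<tau> v $ 3)" for w
  proof (rule Ck_on_vec3[OF D'(1) 1])
    show "Ck_on n D' (\<lambda>v. \<tau> v $ 2)"
      by (rule Ck_on_cong[OF D'(1) _ Ck_on_Re[OF D'(1) that(1)]]) (simp add: that(2))
    show "Ck_on n D' (\<lambda>v. \<tau> v $ 3)"
      by (rule Ck_on_cong[OF D'(1) _ Ck_on_Im[OF D'(1) that(1)]]) (simp add: that(2))
  qed
  from P consider "slice_type \<alpha> D P" | "disc_type \<alpha> D P" unfolding edge_type_def by blast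
  then show ?thesis
  proof cases
    case 1
    show ?thesis
      by (rule 23[of "\<lambda>v. snd (snd (Q v))"]) (use slice_typeD(2)[OF 1 \<tau>] D' Q in \<open>auto intro: Ck_on_intros\<close>)
  next
    case 2
    show ?thesis
      by (rule 23[of "\<lambda>v. fst (snd (Q v))"]) (use disc_typeD(2)[OF 2 \<tau>] D' Q in \<open>auto intro: Ck_on_intros\<close>)
  qed
qed

text \<open>
  Off the corner \<open>Q\<close> is smooth, and the coordinates of a target of edge type are the angle of one
  component of \<open>Q\<close> and another component. The coordinates of a target of corner type are read off from
  \<open>straightening \<circ> Q\<close>, which is smooth off the axes. So the kind of \<open>Q\<close> does not enter.
\<close>

lemma transition_Ck_on:
  assumes D': "open D'" "continuous_on D' \<tau>" "\<tau> ` D' \<subseteq> D" "\<And>v. v \<in> D' \<Longrightarrow> P (\<tau> v) = Q v" "D' \<subseteq> E"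
    and P: "admissible L \<alpha> D P" and Q: "admissible L \<alpha> E Q"
  shows "Ck_on n D' \<tau>"
proof -
  have \<tau>: "\<tau> v \<in> D" if "v \<in> D'" for v using D'(3) that by auto
  have edge: "Ck_on n D' Q" if "edge_type \<alpha> D P \<or> edge_type \<alpha> D (swap_xy \<circ> P)"
    by (rule Ck_on_subset[OF admissible_Ck_on[OF Q]]) (use edge_not_corner[OF that \<tau>] D' in force)
  show ?thesis using P
  proof (cases rule: admissible_cases)
    case corner
    have S: "straightening (Q v) = (cis (\<tau> v $ 1), cis (\<tau> v $ 2), \<tau> v $ 3)" if "v \<in> D'" for v
      using straightening_corner_type[OF corner \<tau>[OF that]] D'(4)[OF that] by simp
    have "fst (Q v) \<noteq> 0 \<and> fst (snd (Q v)) \<noteq> 0" if "v \<in> D'" for v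
      using S[OF that] cis_neq_zero by (cases "Q v") (force simp: straightening_def)
    then have SQ: "Ck_on n D' (straightening \<circ> Q)"
      using D'(5) by (intro Ck_on_subset[OF straightening_Ck_on[OF Q]]) auto
    show ?thesis
    proof (rule Ck_on_vec3[OF D'(1)])
      show "Ck_on n D' (\<lambda>v. \<tau> v $ 1)"
        by (rule Ck_on_angle[OF D'(1) _ _ Ck_on_fst[OF D'(1) SQ]])
          (use S D' in \<open>auto intro!: continuous_intros\<close>)
      show "Ck_on n D' (\<lambda>v. \<tau> v $ 2)"
        by (rule Ck_on_angle[OF D'(1) _ _ Ck_on_fst[OF D'(1) Ck_on_snd[OF D'(1) SQ]]])
          (use S D' in \<open>auto intro!: continuous_intros\<close>)
      show "Ck_on n D' (\<lambda>v. \<tau> v $ 3)"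
        by (rule Ck_on_cong[OF D'(1) _ Ck_on_snd[OF D'(1) Ck_on_snd[OF D'(1) SQ]]]) (use S in auto)
    qed
  next
    case edge': edge
    then show ?thesis using edge by (intro edge_target_Ck_on[where P = P and Q = Q, OF D'(1-4)]) auto
  next
    case swapped_edge
    then have "Ck_on n D' (swap_xy \<circ> Q)"
      using Ck_on_linear_comp[OF bounded_linear_swap_xy D'(1)] edge by (simp add: o_def)
    then show ?thesis
      using swapped_edge D'(4) by (intro edge_target_Ck_on[OF D'(1-3), of "swap_xy \<circ> P" "swap_xy \<circ> Q"]) auto
  qed
qed

text \<open>
  Over the corner \<open>P\<close> and \<open>Q\<close> are both of corner type, so \<open>\<tau>\<close> changes angles by locally constant
  multiples of \<open>2\<pi>\<close> and its derivative is the identity. Any other point lies on exactly one face, and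
  \<open>positive_on_face_det\<close> applies on that face.
\<close>

lemma transition_jacobian_pos:
  assumes D': "open D'" "continuous_on D' \<tau>" "\<tau> ` D' \<subseteq> D" "\<And>v. v \<in> D' \<Longrightarrow> P (\<tau> v) = Q v" "D' \<subseteq> E"
    and P: "admissible L \<alpha> D P" and Q: "admissible L \<alpha> E Q" and v: "v \<in> D'"
  shows "jacobian \<tau> v > 0"
proof -
  have \<tau>: "\<tau> v \<in> D" if "v \<in> D'" for v using D'(3) that by auto
  have vE: "v \<in> E" using v D'(5) by auto
  define \<tau>' where "\<tau>' = frechet_derivative \<tau> (at v)"
  have d\<tau>: "(\<tau> has_derivative \<tau>') (at v)"
    unfolding \<tau>'_def using Ck_on_SucD[OF transition_Ck_on[OF D' P Q]] v by blast
  have lin: "linear \<tau>'" using d\<tau> by (rule has_derivative_linear)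
  show ?thesis
  proof (cases "Q v \<in> corner \<alpha>")
    case True
    then have c: "corner_type \<alpha> D P" "corner_type \<alpha> E Q"
      using P Q edge_not_corner[of \<alpha> D P "\<tau> v"] edge_not_corner[of \<alpha> E Q v] \<tau>[OF v] vE D'(4)[OF v]
      by (auto simp: admissible_def)
    have S: "cis (\<tau> u $ 1) = cis (u $ 1) \<and> cis (\<tau> u $ 2) = cis (u $ 2) \<and> \<tau> u $ 3 = u $ 3" if "u \<in> D'" for u
      using straightening_corner_type[OF c(1) \<tau>[OF that]] straightening_corner_type[OF c(2), of u] D'(4)[OF that]
        that D'(5) by auto
    have d: "((\<lambda>u. \<tau> u $ i) has_derivative (\<lambda>h. \<tau>' h $ i)) (at v)" for i
      by (rule bounded_linear.has_derivative[OF bounded_linear_vec_nth d\<tau>])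
    have i12: "\<tau>' h $ i = h $ i" if "i = 1 \<or> i = 2" for i h
    proof -
      have "((\<lambda>u::real^3. cis (u $ i)) has_derivative (\<lambda>h. \<i> * cis (v $ i) * of_real (h $ i))) (at v)"
        by (intro has_derivative_cis bounded_linear_imp_has_derivative bounded_linear_vec_nth)
      then have "((\<lambda>u. \<tau> u $ i) has_derivative (\<lambda>h. Im (\<i> * cis (v $ i) * of_real (h $ i) / cis (v $ i)))) (at v)"
        by (intro angle_has_derivative[OF D'(1) v]) (use that S D' in \<open>auto intro!: continuous_intros\<close>)
      from has_derivative_unique[OF d this] have "\<tau>' h $ i = Im (\<i> * cis (v $ i) * of_real (h $ i) / cis (v $ i))"
        by metis
      then show ?thesis by simp
    qed
    have "((\<lambda>u. \<tau> u $ 3) has_derivative (\<lambda>h. h $ 3)) (at v)"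
      by (rule has_derivative_transform_within_open[OF bounded_linear_imp_has_derivative[OF bounded_linear_vec_nth] D'(1) v])
        (use S in auto)
    from has_derivative_unique[OF d this] have "\<tau>' h $ 3 = h $ 3" for h by metis
    then have "\<tau>' h = h" for h using i12 by (simp add: vec_eq_iff forall_3)
    then have "\<tau>' = id" by auto
    then show ?thesis by (simp add: jacobian_def \<tau>'_def matrix_id_mat_1)
  next
    case False
    let ?P' = "frechet_derivative P (at (\<tau> v))" and ?Q' = "frechet_derivative Q (at v)"
    have eq: "P (\<tau> v) = Q v" by (rule D'(4)[OF v])
    then have F': "P (\<tau> v) \<notin> corner \<alpha>" using False by simp
    note dP = admissible_has_derivative[OF P \<tau>[OF v] F'] and dQ = admissible_has_derivative[OF Q vE False]
    have "((\<lambda>u. P (\<tau> u)) has_derivative (\<lambda>h. ?P' (\<tau>' h))) (at v)"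
      by (rule has_derivative_compose[OF d\<tau> dP])
    then have "(Q has_derivative (\<lambda>h. ?P' (\<tau>' h))) (at v)"
      by (rule has_derivative_transform_within_open[OF _ D'(1) v]) (rule D'(4))
    then have Q': "?Q' = ?P' \<circ> \<tau>'" unfolding comp_def by (rule frechet_derivative_eq)
    have linP: "linear ?P'" and linQ: "linear ?Q'" using dP dQ has_derivative_linear by auto
    have lsw: "linear swap_xy" using bounded_linear_swap_xy bounded_linear.linear by blast
    have "Q v \<in> L" using Q vE by (auto simp: admissible_def)
    then have "det (matrix \<tau>') > 0"
      using False
    proof (cases rule: L_cases)
      case 1
      show ?thesis
        by (rule positive_on_face_det[OF _ linQ linP lin Q'])
          (use 1 \<alpha> admissible_positive(1)[OF P \<tau>[OF v] F'] admissible_positive(1)[OF Q vE False] eq in auto)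
    next
      case 2
      have Q2: "swap_xy \<circ> ?Q' = (swap_xy \<circ> ?P') \<circ> \<tau>'" using Q' by (simp add: o_assoc)
      show ?thesis
        by (rule positive_on_face_det[OF _ linear_compose[OF linQ lsw] linear_compose[OF linP lsw] lin Q2])
          (use 2 \<alpha> admissible_positive(2)[OF P \<tau>[OF v] F'] admissible_positive(2)[OF Q vE False] eq in auto)
    qed
    then show ?thesis by (simp add: jacobian_def \<tau>'_def)
  qed
qed

definition atlas :: "(C3, 3) chart set" where
  "atlas = {(P ` D, inv_into D P) | D P. admissible L \<alpha> D P \<and> inj_on P D}"

lemma admissible_homeomorphic:
  assumes P: "admissible L \<alpha> D P" "inj_on P D"
  shows "homeomorphic_map (subtopology (top_of_set L) (P ` D)) (top_of_set D) (inv_into D P)"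
proof -
  have PL: "P ` D \<subseteq> L" "continuous_on D P" "open D" using P by (auto simp: admissible_def)
  have sub: "subtopology (top_of_set L) (P ` D) = top_of_set (P ` D)"
    using PL(1) by (simp add: subtopology_subtopology Int_absorb1)
  have "homeomorphic_map (top_of_set D) (top_of_set (P ` D)) P"
  proof (rule bijective_open_imp_homeomorphic_map)
    show "open_map (top_of_set D) (top_of_set (P ` D)) P"
      unfolding open_map_def
    proof (intro allI impI)
      fix U assume "openin (top_of_set D) U"
      then have U: "open U" "U \<subseteq> D" using PL(3) by (auto simp: openin_open_eq)
      then show "openin (top_of_set (P ` D)) (P ` U)"
        using admissible_open_map[OF P(1) U] PL(1) by (auto intro: openin_subset_trans)
    qed
  qed (use P PL in auto)
  then have "homeomorphic_map (top_of_set (P ` D)) (top_of_set D) (inv_into D P)"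
  proof -
    assume h: "homeomorphic_map (top_of_set D) (top_of_set (P ` D)) P"
    then obtain g where g: "homeomorphic_maps (top_of_set D) (top_of_set (P ` D)) P g"
      using homeomorphic_map_maps by blast
    then have "homeomorphic_map (top_of_set (P ` D)) (top_of_set D) g" and "\<forall>x\<in>D. g (P x) = x"
      unfolding homeomorphic_maps_map by auto
    then show ?thesis
      by (elim homeomorphic_map_eq) (use P in auto)
  qed
  then show ?thesis by (simp add: sub)
qed

lemma admissible_is_chart:
  assumes P: "admissible L \<alpha> D P" "inj_on P D"
  shows "is_chart (top_of_set L) (P ` D) (inv_into D P)"
  unfolding is_chart_def
  using admissible_homeomorphic[OF P] admissible_open_map[OF P(1) _ order_refl] P
  by (auto simp: admissible_def)

lemma transition:
  assumes P: "admissible L \<alpha> D P" "inj_on P D" and Q: "admissible L \<alpha> E Q"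
  defines "D' \<equiv> {v \<in> E. Q v \<in> P ` D}" and "\<tau> \<equiv> inv_into D P \<circ> Q"
  shows "open D'" "continuous_on D' \<tau>" "\<tau> ` D' \<subseteq> D" "\<And>v. v \<in> D' \<Longrightarrow> P (\<tau> v) = Q v" "D' \<subseteq> E"
proof -
  have QE: "open E" "continuous_on E Q" "Q ` E \<subseteq> L" using Q by (auto simp: admissible_def)
  have o: "openin (top_of_set L) (P ` D)"
    using admissible_open_map[OF P(1) _ order_refl] P(1) by (auto simp: admissible_def)
  have "openin (top_of_set E) (E \<inter> Q -` (P ` D))"
    by (rule continuous_openin_preimage[OF QE(2) _ o]) (use QE(3) in auto)
  moreover have "E \<inter> Q -` (P ` D) = D'" by (auto simp: D'_def)
  ultimately show "open D'" using QE(1) by (metis openin_open_eq)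
  show "continuous_on D' \<tau>"
  proof -
    have PL: "P ` D \<subseteq> L" using P(1) by (auto simp: admissible_def)
    have "continuous_map (subtopology (top_of_set L) (P ` D)) (top_of_set D) (inv_into D P)"
      using admissible_homeomorphic[OF P] homeomorphic_imp_continuous_map by blast
    then have "continuous_on (P ` D) (inv_into D P)"
      using PL by (simp add: subtopology_subtopology Int_absorb1)
    then show ?thesis unfolding \<tau>_def
      by (intro continuous_on_compose continuous_on_subset[OF QE(2)])
        (auto simp: D'_def intro: continuous_on_subset)
  qed
  show "\<tau> ` D' \<subseteq> D" "D' \<subseteq> E" by (auto simp: \<tau>_def D'_def inv_into_into)
  show "P (\<tau> v) = Q v" if "v \<in> D'" for v
    using that by (auto simp: \<tau>_def D'_def f_inv_into_f)
qed

lemma transition_smooth: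
  assumes P: "admissible L \<alpha> D P" "inj_on P D" and Q: "admissible L \<alpha> E Q"
  shows "smooth_on {v \<in> E. Q v \<in> P ` D} (inv_into D P \<circ> Q)"
    and "v \<in> E \<Longrightarrow> Q v \<in> P ` D \<Longrightarrow> jacobian (inv_into D P \<circ> Q) v > 0"
  using transition_Ck_on[OF transition[OF assms] P(1) Q] transition_jacobian_pos[OF transition[OF assms] P(1) Q]
  by (auto simp: smooth_on_def comp_def)

lemma atlas_oriented:
  assumes cover: "\<And>p. p \<in> L \<Longrightarrow> \<exists>D P v. admissible L \<alpha> D P \<and> v \<in> D \<and> P v = p"
  shows "oriented_smooth_atlas (top_of_set L) atlas"
proof -
  have Un: "\<Union>(fst ` atlas) = L"
  proof (intro equalityI subsetI)
    fix p assume "p \<in> L"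
    then obtain D P v where P: "admissible L \<alpha> D P" "v \<in> D" "P v = p" using cover by blast
    \<comment> \<open>Points at distance less than \<open>1 < 2\<pi>\<close> with equal angles coincide.\<close>
    let ?D = "D \<inter> ball v (1/2)"
    have adm: "admissible L \<alpha> ?D P"
      by (rule admissible_subset[OF P(1)]) (use P(1) in \<open>auto simp: admissible_def\<close>)
    have "inj_on P ?D"
    proof (rule inj_onI)
      fix u w assume "u \<in> ?D" "w \<in> ?D" "P u = P w"
      moreover from this have "dist u w < 1"
        using dist_triangle_half_l[of u v 1 w] by (auto simp: dist_commute)
      ultimately show "u = w" using admissible_locally_inj[OF P(1)] by blast
    qed
    then have "(P ` ?D, inv_into ?D P) \<in> atlas" using adm unfolding atlas_def by blast
    moreover have "p \<in> P ` ?D" using P by auto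
    ultimately show "p \<in> \<Union>(fst ` atlas)" by force
  qed (auto simp: atlas_def admissible_def)
  have T: "smooth_on (inv_into D P ` (P ` D \<inter> Q ` E)) (inv_into E Q \<circ> inv_into (P ` D) (inv_into D P)) \<and>
      (\<forall>p\<in>inv_into D P ` (P ` D \<inter> Q ` E). jacobian (inv_into E Q \<circ> inv_into (P ` D) (inv_into D P)) p > 0)"
    if P: "admissible L \<alpha> D P" "inj_on P D" and Q: "admissible L \<alpha> E Q" "inj_on Q E" for D P E Q
  proof -
    let ?D = "{v \<in> D. P v \<in> Q ` E}"
    have D: "inv_into D P ` (P ` D \<inter> Q ` E) = ?D"
    proof (intro equalityI subsetI)
      fix v assume "v \<in> ?D"
      then show "v \<in> inv_into D P ` (P ` D \<inter> Q ` E)"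
        using P(2) by (intro image_eqI[of _ _ "P v"]) auto
    next
      fix v assume "v \<in> inv_into D P ` (P ` D \<inter> Q ` E)"
      then obtain p where "p \<in> P ` D" "p \<in> Q ` E" "v = inv_into D P p" by blast
      then show "v \<in> ?D" using f_inv_into_f[of p P D] inv_into_into[of p P D] by simp
    qed
    have eq: "(inv_into E Q \<circ> P) v = (inv_into E Q \<circ> inv_into (P ` D) (inv_into D P)) v" if "v \<in> ?D" for v
      using inv_inv_into[OF P(2), of v] that by simp
    note sm = transition_smooth[OF Q P(1)] and o = transition(1)[OF Q P(1)]
    have Ck: "Ck_on n ?D (inv_into E Q \<circ> inv_into (P ` D) (inv_into D P))" for n
      by (rule Ck_on_cong[OF o _ sm(1)[unfolded smooth_on_def, rule_format]]) (rule eq)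
    moreover have "jacobian (inv_into E Q \<circ> inv_into (P ` D) (inv_into D P)) v > 0" if v: "v \<in> ?D" for v
    proof -
      have "Ck_on (Suc 0) ?D (inv_into E Q \<circ> P)" using sm(1) unfolding smooth_on_def by blast
      then have "(inv_into E Q \<circ> P) differentiable (at v)" using v by auto
      from jacobian_cong[OF o v eq this] show ?thesis using sm(2)[of v] v by (simp add: comp_def)
    qed
    ultimately show ?thesis unfolding D smooth_on_def by blast
  qed
  have "smooth_on (\<phi> ` (U \<inter> V)) (\<psi> \<circ> inv_into U \<phi>) \<and> (\<forall>p\<in>\<phi> ` (U \<inter> V). jacobian (\<psi> \<circ> inv_into U \<phi>) p > 0)"
    if charts: "(U, \<phi>) \<in> atlas" "(V, \<psi>) \<in> atlas" for U \<phi> V \<psi>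
  proof -
    obtain D P E Q where "U = P ` D" "\<phi> = inv_into D P" "admissible L \<alpha> D P" "inj_on P D"
      and "V = Q ` E" "\<psi> = inv_into E Q" "admissible L \<alpha> E Q" "inj_on Q E"
      using charts by (auto simp: atlas_def)
    then show ?thesis using T[of D P E Q] by simp
  qed
  moreover have "is_chart (top_of_set L) U \<phi>" if "(U, \<phi>) \<in> atlas" for U \<phi>
    using that by (auto simp: atlas_def admissible_is_chart)
  ultimately show ?thesis
    unfolding oriented_smooth_atlas_def using Un by auto
qed

lemma outward_swap_xy:
  assumes "outward (germ m l k) (polydisc \<alpha> \<epsilon>) (swap_xy p) \<nu>"
  shows "outward (germ m k l) (polydisc \<alpha> \<epsilon>) p (swap_xy \<nu>)"
proof -
  have 1: "dgerm m k l p (swap_xy \<nu>) = dgerm m l k (swap_xy p) \<nu>" 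
    using dgerm_swap_xy[of m l k p "swap_xy \<nu>"] by simp
  have 2: "p - s *\<^sub>R swap_xy \<nu> \<in> interior (polydisc \<alpha> \<epsilon>) \<longleftrightarrow> swap_xy p - s *\<^sub>R \<nu> \<in> interior (polydisc \<alpha> \<epsilon>)" for s
    by (cases p; cases \<nu>) (auto simp: interior_polydisc)
  show ?thesis
    using assms unfolding outward_def 2 frechet_derivative_eq[OF has_derivative_germ] 1 .
qed

lemma admissible_frame:
  assumes P: "admissible L \<alpha> D P" "v \<in> D" "P v \<notin> corner \<alpha>"
  defines "P' \<equiv> frechet_derivative P (at v)"
  shows "inj P' \<and> (\<exists>\<nu>. outward (germ m k l) (polydisc \<alpha> \<epsilon>) (P v) \<nu> \<and>
    complex_positive_frame (vector [\<nu>, P' (axis 1 1), P' (axis 2 1), P' (axis 3 1)]))"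
proof -
  have lin: "linear P'" using admissible_has_derivative[OF P] has_derivative_linear by (auto simp: P'_def)
  have PL: "P v \<in> L" using P by (auto simp: admissible_def)
  have ker: "dgerm m k l (P v) (P' h) = 0" for h using admissible_kernel[OF P] by (simp add: P'_def)
  show ?thesis
    using PL P(3)
  proof (cases rule: L_cases)
    case 1
    have pos: "positive_on_face (P v) P'" using admissible_positive(1)[OF P 1(2)] by (simp add: P'_def)
    have "fst (P v) \<noteq> 0" using 1 \<alpha> by auto
    then show ?thesis
      using positive_on_face_inj[OF lin pos] positive_on_face_frame[OF PL 1 ker pos] by blast
  next
    case 2
    interpret s: milnor m l k \<alpha> \<epsilon> t by (rule swapped)
    have pos: "positive_on_face (swap_xy (P v)) (swap_xy \<circ> P')" using admissible_positive(2)[OF P 2(2)] by (simp add: P'_def)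
    have lin': "linear (swap_xy \<circ> P')" 
      using linear_compose[OF lin] bounded_linear_swap_xy bounded_linear.linear by blast
    have "fst (swap_xy (P v)) \<noteq> 0" using 2 \<alpha> by auto
    then have "inj (swap_xy \<circ> P')" using positive_on_face_inj[OF lin' pos] by blast
    then have "inj P'" by (rule inj_on_imageI2)
    moreover have "swap_xy (P v) \<in> s.L" using PL by (simp add: s.swap_xy_L)
    then obtain \<nu> where \<nu>: "outward (germ m l k) (polydisc \<alpha> \<epsilon>) (swap_xy (P v)) \<nu>"
      "complex_positive_frame (vector [\<nu>, (swap_xy \<circ> P') (axis 1 1), (swap_xy \<circ> P') (axis 2 1), (swap_xy \<circ> P') (axis 3 1)])"
      using s.positive_on_face_frame[OF _ _ _ _ pos] 2 ker dgerm_swap_xy by auto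
    then have "outward (germ m k l) (polydisc \<alpha> \<epsilon>) (P v) (swap_xy \<nu>)"
      "complex_positive_frame (vector [swap_xy \<nu>, P' (axis 1 1), P' (axis 2 1), P' (axis 3 1)])"
      using outward_swap_xy complex_positive_frame_swap_xy[OF \<nu>(2)] by auto
    ultimately show ?thesis by blast
  qed
qed

lemma straightening_derivative_inj:
  assumes P: "admissible L \<alpha> D P" "v \<in> D" "P v \<in> corner \<alpha>"
  shows "((straightening \<circ> P) has_derivative
      (\<lambda>h. (\<i> * cis (v$1) * of_real (h$1), \<i> * cis (v$2) * of_real (h$2), h$3))) (at v)"
    and "inj (\<lambda>h::real^3. (\<i> * cis (v$1) * complex_of_real (h$1), \<i> * cis (v$2) * complex_of_real (h$2), h$3))"
proof -
  have c: "corner_type \<alpha> D P" using P edge_not_corner[of \<alpha> D P v] by (auto simp: admissible_def)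
  have D: "open D" using P by (auto simp: admissible_def)
  show "((straightening \<circ> P) has_derivative
      (\<lambda>h. (\<i> * cis (v$1) * of_real (h$1), \<i> * cis (v$2) * of_real (h$2), h$3))) (at v)"
    by (rule has_derivative_transform_within_open[OF _ D P(2), of "\<lambda>v. (cis (v$1), cis (v$2), v$3)"])
      (auto simp: straightening_corner_type[OF c] intro!: has_derivative_Pair has_derivative_cis
        bounded_linear_imp_has_derivative bounded_linear_vec_nth)
  show "inj (\<lambda>h::real^3. (\<i> * cis (v$1) * complex_of_real (h$1), \<i> * cis (v$2) * complex_of_real (h$2), h$3))"
    by (rule injI) (simp add: vec_eq_iff forall_3)
qed

lemma atlas_smoothed_boundary:
  assumes cover: "\<And>p. p \<in> L \<Longrightarrow> \<exists>D P v. admissible L \<alpha> D P \<and> v \<in> D \<and> P v = p"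
  shows "smoothed_boundary_atlas (germ m k l) \<alpha> \<epsilon> t atlas"
  unfolding smoothed_boundary_atlas_def
proof (intro conjI atlas_oriented cover)
  have "smooth_on (\<phi> ` (U - corner \<alpha>)) (inv_into U \<phi>) \<and>
        (\<forall>p\<in>U - corner \<alpha>. let D = frechet_derivative (inv_into U \<phi>) (at (\<phi> p)) in
           inj D \<and>
           (\<exists>\<nu>. outward (germ m k l) (polydisc \<alpha> \<epsilon>) p \<nu> \<and>
              complex_positive_frame (vector [\<nu>, D (axis 1 1), D (axis 2 1), D (axis 3 1)]))) \<and>
        smooth_on (\<phi> ` {(x, y, z) \<in> U. x \<noteq> 0 \<and> y \<noteq> 0}) (straightening \<circ> inv_into U \<phi>) \<and>
        (\<forall>p\<in>U \<inter> corner \<alpha>. inj (frechet_derivative (straightening \<circ> inv_into U \<phi>) (at (\<phi> p))))"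
    if "(U, \<phi>) \<in> atlas" for U \<phi>
  proof -
    from that obtain D P where U: "U = P ` D" "\<phi> = inv_into D P" and P: "admissible L \<alpha> D P" and inj: "inj_on P D"
      by (auto simp: atlas_def)
    have D: "open D" using P by (auto simp: admissible_def)
    have eq: "P v = inv_into U \<phi> v" if "v \<in> D" for v using inv_inv_into[OF inj that] U by simp
    have \<phi>: "\<phi> (P v) = v" if "v \<in> D" for v using that inj U by simp
    have dom: "\<phi> ` {p \<in> U. R p} = {v \<in> D. R (P v)}" for R
    proof (intro equalityI subsetI)
      fix v assume "v \<in> {v \<in> D. R (P v)}"
      then show "v \<in> \<phi> ` {p \<in> U. R p}" using U(1) \<phi> by (intro image_eqI[of _ _ "P v"]) auto
    qed (use U(1) \<phi> in auto)
    have o1: "open {v \<in> D. P v \<notin> corner \<alpha>}" by (rule open_off_corner[OF P])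
    have d1: "\<phi> ` (U - corner \<alpha>) = {v \<in> D. P v \<notin> corner \<alpha>}"
      using dom[of "\<lambda>p. p \<notin> corner \<alpha>"] by (simp add: set_diff_eq)
    have o2: "open {v \<in> D. fst (P v) \<noteq> 0 \<and> fst (snd (P v)) \<noteq> 0}" by (rule open_off_axes[OF P])
    have d2: "\<phi> ` {(x, y, z) \<in> U. x \<noteq> 0 \<and> y \<noteq> 0} = {v \<in> D. fst (P v) \<noteq> 0 \<and> fst (snd (P v)) \<noteq> 0}"
    proof -
      have "{(x, y, z) \<in> U. x \<noteq> 0 \<and> y \<noteq> 0} = {p \<in> U. fst p \<noteq> 0 \<and> fst (snd p) \<noteq> 0}" by auto
      then show ?thesis using dom[of "\<lambda>p. fst p \<noteq> 0 \<and> fst (snd p) \<noteq> 0"] by simp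
    qed
    have "Ck_on n (\<phi> ` (U - corner \<alpha>)) (inv_into U \<phi>)" for n
      unfolding d1 by (rule Ck_on_cong[OF o1 _ admissible_Ck_on[OF P]]) (use eq in auto)
    moreover have "Ck_on n (\<phi> ` {(x, y, z) \<in> U. x \<noteq> 0 \<and> y \<noteq> 0}) (straightening \<circ> inv_into U \<phi>)" for n
      unfolding d2 by (rule Ck_on_cong[OF o2 _ straightening_Ck_on[OF P]]) (use eq in auto)
    moreover have "let D = frechet_derivative (inv_into U \<phi>) (at (\<phi> p)) in
           inj D \<and>
           (\<exists>\<nu>. outward (germ m k l) (polydisc \<alpha> \<epsilon>) p \<nu> \<and>
              complex_positive_frame (vector [\<nu>, D (axis 1 1), D (axis 2 1), D (axis 3 1)]))"
      if p: "p \<in> U - corner \<alpha>" for p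
    proof -
      obtain v where v: "v \<in> D" "p = P v" using p U by auto
      have "P v \<notin> corner \<alpha>" using p v by auto
      note fr = admissible_frame[OF P v(1) this] and dP = admissible_has_derivative[OF P v(1) this]
      have "(inv_into U \<phi> has_derivative frechet_derivative P (at v)) (at v)"
        by (rule has_derivative_transform_within_open[OF dP D v(1) eq])
      then have "frechet_derivative (inv_into U \<phi>) (at (\<phi> p)) = frechet_derivative P (at v)"
        using \<phi>[OF v(1)] v(2) frechet_derivative_eq by metis
      then show ?thesis using fr v(2) by (simp add: Let_def)
    qed
    moreover have "inj (frechet_derivative (straightening \<circ> inv_into U \<phi>) (at (\<phi> p)))" if p: "p \<in> U \<inter> corner \<alpha>" for p
    proof -
      obtain v where v: "v \<in> D" "p = P v" using p U by auto
      have "P v \<in> corner \<alpha>" using p v by auto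
      note S = straightening_derivative_inj[OF P v(1) this]
      have "((straightening \<circ> inv_into U \<phi>) has_derivative
          (\<lambda>h. (\<i> * cis (v$1) * of_real (h$1), \<i> * cis (v$2) * of_real (h$2), h$3))) (at v)"
        by (rule has_derivative_transform_within_open[OF S(1) D v(1)]) (simp add: eq)
      then show ?thesis using S(2) \<phi>[OF v(1)] v(2) by (simp add: frechet_derivative_eq)
    qed
    ultimately show ?thesis unfolding smooth_on_def by blast
  qed
  then show "\<forall>(U, \<phi>)\<in>atlas. smooth_on (\<phi> ` (U - corner \<alpha>)) (inv_into U \<phi>) \<and>
        (\<forall>p\<in>U - corner \<alpha>. let D = frechet_derivative (inv_into U \<phi>) (at (\<phi> p)) in
           inj D \<and>
           (\<exists>\<nu>. outward (germ m k l) (polydisc \<alpha> \<epsilon>) p \<nu> \<and>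
              complex_positive_frame (vector [\<nu>, D (axis 1 1), D (axis 2 1), D (axis 3 1)]))) \<and>
        smooth_on (\<phi> ` {(x, y, z) \<in> U. x \<noteq> 0 \<and> y \<noteq> 0}) (straightening \<circ> inv_into U \<phi>) \<and>
        (\<forall>p\<in>U \<inter> corner \<alpha>. inj (frechet_derivative (straightening \<circ> inv_into U \<phi>) (at (\<phi> p))))"
    by blast
qed

lemma compact_L: "compact L"
proof -
  have "L = polydisc \<alpha> \<epsilon> \<inter> germ m k l -` {t} \<inter> frontier (polydisc \<alpha> \<epsilon>)"
    by (simp add: milnor_boundary_def milnor_fibre_def)
  moreover have "compact (polydisc \<alpha> \<epsilon>)" unfolding polydisc_def by (intro compact_Times compact_cball)
  moreover have "closed (germ m k l -` {t})"
  proof (rule closed_vimage)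
    show "continuous_on UNIV (germ m k l)"
      by (intro continuous_at_imp_continuous_on ballI has_derivative_continuous[OF has_derivative_germ])
  qed simp
  ultimately show ?thesis by (simp add: compact_Int_closed)
qed

lemma L_closed_oriented_manifold:
  assumes "\<And>p. p \<in> L \<Longrightarrow> \<exists>D P v. admissible L \<alpha> D P \<and> v \<in> D \<and> P v = p"
  shows "closed_oriented_manifold (top_of_set L) atlas"
  unfolding closed_oriented_manifold_def
proof (intro conjI atlas_oriented assms)
  show "compact_space (top_of_set L)" using compact_L by (simp add: compact_space_subtopology)
  show "Hausdorff_space (top_of_set L)" by (simp add: Hausdorff_space_subtopology)
  have "second_countable (euclidean :: C3 topology)"
  proof -
    obtain B :: "C3 set set" where B: "countable B" "topological_basis B" using ex_countable_basis by blast
    have "\<exists>V\<in>B. x \<in> V \<and> V \<subseteq> U" if "open U" "x \<in> U" for U x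
      using topological_basisE[OF B(2) that] by metis
    moreover have "\<forall>V\<in>B. open V" using B(2) by (simp add: topological_basis_open)
    ultimately show ?thesis using B(1) unfolding second_countable_def open_openin[symmetric]
      by (intro exI[of _ B]) simp
  qed
  then show "second_countable (top_of_set L)" by (rule second_countable_subtopology)
qed

end

section \<open>The Seifert foliation\<close>

definition principal_root :: "nat \<Rightarrow> complex \<Rightarrow> complex" where
  "principal_root n w = exp (Ln w / of_nat n)"

lemma principal_root:
  "n \<ge> 1 \<Longrightarrow> w \<noteq> 0 \<Longrightarrow> principal_root n w ^ n = w" "principal_root n w \<noteq> 0" "principal_root n 1 = 1"
  by (auto simp: principal_root_def exp_of_nat_mult[symmetric])

lemma near_one:
  assumes "cmod (w - 1) < 1"
  shows "w \<notin> \<real>\<^sub>\<le>\<^sub>0" "w \<noteq> 0"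
proof -
  have "\<bar>Re (w - 1)\<bar> < 1" using abs_Re_le_cmod assms by (rule order.strict_trans1)
  then have "Re w > 0" by auto
  then show "w \<notin> \<real>\<^sub>\<le>\<^sub>0" "w \<noteq> 0" by (auto simp: complex_nonpos_Reals_iff)
qed

lemma continuous_on_principal_root:
  assumes "continuous_on S f" "\<And>x. x \<in> S \<Longrightarrow> cmod (f x - 1) < 1" "n \<ge> 1"
  shows "continuous_on S (\<lambda>x. principal_root n (f x))"
  unfolding principal_root_def using assms near_one(1) by (intro continuous_intros) auto

lemma coprime_power_inj:
  fixes c d :: complex
  assumes "coprime a b" "a \<noteq> 0" "c ^ a = d ^ a" "c ^ b = d ^ b" "d \<noteq> 0"
  shows "c = d"
proof -
  obtain x y where "a * x = b * y + gcd a b" using bezout_nat[OF assms(2), of b] by blast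
  then have xy: "a * x = b * y + 1" using assms(1) by simp
  have 1: "(c / d) ^ a = 1" "(c / d) ^ b = 1" using assms by (auto simp: power_divide)
  have "(c / d) ^ (a * x) = (c / d) ^ (b * y) * (c / d)" unfolding xy by (simp add: power_add)
  then have "c / d = 1" using 1 by (simp add: power_mult)
  then show ?thesis using assms(5) by simp
qed

lemma solid_torus_iff: "torus_cover v \<in> solid_torus \<longleftrightarrow> cmod (Complex (v$1) (v$2)) < 1"
  by (simp add: torus_cover_def solid_torus_def)

lemma continuous_on_torus_cover: "continuous_on S torus_cover"
proof -
  have eq: "torus_cover = (\<lambda>v. (of_real (v$1) + \<i> * of_real (v$2), cis (v$3)))"
    by (auto simp: torus_cover_def Complex_eq fun_eq_iff)
  show ?thesis unfolding eq by (intro continuous_intros)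
qed

lemma torus_cover_surj:
  assumes "w \<in> solid_torus"
  obtains v where "torus_cover v = w"
proof -
  obtain \<zeta> u where w: "w = (\<zeta>, u)" by (cases w)
  have "u \<noteq> 0" "cmod u = 1" using assms w by (auto simp: solid_torus_def)
  then have "cis (Arg u) = u" using cis_Arg[of u] by (simp add: sgn_div_norm)
  then have "torus_cover (vector [Re \<zeta>, Im \<zeta>, Arg u]) = w" by (simp add: torus_cover_def w)
  then show thesis by (rule that)
qed

lemma open_affine_image:
  fixes T :: "real^3 \<Rightarrow> real^3"
  assumes T: "linear T" "det (matrix T) \<noteq> 0" and "open S"
  shows "open ((\<lambda>v. T v + b) ` S)"
proof -
  have "inj T" using det_nz_iff_inj[OF T(1)] T(2) by blast
  then have "surj T" using linear_injective_imp_surjective[OF T(1)] by blast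
  then have "open (T ` S)" using open_surjective_linear_image[OF assms(3) T(1)] by blast
  then have "open ((+) b ` T ` S)" by (rule open_translation)
  then show ?thesis by (simp add: image_image add.commute)
qed

context milnor begin

definition "k' = k div gcd k l"
definition "l' = l div gcd k l"

lemma reduced_exponents: "coprime k' l'" "k * l' = l * k'" "k' \<noteq> 0" "l' \<noteq> 0"
proof -
  show "coprime k' l'" unfolding k'_def l'_def using k by (intro div_gcd_coprime) auto
  have "k = gcd k l * k'" "l = gcd k l * l'" by (auto simp: k'_def l'_def)
  then show "k * l' = l * k'" by (metis mult.assoc mult.commute)
  show "k' \<noteq> 0" using \<open>k = gcd k l * k'\<close> k by (metis mult_0_right not_one_le_zero)
  show "l' \<noteq> 0" using \<open>l = gcd k l * l'\<close> l by (metis mult_0_right not_one_le_zero)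
qed

text \<open>
  The exponents make \<open>x\<^sup>k y\<^sup>l\<close> invariant, and they are coprime, so that the circle acts freely where
  \<open>x y \<noteq> 0\<close>. On \<open>y = 0\<close> and on \<open>x = 0\<close> the stabilisers have order \<open>l'\<close> and \<open>k'\<close>.
\<close>

definition act :: "complex \<Rightarrow> C3 \<Rightarrow> C3" where
  "act c = (\<lambda>(x, y, z). (c ^ l' * x, c powi (- int k') * y, z))"

definition orbit :: "C3 \<Rightarrow> C3 set" where
  "orbit p = (\<lambda>c. act c p) ` sphere 0 1"

lemma act_simp: "act c (x, y, z) = (c ^ l' * x, inverse c ^ k' * y, z)"
  by (simp add: act_def power_int_minus power_inverse)

lemma act_one: "act 1 p = p" by (cases p) (simp add: act_simp)

lemma act_act: "act c (act d p) = act (c * d) p"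
  by (cases p) (simp add: act_simp power_mult_distrib)

lemma monomial_invariant:
  fixes c x y :: complex
  assumes "c \<noteq> 0"
  shows "(c ^ l' * x) ^ k * (inverse c ^ k' * y) ^ l = x ^ k * y ^ l"
proof -
  have "(c ^ l') ^ k = c ^ (k * l')" "(inverse c ^ k') ^ l = inverse (c ^ (l * k'))"
    by (simp_all add: power_mult[symmetric] power_inverse mult.commute)
  then have "(c ^ l') ^ k * (inverse c ^ k') ^ l = 1"
    using reduced_exponents(2) assms by simp
  then have "(c ^ l') ^ k * (inverse c ^ k') ^ l * (x ^ k * y ^ l) = x ^ k * y ^ l" by simp
  then show ?thesis by (simp add: power_mult_distrib mult_ac)
qed

lemma act_L:
  assumes "cmod c = 1"
  shows "act c p \<in> L \<longleftrightarrow> p \<in> L"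
proof -
  obtain x y z where p: "p = (x, y, z)" by (cases p)
  have "c \<noteq> 0" using assms by auto
  then show ?thesis
    unfolding p act_simp mem_L using assms
    by (simp add: monomial_invariant norm_mult norm_power norm_inverse)
qed

lemma orbit_partition: "partition_on L (orbit ` L)"
proof (rule partition_onI)
  have self: "p \<in> orbit p" for p
    unfolding orbit_def by (rule image_eqI[of _ _ 1]) (auto simp: act_one)
  have sub: "orbit p \<subseteq> orbit q" if "p = act c q" "cmod c = 1" for p q c
    unfolding orbit_def that(1) act_act using that(2) by (auto simp: norm_mult intro!: imageI)
  have inv: "q = act (inverse c) (act c q)" "cmod (inverse c) = 1" if "cmod c = 1" for c q
  proof -
    have "c \<noteq> 0" using that by auto
    then show "q = act (inverse c) (act c q)" "cmod (inverse c) = 1"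
      using that by (auto simp: act_act act_one norm_inverse)
  qed
  have eq: "orbit (act c q) = orbit q" if "cmod c = 1" for c q
    using sub[OF refl that] sub[OF inv[OF that]] by blast
  have "orbit p \<subseteq> L" if "p \<in> L" for p 
    unfolding orbit_def using act_L that by (intro image_subsetI) simp
  then show "\<Union> (orbit ` L) = L" using self by blast
  show "{} \<notin> orbit ` L" using self by blast
  show "disjnt C C'" if C: "C \<in> orbit ` L" "C' \<in> orbit ` L" "C \<noteq> C'" for C C'
  proof (rule ccontr)
    assume "\<not> disjnt C C'"
    then obtain r where r: "r \<in> C" "r \<in> C'" by (auto simp: disjnt_def)
    from C obtain p q where pq: "C = orbit p" "C' = orbit q" by blast
    obtain c where "r = act c p" "cmod c = 1" using r(1) unfolding pq(1) orbit_def by auto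
    then have "orbit r = C" unfolding pq using eq[of c p] by simp
    obtain d where "r = act d q" "cmod d = 1" using r(2) unfolding pq(2) orbit_def by auto
    then have "orbit r = C'" unfolding pq using eq[of d q] by simp
    then show False using C(3) \<open>orbit r = C\<close> by simp
  qed
qed

text \<open>
  A model \<open>g\<close> of a fibred solid torus with core the orbit of \<open>p0\<close>, such that \<open>g\<close> composed with the
  universal covering is \<open>P\<close> composed with an affine isomorphism. That \<open>g\<close> is open and a local
  diffeomorphism is then inherited from \<open>P\<close>.
\<close>

definition torus_data :: "C3 \<Rightarrow> (real^3) set \<Rightarrow> (real^3 \<Rightarrow> C3) \<Rightarrow> bool" where
  "torus_data p0 D P \<longleftrightarrow> (\<exists>p q g T b. q \<ge> 1 \<and> coprime p (int q) \<and>
     continuous_on solid_torus g \<and> inj_on g solid_torus \<and>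
     linear T \<and> det (matrix T :: real^3^3) \<noteq> 0 \<and>
     (\<forall>v. torus_cover v \<in> solid_torus \<longrightarrow> T v + b \<in> D \<and> g (torus_cover v) = P (T v + b)) \<and>
     (\<forall>w\<in>solid_torus. g ` torus_leaf p q w = orbit (g w)) \<and> g (0, 1) = p0)"

lemma torus_data_covers:
  assumes "torus_data p0 D P"
  shows "\<exists>v\<in>D. P v = p0"
proof -
  from assms obtain g :: "complex \<times> complex \<Rightarrow> C3" and T :: "real^3 \<Rightarrow> real^3" and b
    where g: "\<And>v. torus_cover v \<in> solid_torus \<Longrightarrow> T v + b \<in> D \<and> g (torus_cover v) = P (T v + b)"
    and g0: "g (0, 1) = p0" unfolding torus_data_def by blast
  have "torus_cover 0 = (0, 1)" by (simp add: torus_cover_def complex_eq_iff)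
  moreover have "(0, 1) \<in> solid_torus" by (simp add: solid_torus_def)
  ultimately show ?thesis using g[of 0] g0 by auto
qed

text \<open>
  A chart after \<open>g \<circ> torus_cover\<close> is a transition map out of \<open>P\<close>, precomposed with the affine
  isomorphism, so its Jacobian is that of the transition map times \<open>det T\<close>.
\<close>

lemma torus_data_fibred_nbhd:
  assumes P: "admissible L \<alpha> D P" and "torus_data p0 D P" and p0: "p0 \<in> L"
  shows "fibred_torus_nbhd (top_of_set L) atlas (orbit ` L) (orbit p0)"
proof -
  from assms(2) obtain p q g T b where pq: "q \<ge> 1" "coprime p (int q)"
    and g: "continuous_on solid_torus g" "inj_on g solid_torus"
    and T: "linear T" "det (matrix T :: real^3^3) \<noteq> 0"
    and gP: "\<And>v. torus_cover v \<in> solid_torus \<Longrightarrow> T v + b \<in> D \<and> g (torus_cover v) = P (T v + b)"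
    and orb: "\<And>w. w \<in> solid_torus \<Longrightarrow> g ` torus_leaf p q w = orbit (g w)" and g0: "g (0, 1) = p0"
    unfolding torus_data_def by blast
  let ?A = "\<lambda>v. T v + b"
  let ?B = "torus_cover -` solid_torus"
  have B: "open ?B"
  proof -
    have eq: "?B = {v. cmod (Complex (v$1) (v$2)) < 1}" by (simp add: set_eq_iff solid_torus_iff)
    show ?thesis unfolding eq Complex_eq by (intro open_Collect_less continuous_intros)
  qed
  have PL: "P ` D \<subseteq> L" using P by (auto simp: admissible_def)
  have gL: "g w \<in> L" if w: "w \<in> solid_torus" for w
  proof -
    obtain v where "torus_cover v = w" using torus_cover_surj[OF w] .
    then show ?thesis using gP[of v] PL w by auto
  qed
  have opn: "openin (top_of_set L) (g ` O')" if O': "openin (top_of_set solid_torus) O'" for O'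
  proof -
    obtain W where W: "open W" "O' = solid_torus \<inter> W" using O' by (auto simp: openin_open)
    let ?S = "?B \<inter> torus_cover -` W"
    have "open ?S" using B open_vimage[OF W(1)] continuous_on_torus_cover by blast
    then have "open (?A ` ?S)" by (rule open_affine_image[OF T])
    moreover have "?A ` ?S \<subseteq> D" using gP by auto
    ultimately have "openin (top_of_set L) (P ` ?A ` ?S)" by (rule admissible_open_map[OF P])
    moreover have "P ` ?A ` ?S = g ` O'"
    proof (intro equalityI subsetI)
      fix y assume "y \<in> P ` ?A ` ?S"
      then obtain v where v: "v \<in> ?S" "y = P (T v + b)" by blast
      then have "y = g (torus_cover v)" "torus_cover v \<in> O'" using gP[of v] W(2) by auto
      then show "y \<in> g ` O'" by blast
    next
      fix y assume "y \<in> g ` O'"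
      then obtain w where w: "w \<in> O'" "y = g w" by blast
      obtain v where "torus_cover v = w" using torus_cover_surj[of w] w W(2) by blast
      then have "v \<in> ?S" "y = P (?A v)" using w W(2) gP[of v] by auto
      then show "y \<in> P ` ?A ` ?S" by blast
    qed
    ultimately show ?thesis by simp
  qed
  let ?N = "g ` solid_torus"
  have N: "openin (top_of_set L) ?N" by (rule opn) simp
  have NL: "?N \<subseteq> L" using gL by auto
  have sub: "subtopology (top_of_set L) ?N = top_of_set ?N"
    using NL by (simp add: subtopology_subtopology Int_absorb1)
  have "homeomorphic_map (top_of_set solid_torus) (subtopology (top_of_set L) ?N) g"
    unfolding sub
  proof (rule bijective_open_imp_homeomorphic_map)
    show "open_map (top_of_set solid_torus) (top_of_set ?N) g"
      unfolding open_map_def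
    proof (intro allI impI)
      fix O' assume O': "openin (top_of_set solid_torus) O'"
      then have "O' \<subseteq> solid_torus" using openin_imp_subset by blast
      then show "openin (top_of_set ?N) (g ` O')"
        using openin_subset_trans[OF opn[OF O'] _ NL] by blast
    qed
  qed (use g in auto)
  moreover have "local_diffeo_on atlas ?B (g \<circ> torus_cover)"
  proof -
    have "smooth_on {v \<in> ?B. (g \<circ> torus_cover) v \<in> U} (\<phi> \<circ> (g \<circ> torus_cover)) \<and>
        (\<forall>v\<in>?B. (g \<circ> torus_cover) v \<in> U \<longrightarrow> jacobian (\<phi> \<circ> (g \<circ> torus_cover)) v \<noteq> 0)"
      if chart: "(U, \<phi>) \<in> atlas" for U \<phi>
    proof -
      obtain D1 P1 where U: "U = P1 ` D1" "\<phi> = inv_into D1 P1" and P1: "admissible L \<alpha> D1 P1" "inj_on P1 D1"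
        using chart by (auto simp: atlas_def)
      let ?\<tau> = "inv_into D1 P1 \<circ> P" and ?D = "{u \<in> D. P u \<in> P1 ` D1}"
      let ?S = "{v \<in> ?B. (g \<circ> torus_cover) v \<in> U}"
      note sm = transition_smooth[OF P1 P] and oD = transition(1)[OF P1 P]
      have dA: "(?A has_derivative T) (at v)" for v
        using linear_conv_bounded_linear T(1) by (auto intro!: derivative_eq_intros bounded_linear_imp_has_derivative)
      have cA: "continuous_on UNIV ?A"
        by (intro continuous_at_imp_continuous_on ballI has_derivative_continuous[OF dA])
      have Seq: "?S = ?B \<inter> ?A -` ?D"
      proof (rule set_eqI)
        show "v \<in> ?S \<longleftrightarrow> v \<in> ?B \<inter> ?A -` ?D" for v
          by (cases "torus_cover v \<in> solid_torus") (simp_all add: U gP)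
      qed
      have S: "open ?S" unfolding Seq using B open_vimage[OF oD cA] by blast
      have eq: "?\<tau> (?A v) = (\<phi> \<circ> (g \<circ> torus_cover)) v" if "v \<in> ?S" for v using gP[of v] that U by auto
      have CA: "Ck_on n ?S ?A" for n
      proof -
        have "Ck_on n ?S (\<lambda>v. T v)"
          using Ck_on_linear_comp[OF _ S Ck_on_ident] T(1) linear_conv_bounded_linear by blast
        then show ?thesis by (intro Ck_on_add S Ck_on_const)
      qed
      have "?A ` ?S \<subseteq> ?D" unfolding Seq by auto
      then have "Ck_on n ?S (\<lambda>v. ?\<tau> (?A v))" for n
        by (intro Ck_on_compose[OF S CA sm(1)[unfolded smooth_on_def, rule_format]])
      then have Ck: "Ck_on n ?S (\<phi> \<circ> (g \<circ> torus_cover))" for n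
        by (rule Ck_on_cong[OF S eq, rotated])
      have "jacobian (\<phi> \<circ> (g \<circ> torus_cover)) v \<noteq> 0" if v: "v \<in> ?S" for v
      proof -
        have vD: "?A v \<in> ?D" using v unfolding Seq by auto
        have d\<tau>: "(?\<tau> has_derivative frechet_derivative ?\<tau> (at (?A v))) (at (?A v))"
          using Ck_on_SucD[OF sm(1)[unfolded smooth_on_def, rule_format] vD] .
        have "((\<lambda>v. ?\<tau> (?A v)) has_derivative (\<lambda>h. frechet_derivative ?\<tau> (at (?A v)) (T h))) (at v)"
          by (rule has_derivative_compose[OF dA d\<tau>])
        then have "((\<phi> \<circ> (g \<circ> torus_cover)) has_derivative (frechet_derivative ?\<tau> (at (?A v)) \<circ> T)) (at v)"
          unfolding comp_def[of _ T] by (rule has_derivative_transform_within_open[OF _ S v]) (rule eq)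
        then have "jacobian (\<phi> \<circ> (g \<circ> torus_cover)) v = det (matrix (frechet_derivative ?\<tau> (at (?A v)) \<circ> T))"
          unfolding jacobian_def by (simp only: frechet_derivative_eq)
        also have "\<dots> = jacobian ?\<tau> (?A v) * det (matrix T)"
          unfolding jacobian_def matrix_compose[OF T(1) has_derivative_linear[OF d\<tau>]] by (rule det_mul)
        finally show ?thesis using sm(2)[of "?A v"] vD T(2) by simp
      qed
      then show ?thesis using Ck unfolding smooth_on_def by blast
    qed
    then show ?thesis unfolding local_diffeo_on_def by blast
  qed
  moreover have "\<forall>w\<in>solid_torus. g ` torus_leaf p q w \<in> orbit ` L" using orb gL by auto
  moreover have "g ` torus_leaf p q (0, 1) = orbit p0"
    using orb[of "(0, 1)"] g0 by (auto simp: solid_torus_def)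
  ultimately show ?thesis unfolding fibred_torus_nbhd_def using pq N by blast
qed

lemma swap_xy_act:
  assumes "cmod c = 1"
  shows "swap_xy (milnor.act l k c p) = act (inverse c) (swap_xy p)"
proof -
  interpret s: milnor m l k \<alpha> \<epsilon> t by (rule swapped)
  show ?thesis
    by (cases p) (simp add: s.act_simp act_simp s.k'_def s.l'_def k'_def l'_def gcd.commute)
qed

lemma swap_xy_orbit: "swap_xy ` milnor.orbit l k p = orbit (swap_xy p)"
proof -
  interpret s: milnor m l k \<alpha> \<epsilon> t by (rule swapped)
  have "swap_xy ` s.orbit p = (\<lambda>c. act (inverse c) (swap_xy p)) ` sphere 0 1"
    unfolding s.orbit_def image_image by (intro image_cong) (auto simp: swap_xy_act)
  also have "\<dots> = (\<lambda>c. act c (swap_xy p)) ` inverse ` sphere 0 1" by (simp add: image_image)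
  also have "inverse ` sphere 0 1 = (sphere 0 1 :: complex set)"
  proof (intro equalityI subsetI)
    fix c :: complex assume "c \<in> sphere 0 1"
    then show "c \<in> inverse ` sphere 0 1" by (intro image_eqI[of _ _ "inverse c"]) (auto simp: norm_inverse)
  qed (auto simp: norm_inverse)
  finally show ?thesis by (simp add: orbit_def)
qed

text \<open>
  Exchanging \<open>x\<close> and \<open>y\<close> turns the action of \<open>c\<close> for the exponents \<open>(l, k)\<close> into that of \<open>1 / c\<close> for
  \<open>(k, l)\<close>, so the orbits correspond.
\<close>

lemma torus_data_swapped:
  assumes "milnor.torus_data l k (swap_xy p0) D P"
  shows "torus_data p0 D (swap_xy \<circ> P)"
proof -
  interpret s: milnor m l k \<alpha> \<epsilon> t by (rule swapped)
  from assms obtain p q g T b where pq: "q \<ge> 1" "coprime p (int q)"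
    and g: "continuous_on solid_torus g" "inj_on g solid_torus"
    and T: "linear T" "det (matrix T :: real^3^3) \<noteq> 0"
    and gP: "\<forall>v. torus_cover v \<in> solid_torus \<longrightarrow> T v + b \<in> D \<and> g (torus_cover v) = P (T v + b)"
    and orb: "\<forall>w\<in>solid_torus. g ` torus_leaf p q w = s.orbit (g w)" and g0: "g (0, 1) = swap_xy p0"
    unfolding s.torus_data_def by blast
  have "inj swap_xy" by (metis injI swap_xy_simps(2))
  then have "inj_on (swap_xy \<circ> g) solid_torus" using g(2) comp_inj_on inj_on_subset by blast
  moreover have "(swap_xy \<circ> g) ` torus_leaf p q w = orbit ((swap_xy \<circ> g) w)" if "w \<in> solid_torus" for w
  proof -
    have "(swap_xy \<circ> g) ` torus_leaf p q w = swap_xy ` g ` torus_leaf p q w" by (simp add: image_comp)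
    then show ?thesis using orb[rule_format, OF that] swap_xy_orbit by simp
  qed
  ultimately show ?thesis
    unfolding torus_data_def
    by (intro exI[of _ p] exI[of _ q] exI[of _ "swap_xy \<circ> g"] exI[of _ T] exI[of _ b])
      (use pq swap_xy_continuous[OF g(1)] T gP g0 in auto)
qed

lemma equivariant_leaf:
  assumes "\<And>c. cmod c = 1 \<Longrightarrow> g (c powi p * \<zeta>, c ^ q * u) = act c (g (\<zeta>, u))"
  shows "g ` torus_leaf p q (\<zeta>, u) = orbit (g (\<zeta>, u))"
  unfolding torus_leaf_def orbit_def using assms by (auto simp: image_image)

end

section \<open>Fibred neighbourhoods of the leaves\<close>

lemma small_radius:
  assumes "a > 0" "c > 0" "n \<ge> 1"
  obtains \<delta> :: real where "\<delta> > 0" "\<delta> < a" "\<delta> ^ n < c"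
proof -
  define \<delta> where "\<delta> = min (a / 2) (min 1 (c / 2))"
  have d: "\<delta> > 0" "\<delta> < a" "\<delta> \<le> 1" "\<delta> < c" using assms by (auto simp: \<delta>_def)
  then have "\<delta> ^ n \<le> \<delta> ^ 1" using assms(3) by (intro power_decreasing) auto
  then show thesis using d by (intro that[of \<delta>]) auto
qed

lemma polar_form:
  obtains a where "x = of_real (cmod x) * cis a"
  using rcis_cmod_Arg[of x] unfolding rcis_def by metis

lemma inverse_cis_power: "inverse (cis a) ^ n = cis (- (real n * a))"
  by (simp add: cis_inverse Complex.DeMoivre)

lemma of_real_mult_Complex: "of_real r * Complex a b = Complex (r * a) (r * b)"
  by (simp add: complex_eq_iff)

context milnor begin

text \<open>
  A disc \<open>\<sigma>\<close> that meets each orbit at most once, in points with trivial stabiliser, is a transversal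
  of a regular fibration: \<open>g (\<zeta>, u) = u \<cdot> \<sigma> \<zeta>\<close>, of type \<open>p = 0\<close>, \<open>q = 1\<close>.
\<close>

lemma torus_dataI_free:
  assumes \<sigma>: "continuous_on (ball 0 1) \<sigma>"
    and inj: "\<And>\<zeta> \<zeta>' u u'. \<zeta> \<in> ball 0 1 \<Longrightarrow> \<zeta>' \<in> ball 0 1 \<Longrightarrow> cmod u = 1 \<Longrightarrow> cmod u' = 1 \<Longrightarrow>
      act u (\<sigma> \<zeta>) = act u' (\<sigma> \<zeta>') \<Longrightarrow> \<zeta> = \<zeta>' \<and> u = u'"
    and T: "linear T" "det (matrix T :: real^3^3) \<noteq> 0"
    and P: "\<And>v. cmod (Complex (v$1) (v$2)) < 1 \<Longrightarrow>
      T v + b \<in> D \<and> act (cis (v$3)) (\<sigma> (Complex (v$1) (v$2))) = P (T v + b)"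
    and "\<sigma> 0 = p0"
  shows "torus_data p0 D P"
proof -
  define g where "g w = act (snd w) (\<sigma> (fst w))" for w
  have g: "g = (\<lambda>w. (snd w ^ l' * fst (\<sigma> (fst w)), inverse (snd w) ^ k' * fst (snd (\<sigma> (fst w))), snd (snd (\<sigma> (fst w)))))"
    by (auto simp: g_def act_simp fun_eq_iff case_prod_beta split: prod.splits)
      (metis act_simp prod.collapse)
  have st: "continuous_on solid_torus (\<lambda>w. \<sigma> (fst w))"
    by (rule continuous_on_compose2[OF \<sigma>]) (auto intro!: continuous_intros simp: solid_torus_def)
  have "continuous_on solid_torus g"
    unfolding g by (intro continuous_intros st) (auto simp: solid_torus_def)
  moreover have "inj_on g solid_torus"
  proof (rule inj_onI)
    fix w w' assume "w \<in> solid_torus" "w' \<in> solid_torus" "g w = g w'"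
    then show "w = w'" using inj[of "fst w" "fst w'" "snd w" "snd w'"]
      by (cases w; cases w') (auto simp: g_def solid_torus_def)
  qed
  moreover have "g ` torus_leaf 0 1 w = orbit (g w)" for w
    using equivariant_leaf[of g 0 "fst w" 1 "snd w"] by (simp add: g_def act_act)
  moreover have "T v + b \<in> D \<and> g (torus_cover v) = P (T v + b)" if "torus_cover v \<in> solid_torus" for v
  proof -
    have "cmod (Complex (v$1) (v$2)) < 1" using that by (simp only: solid_torus_iff)
    then show ?thesis using P[of v] by (simp add: g_def torus_cover_def)
  qed
  moreover have "g (0, 1) = p0" using assms(6) by (simp add: g_def act_one)
  ultimately show ?thesis
    unfolding torus_data_def using T
    by (intro exI[of _ 0] exI[of _ 1] exI[of _ g] exI[of _ T] exI[of _ b]) auto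
qed

text \<open>
  The leaves in \<open>y = 0\<close>. With \<open>u = x / x0\<close> and \<open>\<zeta> = y / \<delta>\<close> the action has the weights \<open>l'\<close> on \<open>u\<close> and \<open>-k'\<close>
  on \<open>\<zeta>\<close>, so the type is \<open>p = -k'\<close>, \<open>q = l'\<close>. The third component is the branch of the root of
  \<open>t + x\<^sup>k y\<^sup>l\<close> near \<open>z0\<close>; it is constant along the leaves as the radicand is.
\<close>

lemma torus_disc:
  assumes p0: "(x0, 0, z0) \<in> L"
  shows "\<exists>D P. open D \<and> continuous_on D P \<and> P ` D \<subseteq> L \<and> edge_type \<alpha> D P \<and> torus_data (x0, 0, z0) D P"
proof -
  have x0: "cmod x0 = \<alpha>" and z0: "z0 ^ m = t" "z0 \<noteq> 0"
    using p0 l \<alpha> t m by (auto simp: mem_L max_def power_0_left split: if_splits)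
  obtain \<theta> where \<theta>: "x0 = of_real \<alpha> * cis \<theta>" using polar_form[of x0] x0 by metis
  have "cmod t / \<alpha> ^ k > 0" using t \<alpha> by simp
  then obtain \<delta> where \<delta>: "\<delta> > 0" "\<delta> < \<alpha>" "\<delta> ^ l < cmod t / \<alpha> ^ k"
    using small_radius[OF \<alpha> _ l] by blast
  define W where "W x y = (t + x ^ k * y ^ l) / t" for x y
  define Z where "Z x y = z0 * principal_root m (W x y)" for x y
  have W: "cmod (W x y - 1) < 1" if "cmod x = \<alpha>" "cmod y < \<delta>" for x y
  proof -
    have "cmod (W x y - 1) = \<alpha> ^ k * cmod y ^ l / cmod t"
      using t that by (simp add: W_def field_simps norm_divide norm_mult norm_power)
    also have "\<dots> \<le> \<alpha> ^ k * \<delta> ^ l / cmod t"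
      using that \<alpha> \<delta> by (intro divide_right_mono mult_left_mono power_mono) auto
    also have "\<dots> < 1" using \<delta>(3) \<alpha> t by (simp add: field_simps)
    finally show ?thesis .
  qed
  have Zm: "Z x y ^ m = t + x ^ k * y ^ l" if "cmod (W x y - 1) < 1" for x y
    using principal_root(1)[of m "W x y"] near_one(2)[OF that] m z0 t
    by (simp add: Z_def power_mult_distrib W_def)
  have Znz: "Z x y \<noteq> 0" for x y using z0 principal_root(2) by (simp add: Z_def)
  define D where "D = {v::real^3. cmod (Complex (v$2) (v$3)) < \<alpha> \<and>
      cmod (W (of_real \<alpha> * cis (v$1)) (Complex (v$2) (v$3)) - 1) < 1}"
  define P where "P v = (of_real \<alpha> * cis (v$1), Complex (v$2) (v$3), Z (of_real \<alpha> * cis (v$1)) (Complex (v$2) (v$3)))"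
    for v :: "real^3"
  have "open D"
    unfolding D_def W_def Complex_eq by (intro open_Collect_conj open_Collect_less continuous_intros) (use t in auto)
  moreover have "continuous_on D P"
  proof -
    have "continuous_on D (\<lambda>v. W (of_real \<alpha> * cis (v$1)) (Complex (v$2) (v$3)))"
      unfolding W_def Complex_eq by (intro continuous_intros) (use t in auto)
    then have "continuous_on D (\<lambda>v. principal_root m (W (of_real \<alpha> * cis (v$1)) (Complex (v$2) (v$3))))"
      by (rule continuous_on_principal_root) (use m in \<open>auto simp: D_def\<close>)
    then show ?thesis unfolding P_def Z_def Complex_eq by (intro continuous_intros)
  qed
  moreover have "P ` D \<subseteq> L"
    using Zm \<alpha> by (auto simp: P_def D_def mem_L norm_mult max_def)
  moreover have "edge_type \<alpha> D P"
    unfolding edge_type_def disc_type_def using Znz by (auto simp: P_def D_def)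
  moreover have "torus_data (x0, 0, z0) D P"
  proof -
    define g where "g w = (x0 * snd w, of_real \<delta> * fst w, Z (x0 * snd w) (of_real \<delta> * fst w))" for w
    define T :: "real^3 \<Rightarrow> real^3" where "T v = vector [v$3, \<delta> * v$1, \<delta> * v$2]" for v
    have small: "cmod (x0 * u) = \<alpha>" "cmod (of_real \<delta> * \<zeta>) < \<delta>" if "cmod u = 1" "cmod \<zeta> < 1" for u \<zeta>
      using that x0 \<delta> by (auto simp: norm_mult)
    have "continuous_on solid_torus g"
    proof -
      have "continuous_on solid_torus (\<lambda>w. W (x0 * snd w) (of_real \<delta> * fst w))"
        unfolding W_def by (intro continuous_intros) (use t in auto)
      then have "continuous_on solid_torus (\<lambda>w. principal_root m (W (x0 * snd w) (of_real \<delta> * fst w)))"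
        by (rule continuous_on_principal_root) (use m W small in \<open>auto simp: solid_torus_def\<close>)
      then show ?thesis unfolding g_def Z_def by (intro continuous_intros)
    qed
    moreover have "inj_on g solid_torus"
      using x0 \<alpha> \<delta> by (intro inj_onI) (auto simp: g_def prod_eq_iff)
    moreover have "linear T"
      by (auto simp: T_def linear_iff vec_eq_iff forall_3 algebra_simps)
    moreover have "det (matrix T) \<noteq> 0"
      using \<delta> by (simp add: det_3 matrix_def T_def axis_def)
    moreover have "T v + vector [\<theta>, 0, 0] \<in> D \<and> g (torus_cover v) = P (T v + vector [\<theta>, 0, 0])"
      if "torus_cover v \<in> solid_torus" for v
    proof -
      have v: "cmod (Complex (v$1) (v$2)) < 1" using that by (simp add: solid_torus_iff)
      have e: "of_real \<alpha> * cis (v$3 + \<theta>) = x0 * cis (v$3)" unfolding \<theta> by (simp add: cis_mult[symmetric])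
      have e': "Complex (\<delta> * v$1) (\<delta> * v$2) = of_real \<delta> * Complex (v$1) (v$2)" by (simp add: of_real_mult_Complex)
      show ?thesis
        using small[OF norm_cis v] W[OF small[OF norm_cis v]] \<delta>
        by (simp add: D_def P_def T_def g_def torus_cover_def e e')
    qed
    moreover have "g ` torus_leaf (- int k') l' w = orbit (g w)" if "w \<in> solid_torus" for w
    proof -
      have "g (c powi (- int k') * fst w, c ^ l' * snd w) = act c (g (fst w, snd w))" if c: "cmod c = 1" for c
      proof -
        have "c \<noteq> 0" using c by auto
        have "W (x0 * (c ^ l' * snd w)) (of_real \<delta> * (inverse c ^ k' * fst w)) = W (x0 * snd w) (of_real \<delta> * fst w)"
          using monomial_invariant[OF \<open>c \<noteq> 0\<close>, of "x0 * snd w" "of_real \<delta> * fst w"] by (simp add: W_def mult_ac)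
        then show ?thesis by (simp add: g_def Z_def act_simp power_int_minus power_inverse mult_ac)
      qed
      from equivariant_leaf[of g "- int k'" "fst w" l' "snd w", OF this] show ?thesis by simp
    qed
    moreover have "g (0, 1) = (x0, 0, z0)"
      using principal_root(3) l t by (simp add: g_def Z_def W_def power_0_left)
    moreover have "coprime (- int k') (int l')" using reduced_exponents(1) by simp
    moreover have "l' \<ge> 1" using reduced_exponents(4) by simp
    ultimately show ?thesis unfolding torus_data_def by blast
  qed
  ultimately show ?thesis by blast
qed

text \<open>
  The leaves in \<open>z = 0\<close>. On the transversal disc \<open>x\<close> is fixed, \<open>z\<close> varies and \<open>y\<close> is a root of
  \<open>(z\<^sup>m - t) / x0\<^sup>k\<close>.
\<close>

lemma torus_slice:
  assumes p0: "(x0, y0, 0) \<in> L" and x0: "cmod x0 = \<alpha>"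
  shows "\<exists>D P. open D \<and> continuous_on D P \<and> P ` D \<subseteq> L \<and> edge_type \<alpha> D P \<and> torus_data (x0, y0, 0) D P"
proof -
  have xy: "x0 ^ k * y0 ^ l = - t" using p0 m by (simp add: mem_L power_0_left eq_neg_iff_add_eq_0 add.commute)
  have nz: "x0 \<noteq> 0" "y0 \<noteq> 0" using not_both_zero(1)[OF p0] by auto
  obtain \<theta> where \<theta>: "x0 = of_real \<alpha> * cis \<theta>" using polar_form[of x0] x0 by metis
  have "min (cmod t) (\<alpha> ^ (k + l) - cmod t) > 0" "m \<ge> 1" using t t_less m by auto
  then obtain \<delta> where \<delta>: "\<delta> > 0" "\<delta> ^ m < min (cmod t) (\<alpha> ^ (k + l) - cmod t)"
    using small_radius[OF zero_less_one] by blast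
  define W where "W z = (t - z ^ m) / t" for z
  define Y where "Y z = y0 * principal_root l (W z)" for z
  have W: "cmod (W z - 1) < 1" "cmod (t - z ^ m) < \<alpha> ^ (k + l)" if "cmod z < \<delta>" for z
  proof -
    have zm: "cmod (z ^ m) < min (cmod t) (\<alpha> ^ (k + l) - cmod t)"
      using power_mono[of "cmod z" \<delta> m] that \<delta>(2) by (simp add: norm_power)
    have "W z - 1 = - (z ^ m / t)" using t by (simp add: W_def field_simps)
    then have "cmod (W z - 1) = cmod (z ^ m) / cmod t" by (simp add: norm_divide)
    then show "cmod (W z - 1) < 1" using zm t by simp
    show "cmod (t - z ^ m) < \<alpha> ^ (k + l)" using norm_triangle_ineq4[of t "z ^ m"] zm by simp
  qed
  have Yl: "x0 ^ k * Y z ^ l = z ^ m - t" if "cmod (W z - 1) < 1" for z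
  proof -
    have "x0 ^ k * Y z ^ l = (x0 ^ k * y0 ^ l) * W z"
      using principal_root(1)[OF l near_one(2)[OF that]] by (simp add: Y_def power_mult_distrib)
    then show ?thesis unfolding xy using t by (simp add: W_def)
  qed
  have Ynz: "Y z \<noteq> 0" for z using nz principal_root(2) by (simp add: Y_def)
  have Yless: "cmod (Y z) < \<alpha>" if "cmod (W z - 1) < 1" "cmod (t - z ^ m) < \<alpha> ^ (k + l)" for z
  proof -
    have "\<alpha> ^ k * cmod (Y z) ^ l = cmod (z ^ m - t)"
      using Yl[OF that(1)] x0 by (metis norm_mult norm_power)
    also have "\<dots> < \<alpha> ^ k * \<alpha> ^ l" using that(2) by (simp add: norm_minus_commute power_add)
    finally have "cmod (Y z) ^ l < \<alpha> ^ l" using \<alpha> by simp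
    then show ?thesis by (rule power_less_imp_less_base) (use \<alpha> in simp)
  qed
  define D where "D = {v::real^3. cmod (W (Complex (v$2) (v$3)) - 1) < 1 \<and> cmod (t - Complex (v$2) (v$3) ^ m) < \<alpha> ^ (k + l)}"
  \<comment> \<open>Along an orbit the argument of \<open>y\<close> changes \<open>-k' / l'\<close> times as fast as that of \<open>x\<close>.\<close>
  define P where "P v = (of_real \<alpha> * cis (v$1),
      cis (- (real k' / real l' * (v$1 - \<theta>))) * Y (Complex (v$2) (v$3)), Complex (v$2) (v$3))" for v :: "real^3"
  have "open D"
    unfolding D_def W_def Complex_eq by (intro open_Collect_conj open_Collect_less continuous_intros) (use t in auto)
  moreover have "continuous_on D P"
  proof -
    have "continuous_on D (\<lambda>v. W (Complex (v$2) (v$3)))"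
      unfolding W_def Complex_eq by (intro continuous_intros) (use t in auto)
    then have "continuous_on D (\<lambda>v. principal_root l (W (Complex (v$2) (v$3))))"
      by (rule continuous_on_principal_root) (use l in \<open>auto simp: D_def\<close>)
    then show ?thesis unfolding P_def Y_def Complex_eq by (intro continuous_intros)
  qed
  moreover have "P ` D \<subseteq> L"
  proof (rule image_subsetI)
    fix v assume v: "v \<in> D"
    let ?z = "Complex (v$2) (v$3)"
    have lk: "real l * (real k' / real l') = real k"
      using reduced_exponents(2,4) by (simp add: field_simps) (metis of_nat_mult)
    have "(of_real \<alpha> * cis (v$1)) ^ k * (cis (- (real k' / real l' * (v$1 - \<theta>))) * Y ?z) ^ l
      = of_real (\<alpha> ^ k) * (cis (real k * v$1) * cis (real l * - (real k' / real l' * (v$1 - \<theta>)))) * Y ?z ^ l"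
      by (simp add: power_mult_distrib Complex.DeMoivre mult_ac)
    also have "cis (real k * v$1) * cis (real l * - (real k' / real l' * (v$1 - \<theta>))) = cis (real k * \<theta>)"
    proof -
      have "real l * - (real k' / real l' * (v$1 - \<theta>)) = - (real k * (v$1 - \<theta>))"
        unfolding lk[symmetric] by (simp add: mult_ac)
      then show ?thesis by (simp add: cis_mult algebra_simps)
    qed
    also have "of_real (\<alpha> ^ k) * cis (real k * \<theta>) = x0 ^ k"
      by (simp add: \<theta> power_mult_distrib Complex.DeMoivre)
    finally have "?z ^ m = t + (of_real \<alpha> * cis (v$1)) ^ k * (cis (- (real k' / real l' * (v$1 - \<theta>))) * Y ?z) ^ l"
      using Yl[of ?z] v by (simp add: D_def)
    moreover have "cmod (Y ?z) < \<alpha>" using Yless[of ?z] v by (simp add: D_def)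
    ultimately show "P v \<in> L" using \<alpha> by (simp add: P_def mem_L norm_mult max_def)
  qed
  moreover have "edge_type \<alpha> D P"
    unfolding edge_type_def slice_type_def using Ynz Yless by (auto simp: P_def D_def norm_mult)
  moreover have "torus_data (x0, y0, 0) D P"
  proof (rule torus_dataI_free)
    define \<sigma> where "\<sigma> \<zeta> = (x0, Y (of_real \<delta> * \<zeta>), of_real \<delta> * \<zeta>)" for \<zeta>
    define T :: "real^3 \<Rightarrow> real^3" where "T v = vector [real l' * v$3, \<delta> * v$1, \<delta> * v$2]" for v
    have small: "cmod (of_real \<delta> * \<zeta>) < \<delta>" if "cmod \<zeta> < 1" for \<zeta>
      using that \<delta> by (auto simp: norm_mult)
    show "continuous_on (ball 0 1) \<sigma>"
    proof -
      have "continuous_on (ball 0 1) (\<lambda>\<zeta>. W (of_real \<delta> * \<zeta>))"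
        unfolding W_def by (intro continuous_intros) (use t in auto)
      then have "continuous_on (ball 0 1) (\<lambda>\<zeta>. principal_root l (W (of_real \<delta> * \<zeta>)))"
        by (rule continuous_on_principal_root) (use l W small in auto)
      then show ?thesis unfolding \<sigma>_def Y_def by (intro continuous_intros)
    qed
    show "\<zeta> = \<zeta>' \<and> u = u'" if "cmod u = 1" "cmod u' = 1" "act u (\<sigma> \<zeta>) = act u' (\<sigma> \<zeta>')" for \<zeta> \<zeta>' u u'
    proof -
      have z: "\<zeta> = \<zeta>'" using that(3) \<delta> by (simp add: \<sigma>_def act_simp)
      then have "u ^ l' = u' ^ l'" "u ^ k' = u' ^ k'"
        using that(3) nz Ynz by (auto simp: \<sigma>_def act_simp power_inverse)
      moreover have "u' \<noteq> 0" using that by auto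
      ultimately show ?thesis using z coprime_power_inj[OF reduced_exponents(1,3)] by blast
    qed
    show "linear T"
      by (auto simp: T_def linear_iff vec_eq_iff forall_3 algebra_simps)
    show "det (matrix T) \<noteq> 0"
      using \<delta> reduced_exponents(4) by (simp add: det_3 matrix_def T_def axis_def)
    show "T v + vector [\<theta>, 0, 0] \<in> D \<and>
        act (cis (v$3)) (\<sigma> (Complex (v$1) (v$2))) = P (T v + vector [\<theta>, 0, 0])"
      if v: "cmod (Complex (v$1) (v$2)) < 1" for v
    proof -
      have e: "of_real \<alpha> * cis (real l' * v$3 + \<theta>) = cis (v$3) ^ l' * x0"
        unfolding \<theta> by (simp add: cis_mult[symmetric] Complex.DeMoivre)
      have e': "Complex (\<delta> * v$1) (\<delta> * v$2) = of_real \<delta> * Complex (v$1) (v$2)" by (simp add: of_real_mult_Complex)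
      show ?thesis
        using W[OF small[OF v]] reduced_exponents(4)
        by (simp add: D_def P_def T_def \<sigma>_def act_simp e e' Complex.DeMoivre)
    qed
    show "\<sigma> 0 = (x0, y0, 0)" using t m principal_root(3) by (simp add: \<sigma>_def Y_def W_def power_0_left)
  qed
  ultimately show ?thesis by blast
qed

text \<open>
  The remaining leaves, among them those in the corner. On the transversal disc the argument of \<open>x\<close> is
  fixed, while \<open>\<bar>x\<bar> - \<bar>y\<bar>\<close> and the argument of \<open>y\<close> vary. Comparing arguments of \<open>x\<close> determines \<open>u\<close> only up
  to an \<open>l'\<close>-th root of unity. This ambiguity disappears from the \<open>l'\<close>-th power of \<open>y\<close>, which
  determines the argument of \<open>y\<close> on the disc provided \<open>l' \<delta> \<le> 1\<close>.
\<close>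

lemma torus_corner:
  assumes p0: "(x0, y0, z0) \<in> L" and nz: "x0 \<noteq> 0" "y0 \<noteq> 0" "z0 \<noteq> 0"
  shows "\<exists>D P. admissible L \<alpha> D P \<and> torus_data (x0, y0, z0) D P"
proof -
  define h0 where "h0 = cmod x0 - cmod y0"
  define rx where "rx h = min \<alpha> (\<alpha> + h)" for h
  define ry where "ry h = min \<alpha> (\<alpha> - h)" for h
  have mx: "max (cmod x0) (cmod y0) = \<alpha>" and zm: "z0 ^ m = t + x0 ^ k * y0 ^ l" using p0 by (auto simp: mem_L)
  have r0: "rx h0 = cmod x0" "ry h0 = cmod y0" and h0: "\<bar>h0\<bar> < \<alpha>"
    using mx nz \<alpha> by (auto simp: rx_def ry_def h0_def max_def split: if_splits)
  obtain a where a: "x0 = of_real (rx h0) * cis a" using polar_form[of x0] r0 by metis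
  obtain b where b: "y0 = of_real (ry h0) * cis b" using polar_form[of y0] r0 by metis
  define W where "W x y = (t + x ^ k * y ^ l) / z0 ^ m" for x y
  define Z where "Z x y = z0 * principal_root m (W x y)" for x y
  have Zm: "Z x y ^ m = t + x ^ k * y ^ l" if "cmod (W x y - 1) < 1" for x y
    using principal_root(1)[of m "W x y"] near_one(2)[OF that] m nz
    by (simp add: Z_def power_mult_distrib W_def)
  have Znz: "Z x y \<noteq> 0" for x y using nz principal_root(2) by (simp add: Z_def)
  define X where "X s = of_real (rx (h0 + Re s)) * cis a" for s
  define Y where "Y s = of_real (ry (h0 + Re s)) * cis (b + Im s)" for s
  have "continuous_on UNIV (\<lambda>s. W (X s) (Y s))"
    unfolding W_def X_def Y_def rx_def ry_def by (intro continuous_intros) (use nz in auto)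
  then have "isCont (\<lambda>s. W (X s) (Y s)) 0" by (simp add: continuous_on_eq_continuous_at)
  moreover have W0: "W (X 0) (Y 0) = 1"
  proof -
    have "X 0 = x0" "Y 0 = y0" using a b by (simp_all add: X_def Y_def)
    then show ?thesis unfolding W_def using zm nz by (metis divide_self power_not_zero)
  qed
  ultimately obtain d where d: "d > 0" "\<And>s. cmod s < d \<Longrightarrow> cmod (W (X s) (Y s) - 1) < 1"
    unfolding continuous_at_eps_delta using zero_less_one[where 'a = real] by (metis dist_norm diff_zero)
  \<comment> \<open>The disc has to stay in the domain of the root, short of the axes, and within an angle that
    \<open>l'\<close>-th powers do not identify.\<close>
  define \<delta> where "\<delta> = min d (min (\<alpha> - \<bar>h0\<bar>) (1 / real l'))"
  have \<delta>: "\<delta> > 0" "\<delta> \<le> d" "\<delta> \<le> \<alpha> - \<bar>h0\<bar>" "real l' * \<delta> \<le> 1"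
  proof -
    have "\<delta> \<le> 1 / real l'" by (simp add: \<delta>_def)
    then show "real l' * \<delta> \<le> 1" using reduced_exponents(4) by (simp add: field_simps)
  qed (use d h0 reduced_exponents(4) in \<open>auto simp: \<delta>_def\<close>)
  define D where "D = {v::real^3. \<bar>v$3\<bar> < \<alpha> \<and>
      cmod (W (of_real (rx (v$3)) * cis (v$1)) (of_real (ry (v$3)) * cis (v$2)) - 1) < 1}"
  define P where "P v = (of_real (rx (v$3)) * cis (v$1), of_real (ry (v$3)) * cis (v$2),
      Z (of_real (rx (v$3)) * cis (v$1)) (of_real (ry (v$3)) * cis (v$2)))" for v :: "real^3"
  have "open D"
    unfolding D_def W_def rx_def ry_def
    by (intro open_Collect_conj open_Collect_less continuous_intros) (use nz in auto)
  moreover have "continuous_on D P"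
  proof -
    have "continuous_on D (\<lambda>v. W (of_real (rx (v$3)) * cis (v$1)) (of_real (ry (v$3)) * cis (v$2)))"
      unfolding W_def rx_def ry_def by (intro continuous_intros) (use nz in auto)
    then have "continuous_on D (\<lambda>v. principal_root m (W (of_real (rx (v$3)) * cis (v$1)) (of_real (ry (v$3)) * cis (v$2))))"
      by (rule continuous_on_principal_root) (use m in \<open>auto simp: D_def\<close>)
    then show ?thesis unfolding P_def Z_def rx_def ry_def by (intro continuous_intros)
  qed
  moreover have "P ` D \<subseteq> L"
  proof (rule image_subsetI)
    fix v assume v: "v \<in> D"
    then have "\<bar>v$3\<bar> < \<alpha>" by (simp add: D_def)
    then have "max \<bar>rx (v$3)\<bar> \<bar>ry (v$3)\<bar> = \<alpha>" using \<alpha> by (auto simp: rx_def ry_def max_def min_def abs_if)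
    then show "P v \<in> L" using Zm v by (simp add: P_def mem_L norm_mult D_def)
  qed
  moreover have "corner_type \<alpha> D P"
    unfolding corner_type_def using Znz by (auto simp: P_def D_def rx_def ry_def)
  ultimately have adm: "admissible L \<alpha> D P" by (simp add: admissible_def)
  have "torus_data (x0, y0, z0) D P"
  proof (rule torus_dataI_free)
    define \<sigma> where "\<sigma> \<zeta> = (X (of_real \<delta> * \<zeta>), Y (of_real \<delta> * \<zeta>), Z (X (of_real \<delta> * \<zeta>)) (Y (of_real \<delta> * \<zeta>)))" for \<zeta>
    define T :: "real^3 \<Rightarrow> real^3" where "T v = vector [real l' * v$3, \<delta> * v$2 - real k' * v$3, \<delta> * v$1]" for v
    have W: "cmod (W (X (of_real \<delta> * \<zeta>)) (Y (of_real \<delta> * \<zeta>)) - 1) < 1" if "cmod \<zeta> < 1" for \<zeta>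
    proof -
      have "cmod (of_real \<delta> * \<zeta>) < \<delta>" using that \<delta>(1) by (simp add: norm_mult)
      then show ?thesis using \<delta>(2) by (intro d) simp
    qed
    have small: "\<bar>h0 + \<delta> * Re \<zeta>\<bar> < \<alpha>" "\<bar>real l' * (\<delta> * Im \<zeta>)\<bar> < 1" if "cmod \<zeta> < 1" for \<zeta>
    proof -
      have "\<bar>Re \<zeta>\<bar> < 1" "\<bar>Im \<zeta>\<bar> < 1" using abs_Re_le_cmod[of \<zeta>] abs_Im_le_cmod[of \<zeta>] that by linarith+
      then have r: "\<bar>\<delta> * Re \<zeta>\<bar> < \<delta>" and i: "\<bar>\<delta> * Im \<zeta>\<bar> < \<delta>" using \<delta>(1) by (auto simp: abs_mult)
      show "\<bar>h0 + \<delta> * Re \<zeta>\<bar> < \<alpha>" using r \<delta>(3) by linarith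
      have "\<bar>real l' * (\<delta> * Im \<zeta>)\<bar> = real l' * \<bar>\<delta> * Im \<zeta>\<bar>" by (simp add: abs_mult)
      also have "\<dots> < real l' * \<delta>" using i reduced_exponents(4) by (intro mult_strict_left_mono) auto
      finally show "\<bar>real l' * (\<delta> * Im \<zeta>)\<bar> < 1" using \<delta>(4) by linarith
    qed
    show "continuous_on (ball 0 1) \<sigma>"
    proof -
      have "continuous_on (ball 0 1) (\<lambda>\<zeta>. W (X (of_real \<delta> * \<zeta>)) (Y (of_real \<delta> * \<zeta>)))"
        unfolding W_def X_def Y_def rx_def ry_def by (intro continuous_intros) (use nz in auto)
      then have "continuous_on (ball 0 1) (\<lambda>\<zeta>. principal_root m (W (X (of_real \<delta> * \<zeta>)) (Y (of_real \<delta> * \<zeta>))))"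
        by (rule continuous_on_principal_root) (use m W in auto)
      then show ?thesis unfolding \<sigma>_def Z_def X_def Y_def rx_def ry_def by (intro continuous_intros)
    qed
    show "\<zeta> = \<zeta>' \<and> u = u'"
      if ball: "\<zeta> \<in> ball 0 1" "\<zeta>' \<in> ball 0 1" and u: "cmod u = 1" "cmod u' = 1"
        and eq: "act u (\<sigma> \<zeta>) = act u' (\<sigma> \<zeta>')" for \<zeta> \<zeta>' u u'
    proof -
      let ?h = "h0 + \<delta> * Re \<zeta>" and ?h' = "h0 + \<delta> * Re \<zeta>'"
      have h: "\<bar>?h\<bar> < \<alpha>" "\<bar>?h'\<bar> < \<alpha>" using small(1) ball by auto
      have unz: "u \<noteq> 0" "u' \<noteq> 0" using u by auto
      have x: "u ^ l' * (of_real (rx ?h) * cis a) = u' ^ l' * (of_real (rx ?h') * cis a)"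
        and y: "inverse u ^ k' * (of_real (ry ?h) * cis (b + \<delta> * Im \<zeta>)) = inverse u' ^ k' * (of_real (ry ?h') * cis (b + \<delta> * Im \<zeta>'))"
        using eq by (auto simp: \<sigma>_def act_simp X_def Y_def)
      have "rx ?h = rx ?h'" "ry ?h = ry ?h'"
        using arg_cong[OF x, of cmod] arg_cong[OF y, of cmod] u h
        by (auto simp: norm_mult norm_power norm_inverse rx_def ry_def min_def abs_if split: if_splits)
      moreover have "rx h - ry h = h" if "\<bar>h\<bar> < \<alpha>" for h using that by (auto simp: rx_def ry_def min_def)
      ultimately have hh: "?h = ?h'" using h by metis
      then have re: "Re \<zeta> = Re \<zeta>'" using \<delta>(1) by simp
      have pos: "rx ?h \<noteq> 0" "ry ?h \<noteq> 0" using h by (auto simp: rx_def ry_def min_def)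
      have ul: "u ^ l' = u' ^ l'" using x pos hh by simp
      have yy: "inverse u ^ k' * cis (b + \<delta> * Im \<zeta>) = inverse u' ^ k' * cis (b + \<delta> * Im \<zeta>')"
        using y pos hh by simp
      have il: "(inverse u ^ k') ^ l' = (inverse u' ^ k') ^ l'"
      proof -
        have "(inverse w ^ k') ^ l' = inverse (w ^ l') ^ k'" for w :: complex
          by (simp add: power_inverse power_mult[symmetric] mult.commute)
        then show ?thesis by (simp add: ul)
      qed
      have "(inverse u ^ k') ^ l' * cis (b + \<delta> * Im \<zeta>) ^ l' = (inverse u' ^ k') ^ l' * cis (b + \<delta> * Im \<zeta>') ^ l'"
        using yy by (metis power_mult_distrib)
      then have "cis (real l' * (b + \<delta> * Im \<zeta>)) = cis (real l' * (b + \<delta> * Im \<zeta>'))"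
        using il unz by (simp add: Complex.DeMoivre)
      moreover have "\<bar>real l' * (b + \<delta> * Im \<zeta>) - real l' * (b + \<delta> * Im \<zeta>')\<bar> < 2 * pi"
        using small(2)[of \<zeta>] small(2)[of \<zeta>'] ball pi_gt3 by (simp add: algebra_simps)
      ultimately have "real l' * (b + \<delta> * Im \<zeta>) = real l' * (b + \<delta> * Im \<zeta>')" by (rule cis_inj_small)
      then have im: "Im \<zeta> = Im \<zeta>'" using reduced_exponents(4) \<delta>(1) by simp
      then have "u ^ k' = u' ^ k'" using yy by (simp add: power_inverse)
      then show ?thesis using coprime_power_inj[OF reduced_exponents(1,3) _ ul unz(2)] re im by (simp add: complex_eq_iff)
    qed
    show "linear T"
      by (auto simp: T_def linear_iff vec_eq_iff forall_3 algebra_simps)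
    show "det (matrix T) \<noteq> 0"
      using \<delta> reduced_exponents(4) by (simp add: det_3 matrix_def T_def axis_def)
    show "T v + vector [a, b, h0] \<in> D \<and>
        act (cis (v$3)) (\<sigma> (Complex (v$1) (v$2))) = P (T v + vector [a, b, h0])"
      if v: "cmod (Complex (v$1) (v$2)) < 1" for v
    proof -
      let ?s = "of_real \<delta> * Complex (v$1) (v$2)" and ?p = "T v + vector [a, b, h0]"
      have x: "of_real (rx (?p$3)) * cis (?p$1) = cis (v$3) ^ l' * X ?s"
        by (simp add: T_def X_def Complex.DeMoivre cis_mult add.commute mult_ac)
      have y: "of_real (ry (?p$3)) * cis (?p$2) = inverse (cis (v$3)) ^ k' * Y ?s"
        unfolding inverse_cis_power by (simp add: T_def Y_def cis_mult algebra_simps)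
      have "W (cis (v$3) ^ l' * X ?s) (inverse (cis (v$3)) ^ k' * Y ?s) = W (X ?s) (Y ?s)"
        using monomial_invariant[OF cis_neq_zero] by (simp add: W_def)
      then show ?thesis
        using W[OF v] small(1)[OF v] x y
        by (simp add: D_def P_def \<sigma>_def act_simp Z_def) (simp add: T_def add.commute)
    qed
    show "\<sigma> 0 = (x0, y0, z0)" using W0 principal_root(3) a b by (simp add: \<sigma>_def Z_def) (simp add: X_def Y_def)
  qed
  with adm show ?thesis by blast
qed

lemma torus_data_exists:
  assumes p0: "p0 \<in> L"
  shows "\<exists>D P. admissible L \<alpha> D P \<and> torus_data p0 D P"
proof -
  interpret s: milnor m l k \<alpha> \<epsilon> t by (rule swapped)
  obtain x y z where p: "p0 = (x, y, z)" by (cases p0)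
  have edge: ?thesis if "\<exists>D P. open D \<and> continuous_on D P \<and> P ` D \<subseteq> L \<and> edge_type \<alpha> D P \<and> torus_data p0 D P"
    using that unfolding admissible_def by blast
  have swapped_edge: ?thesis
    if "\<exists>D P. open D \<and> continuous_on D P \<and> P ` D \<subseteq> s.L \<and> edge_type \<alpha> D P \<and> s.torus_data (swap_xy p0) D P"
  proof -
    from that obtain D P where P: "open D" "continuous_on D P" "P ` D \<subseteq> s.L" "edge_type \<alpha> D P" "s.torus_data (swap_xy p0) D P"
      by blast
    have "swap_xy \<circ> (swap_xy \<circ> P) = P" by auto
    moreover have "(swap_xy \<circ> P) ` D \<subseteq> L"
    proof (rule image_subsetI)
      fix v assume "v \<in> D"
      then have "P v \<in> s.L" using P(3) by blast
      then show "(swap_xy \<circ> P) v \<in> L" by (simp only: comp_apply swap_xy_L)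
    qed
    ultimately have "admissible L \<alpha> D (swap_xy \<circ> P)"
      using P swap_xy_continuous[OF P(2)] unfolding admissible_def by simp
    then show ?thesis using torus_data_swapped[OF P(5)] by blast
  qed
  have ps: "(y, x, z) \<in> s.L" using p0 unfolding s.swap_xy_L[symmetric] p by simp
  consider "y = 0" | "x = 0" | "z = 0" "cmod x = \<alpha>" | "z = 0" "cmod y = \<alpha>" | "x \<noteq> 0" "y \<noteq> 0" "z \<noteq> 0"
    using p0 unfolding p mem_L max_def by metis
  then show ?thesis
  proof cases
    case 1
    then show ?thesis using edge torus_disc p0 p by blast
  next
    case 2
    then show ?thesis using swapped_edge s.torus_disc ps p by simp
  next
    case 3
    then show ?thesis using edge torus_slice p0 p by blast
  next
    case 4
    then show ?thesis using swapped_edge s.torus_slice ps p by simp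
  next
    case 5
    then show ?thesis using torus_corner p0 p by blast
  qed
qed

end

section \<open>The Seifert structure of the boundary\<close>

context milnor begin

lemma milnor_boundary_seifert:
  "smoothed_boundary_atlas (germ m k l) \<alpha> \<epsilon> t atlas \<and> seifert_manifold (top_of_set L) atlas (orbit ` L) \<and>
    (\<forall>C\<in>orbit ` L. \<exists>c. \<forall>(x, y, z)\<in>C. z = c)"
proof -
  have cover: "\<exists>D P v. admissible L \<alpha> D P \<and> v \<in> D \<and> P v = p" if "p \<in> L" for p
    using torus_data_exists[OF that] torus_data_covers by blast
  have "fibred_torus_nbhd (top_of_set L) atlas (orbit ` L) C" if "C \<in> orbit ` L" for C
    using that torus_data_exists torus_data_fibred_nbhd by blast
  moreover have "\<exists>c. \<forall>(x, y, z)\<in>orbit p. z = c" for p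
    by (cases p) (auto simp: orbit_def act_simp)
  ultimately show ?thesis
    using atlas_smoothed_boundary[OF cover] L_closed_oriented_manifold[OF cover] orbit_partition
    unfolding seifert_manifold_def by simp
qed

end

theorem theorem3p1:
  fixes m k l :: nat and \<alpha> \<epsilon> :: real
  assumes "m \<ge> 2" and "1 \<le> k" and "k \<le> l" and "gcd m (gcd k l) = 1"
    and "0 < \<alpha>" and "\<alpha> \<le> \<epsilon>" and "\<alpha> ^ (k + l) < \<epsilon> ^ m"
  shows "\<exists>\<eta>\<^sub>0>0. \<forall>\<eta> t. 0 < \<eta> \<longrightarrow> \<eta> \<le> \<eta>\<^sub>0 \<longrightarrow> admissible_radius (germ m k l) \<alpha> \<epsilon> \<eta> \<longrightarrow>
           0 < cmod t \<longrightarrow> cmod t \<le> \<eta> \<longrightarrow>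
           (\<exists>A \<F>. smoothed_boundary_atlas (germ m k l) \<alpha> \<epsilon> t A \<and>
              seifert_manifold (top_of_set (milnor_boundary (germ m k l) \<alpha> \<epsilon> t)) A \<F> \<and>
              (\<forall>C\<in>\<F>. \<exists>c. \<forall>(x, y, z)\<in>C. z = c))"
proof -
  define \<eta>0 where "\<eta>0 = min (\<alpha> ^ (k + l)) (\<epsilon> ^ m - \<alpha> ^ (k + l)) / 2"
  have pos: "\<eta>0 > 0" using assms by (simp add: \<eta>0_def)
  have "\<exists>A \<F>. smoothed_boundary_atlas (germ m k l) \<alpha> \<epsilon> t A \<and>
      seifert_manifold (top_of_set (milnor_boundary (germ m k l) \<alpha> \<epsilon> t)) A \<F> \<and>
      (\<forall>C\<in>\<F>. \<exists>c. \<forall>(x, y, z)\<in>C. z = c)" if t: "0 < cmod t" "cmod t \<le> \<eta>0" for t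
  proof -
    have "cmod t < \<alpha> ^ (k + l)" "\<alpha> ^ (k + l) + cmod t < \<epsilon> ^ m"
      using t(2) pos by (auto simp: \<eta>0_def min_def split: if_splits)
    then interpret milnor m k l \<alpha> \<epsilon> t
      using assms t by unfold_locales auto
    show ?thesis using milnor_boundary_seifert by blast
  qed
  then show ?thesis using pos by (intro exI[of _ \<eta>0]) force
qed

end
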